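(* There is an algorithm that, given an ADMG $G$ with $p$ nodes and $m$ edges and distinct nodes $x,y$ of $G$, runs in time $O(p\cdot(p+m))$ and returns a pair $(z,W)$, with $z$ a node and $W$ a node set, such that $(\{z\},W)$ is a valid conditional instrumental set relative to $(x,y)$ in $G$, whenever such a pair exists, and otherwise reports that no such pair exists.
   Context: An ADMG $G$ has a finite node set $V$, directed edges $u\to v$ and bidirected edges $u\leftrightarrow v$, with no directed cycle. A walk is a sequence of nodes $v_1,\dots,v_r$ with edges $e_i$ joining $v_i$ and $v_{i+1}$ (nodes may repeat). $\mathrm{de}_G(v)$ ($\mathrm{an}_G(v)$) is the set of nodes reachable from $v$ by a directed path (from which $v$ is reachable by a directed path), including $v$; for sets take unions. A non-endpoint occurrence on a walk is a collider if both incident walk edges have an arrowhead at it, otherwise a non-collider. A walk is open given $W$ if every collider is in $W$ and every non-collider is not in $W$. For disjoint $A,B,W$, $A\not\perp_G B\mid W$ if some walk from $A$ to $B$ is open given $W$, otherwise $A\perp_G B\mid W$. $\mathrm{causal}_G(x,y)=(\mathrm{de}_G(x)\cap\mathrm{an}_G(y))\setminus\{x\}$, $\mathrm{forb}_G(x,y)=\mathrm{de}_G(\mathrm{causal}_G(x,y))\cup\{x\}$, and $\tilde G$ is $G$ with all directed edges $x\to c$, $c\in\mathrm{causal}_G(x,y)$, removed. For pairwise disjoint $\{x,y\},Z,W$, $(Z,W)$ is a valid conditional instrumental set relative to $(x,y)$ in $G$ iff (a) $(Z\cup W)\cap\mathrm{forb}_G(x,y)=\emptyset$, (b) $x\not\perp_G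 Z\mid W$, and (c) $y\perp_{\tilde G} Z\mid W$. *)

theory Defs
  imports Main
begin

record 'a admg =
  nodes :: "'a set"
  dir   :: "('a \<times> 'a) set"   (* (u,v) means u \<rightarrow> v *)
  bi    :: "('a \<times> 'a) set"   (* symmetric; (u,v) and (v,u) both mean u \<leftrightarrow> v *)

definition wf_admg :: "'a admg \<Rightarrow> bool" where
  "wf_admg G \<longleftrightarrow> finite (nodes G) \<and> dir G \<subseteq> nodes G \<times> nodes G
     \<and> bi G \<subseteq> nodes G \<times> nodes G \<and> sym (bi G) \<and> (\<forall>v. (v, v) \<notin> bi G)
     \<and> acyclic (dir G)"

datatype 'a edge = Dir 'a 'a | Bi 'a 'a

fun edge_in :: "'a admg \<Rightarrow> 'a edge \<Rightarrow> bool" where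
  "edge_in G (Dir u v) = ((u, v) \<in> dir G)"
| "edge_in G (Bi u v) = ((u, v) \<in> bi G)"

fun joins :: "'a edge \<Rightarrow> 'a \<Rightarrow> 'a \<Rightarrow> bool" where
  "joins (Dir u v) a b = ((u = a \<and> v = b) \<or> (u = b \<and> v = a))"
| "joins (Bi u v) a b = ((u = a \<and> v = b) \<or> (u = b \<and> v = a))"

fun arrow_at :: "'a edge \<Rightarrow> 'a \<Rightarrow> bool" where
  "arrow_at (Dir u v) w = (w = v)"
| "arrow_at (Bi u v) w = (w = u \<or> w = v)"

definition is_walk :: "'a admg \<Rightarrow> 'a list \<Rightarrow> 'a edge list \<Rightarrow> bool" where
  "is_walk G vs es \<longleftrightarrow> vs \<noteq> [] \<and> length es = length vs - 1 \<and> set vs \<subseteq> nodes G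
     \<and> (\<forall>i < length es. edge_in G (es ! i) \<and> joins (es ! i) (vs ! i) (vs ! Suc i))"

definition collider :: "'a list \<Rightarrow> 'a edge list \<Rightarrow> nat \<Rightarrow> bool" where
  "collider vs es i \<longleftrightarrow> arrow_at (es ! (i - 1)) (vs ! i) \<and> arrow_at (es ! i) (vs ! i)"

definition open_walk :: "'a admg \<Rightarrow> 'a set \<Rightarrow> 'a list \<Rightarrow> 'a edge list \<Rightarrow> bool" where
  "open_walk G W vs es \<longleftrightarrow> is_walk G vs es \<and>
     (\<forall>i. 0 < i \<and> i < length vs - 1 \<longrightarrow>
        (collider vs es i \<longrightarrow> vs ! i \<in> W) \<and> (\<not> collider vs es i \<longrightarrow> vs ! i \<notin> W))"

definition d_connected :: "'a admg \<Rightarrow> 'a set \<Rightarrow> 'a set \<Rightarrow> 'a set \<Rightarrow> bool" where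
  "d_connected G A B W \<longleftrightarrow> (\<exists>vs es. open_walk G W vs es \<and> hd vs \<in> A \<and> last vs \<in> B)"

definition d_separated :: "'a admg \<Rightarrow> 'a set \<Rightarrow> 'a set \<Rightarrow> 'a set \<Rightarrow> bool" where
  "d_separated G A B W \<longleftrightarrow> \<not> d_connected G A B W"

definition de :: "'a admg \<Rightarrow> 'a \<Rightarrow> 'a set" where
  "de G v = {w. (v, w) \<in> (dir G)\<^sup>*}"

definition an :: "'a admg \<Rightarrow> 'a \<Rightarrow> 'a set" where
  "an G v = {w. (w, v) \<in> (dir G)\<^sup>*}"

definition de_set :: "'a admg \<Rightarrow> 'a set \<Rightarrow> 'a set" where
  "de_set G S = (\<Union>v\<in>S. de G v)"

definition causal :: "'a admg \<Rightarrow> 'a \<Rightarrow> 'a \<Rightarrow> 'a set" where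
  "causal G x y = (de G x \<inter> an G y) - {x}"

definition forb :: "'a admg \<Rightarrow> 'a \<Rightarrow> 'a \<Rightarrow> 'a set" where
  "forb G x y = de_set G (causal G x y) \<union> {x}"

definition tilde :: "'a admg \<Rightarrow> 'a \<Rightarrow> 'a \<Rightarrow> 'a admg" where
  "tilde G x y = G\<lparr> dir := dir G - {(x, c) | c. c \<in> causal G x y} \<rparr>"

text \<open>Valid conditional instrumental set (Z, W) relative to (x, y); the standing
  requirement that {x,y}, Z, W are pairwise disjoint sets of nodes is included.\<close>
definition valid_cis :: "'a admg \<Rightarrow> 'a \<Rightarrow> 'a \<Rightarrow> 'a set \<Rightarrow> 'a set \<Rightarrow> bool" where
  "valid_cis G x y Z W \<longleftrightarrow>
     x \<in> nodes G \<and> y \<in> nodes G \<and> x \<noteq> y \<and> Z \<subseteq> nodes G \<and> W \<subseteq> nodes G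
     \<and> {x, y} \<inter> Z = {} \<and> {x, y} \<inter> W = {} \<and> Z \<inter> W = {}
     \<and> (Z \<union> W) \<inter> forb G x y = {}
     \<and> d_connected G {x} Z W
     \<and> d_separated (tilde G x y) {y} Z W"

datatype instr =
    Const nat int
  | Add nat nat nat
  | Sub nat nat nat
  | Load nat nat
  | Store nat nat
  | Jz nat nat
  | Jmp nat
  | Halt

type_synonym state = "nat \<times> (nat \<Rightarrow> int)"

definition halted :: "instr list \<Rightarrow> state \<Rightarrow> bool" where
  "halted P s \<longleftrightarrow> fst s \<ge> length P \<or> P ! fst s = Halt"

fun exec :: "instr \<Rightarrow> state \<Rightarrow> state" where
  "exec (Const r k) (pc, m) = (Suc pc, m(r := k))"
| "exec (Add r a b) (pc, m) = (Suc pc, m(r := m a + m b))"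
| "exec (Sub r a b) (pc, m) = (Suc pc, m(r := m a - m b))"
| "exec (Load r a) (pc, m) = (Suc pc, m(r := m (nat (m a))))"
| "exec (Store a r) (pc, m) = (Suc pc, m(nat (m a) := m r))"
| "exec (Jz r l) (pc, m) = (if m r = 0 then l else Suc pc, m)"
| "exec (Jmp l) (pc, m) = (l, m)"
| "exec Halt s = s"

fun steps :: "instr list \<Rightarrow> state \<Rightarrow> nat \<Rightarrow> state" where
  "steps P s 0 = s"
| "steps P s (Suc n) = (if halted P s then s else steps P (exec (P ! fst s) s) n)"

text \<open>Input encoding of an ADMG on nodes 0..p-1 with distinguished x, y:
  memory cells hold p, #directed edges, #bidirected edges, x, y, then the directed
  edges as consecutive pairs (tail, head), then the bidirected edges as pairs;
  all other cells are 0.\<close>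
definition input_list :: "nat \<Rightarrow> nat \<Rightarrow> nat \<Rightarrow> (nat \<times> nat) list \<Rightarrow> (nat \<times> nat) list \<Rightarrow> int list" where
  "input_list p x y ds bs =
     [int p, int (length ds), int (length bs), int x, int y]
     @ concat (map (\<lambda>(u, v). [int u, int v]) ds)
     @ concat (map (\<lambda>(u, v). [int u, int v]) bs)"

definition init_mem :: "nat \<Rightarrow> nat \<Rightarrow> nat \<Rightarrow> (nat \<times> nat) list \<Rightarrow> (nat \<times> nat) list \<Rightarrow> nat \<Rightarrow> int" where
  "init_mem p x y ds bs a = (let L = input_list p x y ds bs in if a < length L then L ! a else 0)"

definition output_correct :: "nat admg \<Rightarrow> nat \<Rightarrow> nat \<Rightarrow> nat \<Rightarrow> (nat \<Rightarrow> int) \<Rightarrow> bool" where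
  "output_correct G p x y m \<longleftrightarrow>
     (if m 0 \<noteq> 0
      then m 1 \<ge> 0 \<and> valid_cis G x y {nat (m 1)} {v. v < p \<and> m (2 + v) \<noteq> 0}
      else \<not> (\<exists>z W. valid_cis G x y {z} W))"

text \<open>ds lists the directed edges, bs lists every bidirected edge exactly once (in
  either orientation).\<close>
definition encodes :: "nat admg \<Rightarrow> nat \<Rightarrow> (nat \<times> nat) list \<Rightarrow> (nat \<times> nat) list \<Rightarrow> bool" where
  "encodes G p ds bs \<longleftrightarrow> nodes G = {..<p} \<and> distinct ds \<and> set ds = dir G
     \<and> distinct (map (\<lambda>(u, v). {u, v}) bs) \<and> set bs \<union> (set bs)\<inverse> = bi G"

end

(*
  Let H be G without the removed edges and R the set of nodes outside forb(x,y) and different from y.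
  If z and W avoid forb(x,y), connections of z to x given W need no removed edge, so (z,W) is valid iff
  z and W lie in R and z is connected to x and separated from y in H given W.

  If some pair (z,W) is valid, there is one with W inside A = an(y) Un an(z): a lowest node w of W
  outside A can be dropped, or it is a collider on the walk to x and (w, W - {w}) is valid.  For such z
  the set W may be replaced by the nodes of A Int R that are reachable from y by walks with colliders
  in A and non-colliders in A - R.  Hence it suffices to test this one set for every z, which takes
  three graph searches on states (node, entered through an arrowhead or not).

  The machine code is obtained by compiling a structured language with registers and unbounded arrays,
  the arrays being interleaved above the input; running times are counted in the source language.
*)
theory Submission
  imports Defs
begin

text \<open>Nodes may repeat on a walk and a collider must lie in the conditioning set itself, so
  openness is a local test on two consecutive edge marks; this is why a search on marked nodes
  decides connection in linear time. The price is that shrinking the conditioning set closes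
  colliders. \<open>conn_if_colliders_anc\<close> repairs such walks by running down to a descendant
  in the set and back. The canonical set is the separator nearest to \<open>y\<close>. If some
  ancestral \<open>W\<close> separates \<open>z\<close> from \<open>y\<close>, then a walk from
  \<open>z\<close> that is open given \<open>W\<close> has no non-collider in the canonical set,
  since that node would be joined to \<open>y\<close>. So replacing \<open>W\<close> by the
  canonical set blocks no connection to \<open>x\<close>, and one set per \<open>z\<close> stands
  for exponentially many. The machine has neither multiplication nor protected registers, and the
  input starts at cell 0. Hence strides and block sizes are powers of two reached by doubling, and
  the low input cells must be moved before they can serve as registers.\<close>

section \<open>Walks as transitions between marked nodes\<close>

text \<open>Each flag tells whether the edge has an arrowhead at the node just before it. A junction
  of two edges is a collider iff both flags at it hold, so the pair (node, entry flag) is all that a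
  walk has to remember.\<close>

inductive estep :: "'a admg \<Rightarrow> 'a \<Rightarrow> bool \<Rightarrow> 'a \<Rightarrow> bool \<Rightarrow> bool" for G where
  fwd: "(u, v) \<in> dir G \<Longrightarrow> estep G u False v True"
| bwd: "(v, u) \<in> dir G \<Longrightarrow> estep G u True v False"
| bid: "(u, v) \<in> bi G \<Longrightarrow> estep G u True v True"

text \<open>\<open>C\<close> holds the permitted colliders and \<open>N\<close> the permitted
  non-colliders. Openness given \<open>W\<close> is the case \<open>W\<close>, \<open>- W\<close>,
  but the proofs vary the two sets independently.\<close>

definition passes :: "'a set \<Rightarrow> 'a set \<Rightarrow> bool \<Rightarrow> 'a \<Rightarrow> bool \<Rightarrow> bool" where
  "passes C N a v b \<longleftrightarrow> (if a \<and> b then v \<in> C else v \<in> N)"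

inductive mwalk :: "'a admg \<Rightarrow> 'a set \<Rightarrow> 'a set \<Rightarrow> 'a \<Rightarrow> bool \<Rightarrow> 'a \<Rightarrow> bool \<Rightarrow> bool" for G C N u a where
  one: "estep G u a v b \<Longrightarrow> mwalk G C N u a v b"
| snoc: "mwalk G C N u a v b \<Longrightarrow> passes C N b v c \<Longrightarrow> estep G v c w d \<Longrightarrow> mwalk G C N u a w d"

text \<open>A walk in this sense has at least one edge, whereas a one-node list is a walk for
  \<open>is_walk\<close>; the two notions are therefore compared only for distinct
  endpoints.\<close>

definition conn :: "'a admg \<Rightarrow> 'a set \<Rightarrow> 'a \<Rightarrow> 'a \<Rightarrow> bool" where
  "conn G W u v \<longleftrightarrow> (\<exists>a b. mwalk G W (- W) u a v b)"

lemma mwalk_append: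
  assumes "mwalk G C N v c w d" "mwalk G C N u a v b" "passes C N b v c"
  shows "mwalk G C N u a w d"
  using assms
proof (induction rule: mwalk.induct)
  case (one w d)
  then show ?case by (meson mwalk.snoc)
next
  case (snoc w d e w' f)
  then show ?case by (meson mwalk.snoc)
qed

lemma estep_sym: "sym (bi G) \<Longrightarrow> estep G u a v b \<Longrightarrow> estep G v b u a"
  by (auto elim!: estep.cases intro: estep.intros dest: symD)

lemma passes_sym: "passes C N a v b \<Longrightarrow> passes C N b v a"
  by (auto simp: passes_def split: if_splits)

lemma mwalk_sym:
  assumes "sym (bi G)" "mwalk G C N u a v b"
  shows "mwalk G C N v b u a"
  using assms(2)
proof (induction rule: mwalk.induct)
  case (one v b)
  then show ?case by (meson assms(1) estep_sym mwalk.one)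
next
  case (snoc v b c w d)
  have "mwalk G C N w d v c" using snoc.hyps assms(1) estep_sym mwalk.one by metis
  with snoc.IH snoc.hyps(2) show ?case by (meson mwalk_append passes_sym)
qed

lemma mwalk_mono:
  assumes "mwalk G C N u a v b" "C \<subseteq> C'" "N \<subseteq> N'"
  shows "mwalk G C' N' u a v b"
  using assms(1)
proof (induction rule: mwalk.induct)
  case (snoc v b c w d)
  have "passes C' N' b v c" using snoc.hyps(2) assms(2,3) by (auto simp: passes_def split: if_splits)
  with snoc show ?case by (meson mwalk.snoc)
qed (rule mwalk.one)

lemma mwalk_nodes:
  assumes "mwalk G C N u a v b" "wf_admg G"
  shows "u \<in> nodes G \<and> v \<in> nodes G"
  using assms(1)
proof (induction rule: mwalk.induct)
  case (one v b)
  then show ?case using assms(2) by (auto simp: wf_admg_def elim!: estep.cases)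
next
  case (snoc v b c w d)
  then show ?case using assms(2) by (auto simp: wf_admg_def elim!: estep.cases)
qed

section \<open>Agreement with list walks\<close>

lemma wf_no_loop: "wf_admg G \<Longrightarrow> (v, v) \<notin> dir G \<and> (v, v) \<notin> bi G"
  by (auto simp: wf_admg_def acyclic_def)

text \<open>Well-formedness enters through the absence of loops: on a loop \<open>arrow_at\<close>
  cannot tell the two ends apart, and a directed loop would seem to have two arrowheads.\<close>

lemma estep_edge:
  assumes "wf_admg G" "edge_in G e" "joins e u v"
  shows "estep G u (arrow_at e u) v (arrow_at e v)"
proof (cases e)
  case (Dir s t)
  then have "s \<noteq> t" using assms wf_no_loop[of G] by auto
  with Dir assms show ?thesis by (auto intro: estep.intros)
next
  case (Bi s t)
  then have "s \<noteq> t" using assms wf_no_loop[of G] by auto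
  moreover have "(t, s) \<in> bi G" using Bi assms by (auto simp: wf_admg_def dest: symD)
  ultimately show ?thesis using Bi assms by (auto intro: estep.intros)
qed

lemma edge_of_estep:
  assumes "wf_admg G" "estep G u a v b"
  obtains e where "edge_in G e" "joins e u v" "arrow_at e u = a" "arrow_at e v = b" "u \<noteq> v"
  using assms(2)
proof cases
  case fwd
  then have "u \<noteq> v" using assms wf_no_loop by metis
  with fwd that[of "Dir u v"] show ?thesis by auto
next
  case bwd
  then have "u \<noteq> v" using assms wf_no_loop by metis
  with bwd that[of "Dir v u"] show ?thesis by auto
next
  case bid
  then have "u \<noteq> v" using assms wf_no_loop by metis
  with bid that[of "Bi u v"] show ?thesis by auto
qed

lemma open_walk_mwalk:
  assumes wf: "wf_admg G" and ow: "open_walk G W vs es"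
  shows "i < length es \<Longrightarrow>
    mwalk G W (- W) (vs ! 0) (arrow_at (es ! 0) (vs ! 0)) (vs ! Suc i) (arrow_at (es ! i) (vs ! Suc i))"
proof (induction i)
  case 0
  then show ?case
    using ow estep_edge[OF wf] by (auto simp: open_walk_def is_walk_def intro!: mwalk.one)
next
  case (Suc i)
  have st: "estep G (vs ! Suc i) (arrow_at (es ! Suc i) (vs ! Suc i)) (vs ! Suc (Suc i))
      (arrow_at (es ! Suc i) (vs ! Suc (Suc i)))"
    using ow estep_edge[OF wf] Suc.prems by (auto simp: open_walk_def is_walk_def)
  have "Suc i < length vs - 1" using ow Suc.prems by (simp add: open_walk_def is_walk_def)
  then have "passes W (- W) (arrow_at (es ! i) (vs ! Suc i)) (vs ! Suc i) (arrow_at (es ! Suc i) (vs ! Suc i))"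
    using ow by (auto simp: open_walk_def passes_def collider_def)
  then show ?case using Suc st by (meson Suc_lessD mwalk.snoc)
qed

lemma mwalk_open_walk:
  assumes wf: "wf_admg G" and "mwalk G W (- W) u a v b"
  shows "\<exists>vs es. open_walk G W vs es \<and> hd vs = u \<and> last vs = v \<and> es \<noteq> [] \<and> arrow_at (last es) v = b"
  using assms(2)
proof (induction rule: mwalk.induct)
  case (one v b)
  then obtain e where "edge_in G e" "joins e u v" "arrow_at e u = a" "arrow_at e v = b" "u \<noteq> v"
    using edge_of_estep[OF wf] by metis
  moreover have "u \<in> nodes G" "v \<in> nodes G" using mwalk_nodes[OF mwalk.one wf] one by metis+
  ultimately show ?case
    by (intro exI[of _ "[u, v]"] exI[of _ "[e]"]) (auto simp: open_walk_def is_walk_def)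
next
  case (snoc v b c w d)
  then obtain vs es where IH: "open_walk G W vs es" "hd vs = u" "last vs = v" "es \<noteq> []"
    "arrow_at (last es) v = b" by blast
  obtain e where e: "edge_in G e" "joins e v w" "arrow_at e v = c" "arrow_at e w = d"
    using edge_of_estep[OF wf snoc.hyps(3)] by metis
  have w: "w \<in> nodes G" using mwalk_nodes[OF mwalk.one wf] snoc by metis
  have ne: "vs \<noteq> []" and len: "length vs = Suc (length es)"
    using IH(1) by (auto simp: open_walk_def is_walk_def)
  have lastv: "vs ! length es = v" using IH(3) ne len by (simp add: last_conv_nth)
  have laste: "es ! (length es - 1) = last es" using IH(4) by (simp add: last_conv_nth)
  have walk: "is_walk G (vs @ [w]) (es @ [e])"
    using IH(1) e w ne len lastv by (auto simp: open_walk_def is_walk_def nth_append less_Suc_eq)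
  have "(collider (vs @ [w]) (es @ [e]) i \<longrightarrow> (vs @ [w]) ! i \<in> W) \<and>
        (\<not> collider (vs @ [w]) (es @ [e]) i \<longrightarrow> (vs @ [w]) ! i \<notin> W)"
    if "0 < i" "i < length (vs @ [w]) - 1" for i
  \<comment> \<open>The only new inner position is the old endpoint; earlier positions keep their
    two edges and hence their collider status.\<close>
  proof (cases "i = length es")
    case True
    then have "collider (vs @ [w]) (es @ [e]) i = (b \<and> c)"
      using that IH(4,5) laste lastv len e by (auto simp: collider_def nth_append)
    then show ?thesis
      using snoc.hyps(2) True len lastv by (auto simp: passes_def nth_append split: if_splits)
  next
    case False
    then have "i < length es" using that len by auto
    then have "collider (vs @ [w]) (es @ [e]) i = collider vs es i"
      using that len by (auto simp: collider_def nth_append)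
    moreover have "i < length vs - 1" using \<open>i < length es\<close> len by simp
    ultimately show ?thesis
      using IH(1) that(1) len \<open>i < length es\<close> by (auto simp: open_walk_def nth_append)
  qed
  with walk have "open_walk G W (vs @ [w]) (es @ [e])" by (auto simp: open_walk_def)
  then show ?case using IH ne e
    by (intro exI[of _ "vs @ [w]"] exI[of _ "es @ [e]"]) auto
qed

lemma d_connected_iff_conn:
  assumes "wf_admg G" "u \<noteq> v"
  shows "d_connected G {u} {v} W \<longleftrightarrow> conn G W u v"
proof
  assume "d_connected G {u} {v} W"
  then obtain vs es where ow: "open_walk G W vs es" and h: "hd vs = u" "last vs = v"
    by (auto simp: d_connected_def)
  have ne: "vs \<noteq> []" and len: "length vs = Suc (length es)"
    using ow by (auto simp: open_walk_def is_walk_def)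
  have "es \<noteq> []"
  proof
    assume "es = []"
    with len obtain q where "vs = [q]" by (auto simp: length_Suc_conv)
    with h assms show False by simp
  qed
  then have "length es - 1 < length es" and s: "Suc (length es - 1) = length es" by simp_all
  from open_walk_mwalk[OF assms(1) ow this(1)]
  show "conn G W u v" unfolding s using h ne len
    by (auto simp: conn_def hd_conv_nth last_conv_nth)
next
  assume "conn G W u v"
  then show "d_connected G {u} {v} W"
    unfolding conn_def d_connected_def using mwalk_open_walk[OF assms(1)] by fastforce
qed

section \<open>Splitting and shortening walks\<close>

text \<open>Cut at the first and at the last visit of \<open>w\<close> as a collider and drop what
  lies between. Both pieces have an arrowhead at \<open>w\<close>.\<close>

lemma mwalk_split_collider:
  assumes "mwalk G C N u a v b"
  shows "mwalk G (C - {w}) N u a v b \<or>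
    (mwalk G (C - {w}) N u a w True \<and> mwalk G (C - {w}) N w True v b)"
  using assms
proof (induction rule: mwalk.induct)
  case (one v b)
  then show ?case by (simp add: mwalk.one)
next
  case (snoc v b c v' d)
  show ?case
  proof (cases "v = w \<and> b \<and> c")
    case True
    then have "mwalk G (C - {w}) N w True v' d" using snoc.hyps by (auto intro: mwalk.one)
    with snoc.IH True show ?thesis by auto
  next
    case False
    then have "passes (C - {w}) N b v c" using snoc.hyps(2) by (auto simp: passes_def split: if_splits)
    with snoc show ?thesis by (meson mwalk.snoc)
  qed
qed

text \<open>Cut at the last visit of \<open>w\<close> as a non-collider; only the second piece is
  free of such visits.\<close>

lemma mwalk_split_noncollider:
  assumes "mwalk G C N u a v b"
  shows "mwalk G C (N - {w}) u a v b \<or>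
    (\<exists>c d. mwalk G C N u a w c \<and> mwalk G C (N - {w}) w d v b \<and> \<not> (c \<and> d))"
  using assms
proof (induction rule: mwalk.induct)
  case (one v b)
  then show ?case by (simp add: mwalk.one)
next
  case (snoc v b c v' d)
  show ?case
  proof (cases "v = w \<and> \<not> (b \<and> c)")
    case True
    then have "mwalk G C (N - {w}) w c v' d" using snoc.hyps by (auto intro: mwalk.one)
    with snoc.hyps True show ?thesis by auto
  next
    case False
    then have "passes C (N - {w}) b v c" using snoc.hyps(2) by (auto simp: passes_def split: if_splits)
    with snoc show ?thesis by (meson mwalk.snoc)
  qed
qed

text \<open>A walk that leaves \<open>u\<close> by a tail follows directed edges until its first
  collider, which lies in \<open>C\<close>, or until its end.\<close>

lemma mwalk_tail_anc:
  assumes "mwalk G C N u a v b" "\<not> a"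
  shows "(\<exists>t\<in>C. (u, t) \<in> (dir G)\<^sup>+) \<or> (b \<and> (u, v) \<in> (dir G)\<^sup>+)"
  using assms
proof (induction rule: mwalk.induct)
  case (one v b)
  then show ?case by (auto elim!: estep.cases)
next
  case (snoc v b c w d)
  then show ?case
    by (cases c) (auto elim!: estep.cases simp: passes_def)
qed

text \<open>A non-collider of a walk has an outgoing edge, which leads to an endpoint or to a collider.\<close>
lemma mwalk_restrict_anc:
  assumes "sym (bi G)" "mwalk G C N u a v b"
  shows "mwalk G C (N \<inter> {n. \<exists>t \<in> C \<union> {u, v}. (n, t) \<in> (dir G)\<^sup>*}) u a v b"
  using assms(2)
proof (induction rule: mwalk.induct)
  case (one v b)
  then show ?case by (simp add: mwalk.one)
next
  case (snoc v b c w d)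
  let ?X = "\<lambda>v. {n. \<exists>t \<in> C \<union> {u, v}. (n, t) \<in> (dir G)\<^sup>*}"
  have v: "v \<in> ?X w"
  proof -
    consider "b \<and> c" | "\<not> c" | "\<not> b" by blast
    then show ?thesis
    proof cases
      case 1
      then show ?thesis using snoc.hyps(2) by (auto simp: passes_def)
    next
      case 2
      then show ?thesis using snoc.hyps(3) by (auto elim!: estep.cases)
    next
      case 3
      \<comment> \<open>The walk arrives at \<open>v\<close> by a tail, so read backwards it leaves
        \<open>v\<close> by a tail and runs down to a collider or to \<open>u\<close>.\<close>
      then show ?thesis using mwalk_tail_anc[OF mwalk_sym[OF assms(1) snoc.hyps(1)]]
        by (auto dest: trancl_into_rtrancl)
    qed
  qed
  then have "?X v \<subseteq> ?X w" by (auto intro: rtrancl_trans)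
  then have "mwalk G C (N \<inter> ?X w) u a v b" by (intro mwalk_mono[OF snoc.IH]) auto
  moreover have "passes C (N \<inter> ?X w) b v c" using snoc.hyps(2) v by (auto simp: passes_def)
  ultimately show ?case using snoc.hyps(3) by (meson mwalk.snoc)
qed

text \<open>Stop the directed path at its first node in \<open>U\<close>. All its edges then have
  their tail outside \<open>U\<close>, so its inner nodes are admissible non-colliders.\<close>

lemma dir_path_avoiding:
  assumes "(c, t) \<in> (dir G)\<^sup>*"
  shows "\<exists>w \<in> U \<union> {t}. (c, w) \<in> (dir G \<inter> (- U) \<times> UNIV)\<^sup>*"
  using assms
proof (induction rule: converse_rtrancl_induct)
  case base
  then show ?case by auto
next
  case (step c d)
  show ?case
  proof (cases "c \<in> U")
    case False
    with step have "(c, d) \<in> dir G \<inter> (- U) \<times> UNIV" by simp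
    with step.IH show ?thesis by (meson converse_rtrancl_into_rtrancl)
  qed auto
qed

lemma mwalk_dir:
  assumes "(c, w) \<in> (dir G \<inter> (- U) \<times> UNIV)\<^sup>+"
  shows "mwalk G C (- U) c False w True"
  using assms
proof (induction rule: trancl_induct)
  case (base y)
  then show ?case by (auto intro: mwalk.one estep.intros)
next
  case (step y z)
  then have "passes C (- U) True y False" by (auto simp: passes_def)
  with step show ?case by (auto intro: mwalk.snoc estep.intros)
qed

text \<open>Closed colliders with a descendant in \<open>U\<close> are opened by a detour to that descendant; those with
  a descendant among the endpoints allow a shortcut.\<close>
lemma conn_if_colliders_anc:
  assumes sym: "sym (bi G)" and w: "mwalk G C N u a v b" and "u \<noteq> v" and N: "N \<subseteq> - U"
    and C: "\<And>c. c \<in> C \<Longrightarrow> \<exists>t \<in> U \<union> {u, v}. (c, t) \<in> (dir G)\<^sup>*"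
  shows "conn G U u v"
proof -
  \<comment> \<open>The start mark is quantified because a shortcut through \<open>u\<close>
    replaces the beginning of the walk; the first alternative records that a shortcut has already
    reached \<open>v\<close>.\<close>
  have "conn G U u v \<or> (\<exists>a. mwalk G U (- U) u a v' b')" if "mwalk G C N u a v' b'" for v' b'
    using that
  proof (induction rule: mwalk.induct)
    case (one v b)
    then show ?case by (auto intro: mwalk.one)
  next
    case (snoc q b c w d)
    from snoc.IH show ?case
    proof (elim disjE exE)
      fix a' assume P: "mwalk G U (- U) u a' q b"
      show ?thesis
      proof (cases "b \<and> c \<and> q \<notin> U")
        case False
        then have "passes U (- U) b q c" using snoc.hyps(2) N by (auto simp: passes_def split: if_splits)
        with P snoc.hyps(3) show ?thesis by (meson mwalk.snoc)
      next
        case True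
        then have "q \<in> C" using snoc.hyps(2) by (auto simp: passes_def)
        from C[OF this] obtain t0 where "t0 \<in> U \<union> {u, v}" "(q, t0) \<in> (dir G)\<^sup>*" by blast
        with dir_path_avoiding[of q t0 G U] obtain t where t: "t \<in> U \<union> {u, v}"
          and "(q, t) \<in> (dir G \<inter> (- U) \<times> UNIV)\<^sup>*" by auto
        then have q: "q = t \<or> mwalk G U (- U) q False t True"
          using mwalk_dir by (metis rtrancl_eq_or_trancl)
        have pq: "passes U (- U) True q False" "passes U (- U) False q True"
          using True by (auto simp: passes_def)
        consider "t \<in> U" | "t = v" | "t = u" using t by auto
        then show ?thesis
        proof cases
          case 1
          \<comment> \<open>Run down to \<open>t\<close>, turn round there as at an open collider
            and come back to \<open>q\<close>. Both passages of \<open>q\<close> have a tail at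
            \<open>q\<close>, which is outside \<open>U\<close>.\<close>
          then have q': "mwalk G U (- U) q False t True" using q True by auto
          have "mwalk G U (- U) u a' t True" using mwalk_append[OF q' P] pq True by simp
          moreover have "passes U (- U) True t True" using 1 by (auto simp: passes_def)
          ultimately have "mwalk G U (- U) u a' q False"
            using mwalk_append[OF mwalk_sym[OF sym q']] by blast
          then show ?thesis using pq(2) snoc.hyps(3) True by (metis (full_types) mwalk.snoc)
        next
          case 2
          with q P pq True have "\<exists>e. mwalk G U (- U) u a' v e" using mwalk_append by (metis (full_types))
          then show ?thesis by (auto simp: conn_def)
        next
          case 3
          \<comment> \<open>The path from \<open>q\<close> down to \<open>u\<close>, read backwards,
            becomes the new prefix; if \<open>q = u\<close>, the walk simply starts afresh with the
            next edge.\<close>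
          show ?thesis
          proof (cases "q = u")
            case True
            then show ?thesis using snoc.hyps(3) by (auto intro: mwalk.one)
          next
            case False
            with 3 q have "mwalk G U (- U) u True q False" using mwalk_sym[OF sym] by auto
            then show ?thesis using pq(2) snoc.hyps(3) True by (metis (full_types) mwalk.snoc)
          qed
        qed
      qed
    qed simp
  qed
  from this[OF w] show ?thesis by (auto simp: conn_def)
qed


section \<open>The canonical separator\<close>

text \<open>In the augmented (moralized) graph on \<open>A\<close> these are the first nodes of
  \<open>R\<close> met when searching from \<open>y\<close>. A chain of colliders in
  \<open>A\<close> plays the role of one augmented edge, which is why colliders may lie anywhere in
  \<open>A\<close> while non-colliders must avoid \<open>R\<close>.\<close>

definition canon_sep :: "'a admg \<Rightarrow> 'a set \<Rightarrow> 'a \<Rightarrow> 'a \<Rightarrow> 'a set" where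
  "canon_sep G R y z = (let A = an G y \<union> an G z in
     {v \<in> A \<inter> R. \<exists>a b. mwalk G A (A - R) y a v b})"

lemma conn_sym: "sym (bi G) \<Longrightarrow> conn G W u v \<Longrightarrow> conn G W v u"
  unfolding conn_def using mwalk_sym by metis

text \<open>Non-colliders of an open walk from \<open>y\<close> to \<open>z\<close> are ancestors of
  its ends or of colliders, hence in \<open>A\<close>. Along such a walk every prefix is a search
  walk: a non-collider in \<open>R\<close> would have been put into the separator. So the search
  reaches \<open>z\<close> itself, which lies in \<open>R\<close>.\<close>

lemma canon_sep_separates:
  assumes sym: "sym (bi G)" and z: "z \<in> R" "z \<notin> canon_sep G R y z"
  shows "\<not> conn G (canon_sep G R y z) z y"
proof
  define A where "A = an G y \<union> an G z"
  define W where "W = canon_sep G R y z"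
  have W: "W = {v \<in> A \<inter> R. \<exists>a b. mwalk G A (A - R) y a v b}"
    by (simp add: W_def canon_sep_def A_def Let_def)
  assume "conn G (canon_sep G R y z) z y"
  then obtain a b where "mwalk G W (- W) y a z b"
    using conn_sym[OF sym] by (metis conn_def W_def)
  from mwalk_restrict_anc[OF sym this]
  have "mwalk G W (- W \<inter> A) y a z b"
    by (rule mwalk_mono) (auto simp: W A_def an_def intro: rtrancl_trans)
  then have "mwalk G A (A - R) y a z b"
  proof (induction rule: mwalk.induct)
    case (one v b)
    then show ?case by (rule mwalk.one)
  next
    case (snoc v b c w d)
    \<comment> \<open>The induction hypothesis says that the search reaches \<open>v\<close>, so
      \<open>v\<close> in \<open>R\<close> would put \<open>v\<close> into the separator.\<close>
    have "v \<in> A - R" if "v \<in> - W \<inter> A" using that snoc.IH by (auto simp: W)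
    moreover have "v \<in> A" if "v \<in> W" using that by (auto simp: W)
    ultimately have "passes A (A - R) b v c" using snoc.hyps(2) by (auto simp: passes_def split: if_splits)
    with snoc show ?case by (meson mwalk.snoc)
  qed
  moreover have "z \<in> A" by (simp add: A_def an_def)
  ultimately show False using z unfolding W_def[symmetric] by (auto simp: W)
qed

lemma mwalk_tail_at: "sym (bi G) \<Longrightarrow> mwalk G C N u a v False \<Longrightarrow>
   (\<exists>t\<in>C \<union> {u}. (v, t) \<in> (dir G)\<^sup>+)"
  using mwalk_tail_anc[OF mwalk_sym, of G C N u a v False] by auto

text \<open>The given walk from \<open>z\<close> to \<open>x\<close> is reused. Its non-colliders
  avoid the canonical set, because otherwise a search walk would lead on to \<open>y\<close>. Its
  colliders have descendants in the canonical set or at \<open>z\<close>, so they can be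
  reopened.\<close>

lemma canon_sep_connects:
  assumes sym: "sym (bi G)" and z: "z \<in> R" and y: "y \<notin> R" and "z \<noteq> x"
    and W: "W \<subseteq> (an G y \<union> an G z) \<inter> R" "z \<notin> W"
    and zx: "conn G W z x" and zy: "\<not> conn G W z y"
  shows "z \<notin> canon_sep G R y z \<and> conn G (canon_sep G R y z) z x"
proof -
  define A where "A = an G y \<union> an G z"
  define V where "V = canon_sep G R y z"
  have V: "V = {v \<in> A \<inter> R. \<exists>a b. mwalk G A (A - R) y a v b}"
    by (simp add: V_def canon_sep_def A_def Let_def)
  have zy': "z \<noteq> y" using z y by auto
  \<comment> \<open>Every node of \<open>A\<close> is an ancestor of an endpoint of this walk, so
    all its colliders can be repaired and \<open>z\<close> would be connected to \<open>y\<close>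
    given \<open>W\<close>.\<close>
  have closed: False if "mwalk G A (- W) z a y b" for a b
    using conn_if_colliders_anc[OF sym that zy', of W] zy by (auto simp: A_def an_def)
  have AW: "A - R \<subseteq> - W" using W by auto
  have zV: "z \<notin> V"
  proof
    assume "z \<in> V"
    then obtain a b where "mwalk G A (A - R) y a z b" by (auto simp: V)
    then have "mwalk G A (- W) z b y a" using mwalk_sym[OF sym] mwalk_mono[OF _ subset_refl AW] by metis
    then show False by (rule closed)
  qed
  obtain a b where "mwalk G W (- W) z a x b" using zx by (auto simp: conn_def)
  then have zxV: "mwalk G W (- V) z a x b"
  proof (induction rule: mwalk.induct)
    case (one v b)
    then show ?case by (rule mwalk.one)
  next
    case (snoc v b c w d)
    have "v \<notin> V" if nc: "\<not> (b \<and> c)"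
    proof
      assume "v \<in> V"
      then obtain e f where "mwalk G A (A - R) y e v f" by (auto simp: V)
      then have P: "mwalk G A (- W) v f y e" using mwalk_sym[OF sym] mwalk_mono[OF _ subset_refl AW] by metis
      have Q: "mwalk G A (- W) z a v b" by (rule mwalk_mono[OF snoc.hyps(1)]) (use W in \<open>auto simp: A_def\<close>)
      have "v \<in> A" "v \<notin> W" using \<open>v \<in> V\<close> nc snoc.hyps(2) by (auto simp: V passes_def)
      then have "passes A (- W) b v f" by (auto simp: passes_def)
      with closed mwalk_append[OF P Q] show False by blast
    qed
    then have "passes W (- V) b v c" using snoc.hyps(2) by (auto simp: passes_def split: if_splits)
    with snoc show ?case by (meson mwalk.snoc)
  qed
  \<comment> \<open>Going back from \<open>y\<close> against directed edges is a search walk as long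
    as no node of the canonical set is met; on meeting one, all further ancestors have it as a
    descendant.\<close>
  have anc_y: "(\<exists>w\<in>V. (c, w) \<in> (dir G)\<^sup>*) \<or> c = y \<or> mwalk G A (A - R) y True c False"
    if "(c, y) \<in> (dir G)\<^sup>*" for c
    using that
  proof (induction rule: converse_rtrancl_induct)
    case base
    then show ?case by simp
  next
    case (step c d)
    from step.IH consider w where "w \<in> V" "(d, w) \<in> (dir G)\<^sup>*" | "d = y" | "d \<notin> V" "mwalk G A (A - R) y True d False"
      by blast
    then show ?case
    proof cases
      case 1
      with step.hyps(1) show ?thesis by (meson converse_rtrancl_into_rtrancl)
    next
      case 2
      with step.hyps(1) show ?thesis by (auto intro: mwalk.one estep.intros)
    next
      case 3
      then have "passes A (A - R) False d True" using step.hyps(2) by (auto simp: V A_def an_def passes_def)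
      with 3 step.hyps(1) show ?thesis by (auto intro: mwalk.snoc estep.intros)
    qed
  qed
  have "conn G V z x"
  proof (rule conn_if_colliders_anc[OF sym zxV \<open>z \<noteq> x\<close> subset_refl])
    fix c assume "c \<in> W"
    then have c: "c \<in> A" "c \<in> R" using W by (auto simp: A_def)
    show "\<exists>t\<in>V \<union> {z, x}. (c, t) \<in> (dir G)\<^sup>*"
    proof (cases "c \<in> an G z")
      case False
      then have "(c, y) \<in> (dir G)\<^sup>*" "c \<noteq> y" using c y by (auto simp: A_def an_def)
      with anc_y[of c] c show ?thesis by (auto simp: V)
    qed (auto simp: an_def)
  qed
  with zV show ?thesis by (simp add: V_def)
qed

text \<open>If the separator contains a node outside the ancestors of \<open>y\<close> and \<open>z\<close>, take a lowest such node
  \<open>w\<close>. Either it can be dropped, or it is a collider on the walk to \<open>x\<close> and is itself an instrument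
  given the other nodes.\<close>
lemma ancestral_separator_exists:
  assumes wf: "wf_admg G" and "finite W" "W \<subseteq> R" "z \<in> R" "z \<notin> W" "conn G W z x" "\<not> conn G W z y"
  shows "\<exists>z W. W \<subseteq> (an G y \<union> an G z) \<inter> R \<and> z \<in> R \<and> z \<notin> W \<and> conn G W z x \<and> \<not> conn G W z y"
  using assms(2-)
proof (induction "card W" arbitrary: z W rule: less_induct)
  case less
  note sym = wf[unfolded wf_admg_def, THEN conjunct2, THEN conjunct2, THEN conjunct2, THEN conjunct1]
  define D where "D = W - (an G y \<union> an G z)"
  show ?case
  proof (cases "D = {}")
    case True
    with less.prems show ?thesis by (auto simp: D_def)
  next
    case False
    have "finite (dir G)" using wf by (auto simp: wf_admg_def intro: finite_subset)
    then have "wf ((dir G)\<inverse>)" using wf by (intro finite_acyclic_wf_converse) (auto simp: wf_admg_def)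
    then have "wf (((dir G)\<inverse>)\<^sup>+)" by (rule wf_trancl)
    \<comment> \<open>Acyclicity gives a node of \<open>D\<close> with no proper descendant in
      \<open>D\<close>.\<close>
    then obtain w where w: "w \<in> D" "\<And>t. (t, w) \<in> ((dir G)\<inverse>)\<^sup>+ \<Longrightarrow> t \<notin> D"
      using False by (metis wfE_min ex_in_conv)
    define W1 where "W1 = W - {w}"
    have wW: "w \<in> W" "w \<notin> W1" "insert w W1 = W" using w by (auto simp: D_def W1_def)
    \<comment> \<open>So no walk can leave \<open>w\<close> by a tail when its colliders lie in
      \<open>W1\<close> and it ends in \<open>y\<close> or \<open>z\<close>: it would run down into
      one of these nodes.\<close>
    have wdown: False if "t \<in> W1 \<union> {y, z}" "(w, t) \<in> (dir G)\<^sup>+" for t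
    proof (cases "t \<in> D")
      case True
      with w(2)[of t] that show False by (simp add: trancl_converse)
    next
      case False
      then have "t \<in> an G y \<union> an G z" using that by (auto simp: D_def W1_def an_def)
      then have "w \<in> an G y \<union> an G z" using that(2)
        by (auto simp: an_def intro: rtrancl_trans trancl_into_rtrancl)
      with w(1) show False by (simp add: D_def)
    qed
    have card: "card W1 < card W" unfolding W1_def using less.prems wW(1) by (intro card_Diff1_less)
    have W1: "finite W1" "W1 \<subseteq> R" "z \<notin> W1" using less.prems by (auto simp: W1_def)
    have NW: "- W1 - {w} = - W" using wW by auto
    obtain a b where "mwalk G W (- W) z a x b" using less.prems by (auto simp: conn_def)
    from mwalk_split_collider[OF this, of w, folded W1_def]
    consider (off) "mwalk G W1 (- W) z a x b"
      | (on) "mwalk G W1 (- W) z a w True" "mwalk G W1 (- W) w True x b" by blast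
    then show ?thesis
    proof cases
      case off
      then have "mwalk G W1 (- W1) z a x b" by (rule mwalk_mono) (auto simp: W1_def)
      then have "conn G W1 z x" by (auto simp: conn_def)
      moreover have "\<not> conn G W1 z y"
      proof
        assume "conn G W1 z y"
        then obtain c d where "mwalk G W1 (- W1) z c y d" by (auto simp: conn_def)
        \<comment> \<open>Dropping \<open>w\<close> can open only walks that have \<open>w\<close>
          as a non-collider. Such a visit has a tail at \<open>w\<close>, which \<open>wdown\<close>
          excludes on either side.\<close>
        from mwalk_split_noncollider[OF this, of w, unfolded NW]
        show False
        proof (elim disjE exE conjE)
          assume "mwalk G W1 (- W) z c y d"
          then have "mwalk G W (- W) z c y d" by (rule mwalk_mono) (auto simp: W1_def)
          with less.prems show False by (auto simp: conn_def)
        next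
          fix e f assume e: "mwalk G W1 (- W1) z c w e" and f: "mwalk G W1 (- W) w f y d" and "\<not> (e \<and> f)"
          then consider "\<not> e" | "\<not> f" by blast
          then show False
          proof cases
            case 1
            with mwalk_tail_at[OF sym, of W1 "- W1" z c w] e wdown show False by auto
          next
            case 2
            with mwalk_tail_anc[OF f] wdown show False by auto
          qed
        qed
      qed
      ultimately show ?thesis using less.hyps[OF card W1(1,2) less.prems(3) W1(3)] by blast
    next
      case on
      have "mwalk G W1 (- W1) w True x b" by (rule mwalk_mono[OF on(2)]) (auto simp: W1_def)
      then have "conn G W1 w x" by (auto simp: conn_def)
      moreover have "\<not> conn G W1 w y"
      proof
        assume "conn G W1 w y"
        then obtain c d where "mwalk G W1 (- W1) w c y d" by (auto simp: conn_def)
        \<comment> \<open>Either alternative leaves a walk from \<open>w\<close> to \<open>y\<close>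
          without \<open>w\<close> as a non-collider. It must start with an arrowhead at
          \<open>w\<close>, so it can be glued to the walk from \<open>z\<close> at the collider
          \<open>w\<close> in \<open>W\<close>.\<close>
        from mwalk_split_noncollider[OF this, of w, unfolded NW]
        obtain f where f: "mwalk G W1 (- W) w f y d" by auto
        have f'': f using mwalk_tail_anc[OF f] wdown by auto
        have "W1 \<subseteq> W" by (auto simp: W1_def)
        then have "mwalk G W (- W) z a w True" "mwalk G W (- W) w True y d"
          using on(1) f f'' mwalk_mono[of G W1 "- W" _ _ _ _ W "- W"] by auto
        moreover have "passes W (- W) True w True" using wW by (simp add: passes_def)
        ultimately have "mwalk G W (- W) z a y d" using mwalk_append by metis
        with less.prems show False by (auto simp: conn_def)
      qed
      ultimately show ?thesis using less.hyps[OF card W1(1,2) _ wW(2)] wW less.prems(2) by blast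
    qed
  qed
qed

section \<open>Removing the causal edges\<close>

lemma tilde_simps [simp]: "nodes (tilde G x y) = nodes G" "bi (tilde G x y) = bi G"
  "dir (tilde G x y) = dir G - {(x, c) | c. c \<in> causal G x y}"
  by (simp_all add: tilde_def)

lemma wf_tilde: "wf_admg G \<Longrightarrow> wf_admg (tilde G x y)"
  by (auto simp: wf_admg_def intro: acyclic_subset)

lemma estep_tilde: "estep (tilde G x y) u a v b \<Longrightarrow> estep G u a v b"
  by (auto elim!: estep.cases intro: estep.intros)

lemma mwalk_tilde: "mwalk (tilde G x y) C N u a v b \<Longrightarrow> mwalk G C N u a v b"
  by (induction rule: mwalk.induct) (auto intro: estep_tilde mwalk.intros)

text \<open>A walk from \<open>x\<close> that starts with a removed edge follows directed edges inside the forbidden set, since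
  no collider in \<open>W\<close> lies there, and hence does not reach \<open>z\<close>.\<close>
lemma conn_tilde:
  assumes wf: "wf_admg G" and W: "W \<inter> forb G x y = {}" and z: "z \<notin> forb G x y"
    and zx: "conn G W z x"
  shows "conn (tilde G x y) W z x"
proof -
  have sym: "sym (bi G)" using wf by (simp add: wf_admg_def)
  define K where "K = de_set G (causal G x y)"
  have forb: "forb G x y = K \<union> {x}" by (simp add: forb_def K_def)
  have K: "w \<in> K" if "v \<in> K" "(v, w) \<in> dir G" for v w
    using that by (auto simp: K_def de_set_def de_def intro: rtrancl_into_rtrancl)
  have cK: "causal G x y \<subseteq> K" by (auto simp: K_def de_set_def de_def)
  obtain a0 b0 where "mwalk G W (- W) x a0 z b0" using conn_sym[OF sym zx] by (auto simp: conn_def)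
  \<comment> \<open>As a forbidden node, \<open>x\<close> is not in \<open>W\<close> and so occurs
    inside the walk only as a non-collider. Cutting at its last such visit leaves a walk that does
    not return to \<open>x\<close> on the way.\<close>
  from mwalk_split_noncollider[OF this, of x]
  obtain a b where "mwalk G W (- W - {x}) x a z b" by auto
  \<comment> \<open>For a prefix ending in \<open>x\<close> nothing has to be shown, since no longer
    prefix continues from there. In the last alternative the walk has entered \<open>K\<close>
    through an arrowhead; with no collider available in \<open>K\<close> it can leave only along
    directed edges, which stay in \<open>K\<close>.\<close>
  then have "z = x \<or> mwalk (tilde G x y) W (- W) x a z b \<or> (z \<in> K \<and> b)"
  proof (induction rule: mwalk.induct)
    case (one v b)
    then have "estep (tilde G x y) x a v b \<or> (v \<in> K \<and> b)"
      using cK by cases (auto simp: causal_def intro!: estep.intros)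
    then show ?case by (auto intro: mwalk.one)
  next
    case (snoc v b c w d)
    have vx: "v \<noteq> x" and vW: "b \<and> c \<longleftrightarrow> v \<in> W" using snoc.hyps(2) W
      by (auto simp: forb passes_def split: if_splits)
    from snoc.IH consider "mwalk (tilde G x y) W (- W) x a v b" | "v \<in> K" "b" using vx by blast
    then show ?case
    proof cases
      case 1
      have "w = x \<or> estep (tilde G x y) v c w d"
        using snoc.hyps(3) vx by (auto elim!: estep.cases intro: estep.intros)
      moreover have "passes W (- W) b v c" using vW by (auto simp: passes_def)
      ultimately show ?thesis using 1 by (meson mwalk.snoc)
    next
      case 2
      then have "\<not> c" using vW W by (auto simp: forb)
      with snoc.hyps(3) 2 K show ?thesis by (auto elim!: estep.cases)
    qed
  qed
  then have "mwalk (tilde G x y) W (- W) x a z b" using z by (auto simp: forb)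
  then show ?thesis using conn_sym[of "tilde G x y" W x z] sym by (auto simp: conn_def)
qed

section \<open>Reduction to one test per node\<close>

definition allowed :: "'a admg \<Rightarrow> 'a \<Rightarrow> 'a \<Rightarrow> 'a set" where
  "allowed G x y = nodes G - forb G x y - {y}"

abbreviation instr_sep :: "'a admg \<Rightarrow> 'a \<Rightarrow> 'a \<Rightarrow> 'a \<Rightarrow> 'a set" where
  "instr_sep G x y z \<equiv> canon_sep (tilde G x y) (allowed G x y) y z"

definition good_instr :: "'a admg \<Rightarrow> 'a \<Rightarrow> 'a \<Rightarrow> 'a \<Rightarrow> bool" where
  "good_instr G x y z \<longleftrightarrow> z \<in> allowed G x y \<and> z \<notin> instr_sep G x y z \<and>
     conn (tilde G x y) (instr_sep G x y z) z x"

text \<open>The definition speaks of two graphs. Walks of the reduced graph are walks of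
  \<open>G\<close>, and \<open>conn_tilde\<close> gives the converse for walks to \<open>x\<close>,
  so both conditions move to the graph in which the separator lemmas are applied.\<close>

lemma valid_cis_singleton:
  assumes wf: "wf_admg G" and "x \<in> nodes G" "y \<in> nodes G" "x \<noteq> y"
  shows "valid_cis G x y {z} W \<longleftrightarrow> z \<in> allowed G x y \<and> W \<subseteq> allowed G x y \<and> z \<notin> W \<and>
     conn (tilde G x y) W z x \<and> \<not> conn (tilde G x y) W z y"
proof -
  have sym: "sym (bi G)" and symt: "sym (bi (tilde G x y))" using wf by (simp_all add: wf_admg_def)
  have x: "x \<in> forb G x y" by (simp add: forb_def)
  have *: "d_connected G {x} {z} W \<longleftrightarrow> conn (tilde G x y) W z x"
    if "z \<in> allowed G x y" "W \<subseteq> allowed G x y"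
  proof -
    have "x \<noteq> z" "z \<notin> forb G x y" "W \<inter> forb G x y = {}" using that x by (auto simp: allowed_def)
    moreover have "conn (tilde G x y) W z x \<Longrightarrow> conn G W z x"
      unfolding conn_def using mwalk_tilde by metis
    ultimately show ?thesis
      using d_connected_iff_conn[OF wf] conn_tilde[OF wf] conn_sym[OF sym] by metis
  qed
  have **: "d_separated (tilde G x y) {y} {z} W \<longleftrightarrow> \<not> conn (tilde G x y) W z y"
    if "z \<in> allowed G x y"
    using that d_connected_iff_conn[OF wf_tilde[OF wf], of y z] conn_sym[OF symt]
    unfolding d_separated_def by (metis DiffE allowed_def singletonI)
  have "valid_cis G x y {z} W \<Longrightarrow> z \<in> allowed G x y \<and> W \<subseteq> allowed G x y \<and> z \<notin> W"
    by (auto simp: valid_cis_def allowed_def)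
  moreover have "z \<in> allowed G x y \<and> W \<subseteq> allowed G x y \<and> z \<notin> W \<Longrightarrow>
      d_connected G {x} {z} W \<and> d_separated (tilde G x y) {y} {z} W \<Longrightarrow> valid_cis G x y {z} W"
    using assms x by (auto simp: valid_cis_def allowed_def)
  moreover have "valid_cis G x y {z} W \<Longrightarrow>
      d_connected G {x} {z} W \<and> d_separated (tilde G x y) {y} {z} W"
    by (simp add: valid_cis_def)
  ultimately show ?thesis using * ** by blast
qed

lemma good_instr_valid:
  assumes "wf_admg G" "x \<in> nodes G" "y \<in> nodes G" "x \<noteq> y" "good_instr G x y z"
  shows "valid_cis G x y {z} (instr_sep G x y z)"
proof -
  have "sym (bi (tilde G x y))" using assms by (simp add: wf_admg_def)
  moreover have "instr_sep G x y z \<subseteq> allowed G x y" by (auto simp: canon_sep_def Let_def)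
  ultimately show ?thesis
    using assms(5) canon_sep_separates unfolding valid_cis_singleton[OF assms(1-4)] good_instr_def
    by metis
qed

text \<open>The node found may differ from the given \<open>z\<close>: making the separator
  ancestral can replace the instrument by a collider of its walk to \<open>x\<close>.\<close>

lemma good_instr_exists:
  assumes wf: "wf_admg G" and "x \<in> nodes G" "y \<in> nodes G" "x \<noteq> y" "valid_cis G x y {z} W"
  shows "\<exists>z. good_instr G x y z"
proof -
  let ?H = "tilde G x y" and ?R = "allowed G x y"
  have sym: "sym (bi ?H)" using wf by (simp add: wf_admg_def)
  have "W \<subseteq> nodes G" using assms(5) by (simp add: valid_cis_def)
  then have "finite W" using wf by (auto simp: wf_admg_def intro: finite_subset)
  with ancestral_separator_exists[OF wf_tilde[OF wf], of W ?R z x y x y] assms(5)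
  obtain z W where zW: "W \<subseteq> (an ?H y \<union> an ?H z) \<inter> ?R" "z \<in> ?R" "z \<notin> W" "conn ?H W z x" "\<not> conn ?H W z y"
    by (auto simp: valid_cis_singleton[OF assms(1-4)])
  have "y \<notin> ?R" "z \<noteq> x" using zW(2) by (auto simp: allowed_def forb_def)
  with canon_sep_connects[OF sym zW(2) _ _ zW(1,3,4,5)] zW(2) show ?thesis
    by (auto simp: good_instr_def)
qed

section \<open>Machine runs\<close>

text \<open>The step number is an upper bound, so that bounds of consecutive runs add up and can be
  weakened.\<close>

definition run :: "instr list \<Rightarrow> nat \<Rightarrow> state \<Rightarrow> state \<Rightarrow> bool" where
  "run P t s s' \<longleftrightarrow> (\<exists>n\<le>t. steps P s n = s')"

lemma steps_halted: "halted P s \<Longrightarrow> steps P s n = s"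
  by (cases n) auto

lemma steps_add: "steps P s (m + n) = steps P (steps P s m) n"
  by (induction P s m rule: steps.induct) (auto simp: steps_halted)

lemma run_refl: "run P t s s"
  unfolding run_def by (rule exI[of _ 0]) simp

lemma run_same: "m = m' \<Longrightarrow> run P t (pc, m) (pc, m')"
  by (simp add: run_refl)

lemma run_trans: "run P t s s' \<Longrightarrow> run P u s' s'' \<Longrightarrow> run P (t + u) s s''"
  unfolding run_def by (metis add_mono steps_add)

lemma run_mono: "run P t s s' \<Longrightarrow> t \<le> u \<Longrightarrow> run P u s s'"
proof -
  assume "run P t s s'" "t \<le> u"
  then obtain n where "n \<le> t" "steps P s n = s'" by (auto simp: run_def)
  with \<open>t \<le> u\<close> show ?thesis unfolding run_def by (intro exI[of _ n]) simp
qed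

definition code_at :: "instr list \<Rightarrow> nat \<Rightarrow> instr list \<Rightarrow> bool" where
  "code_at P pc cs \<longleftrightarrow> (\<forall>i<length cs. pc + i < length P \<and> P ! (pc + i) = cs ! i)"

lemma code_at_Nil [simp]: "code_at P pc []"
  by (simp add: code_at_def)

lemma code_at_Cons [simp]:
  "code_at P pc (c # cs) \<longleftrightarrow> pc < length P \<and> P ! pc = c \<and> code_at P (Suc pc) cs"
  unfolding code_at_def by (auto simp: less_Suc_eq_0_disj nth_Cons split: nat.splits)

lemma code_at_append [simp]:
  "code_at P pc (as @ bs) \<longleftrightarrow> code_at P pc as \<and> code_at P (pc + length as) bs"
  by (induction as arbitrary: pc) auto

lemma code_at_mid: "code_at (as @ cs @ bs) (length as) cs"
  by (auto simp: code_at_def nth_append)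

lemma run_instr:
  assumes "pc < length P" "P ! pc \<noteq> Halt" "run P t (exec (P ! pc) (pc, m)) s"
  shows "run P (Suc t) (pc, m) s"
proof -
  from assms(3) obtain n where "n \<le> t" "steps P (exec (P ! pc) (pc, m)) n = s" by (auto simp: run_def)
  with assms(1,2) show ?thesis unfolding run_def by (intro exI[of _ "Suc n"]) (simp add: halted_def)
qed

section \<open>A structured language\<close>

datatype exp = K int | V nat | Pl exp exp | Mi exp exp | Ar nat exp | Ite exp exp exp

datatype com = Skip | Assign nat exp | Upd nat exp exp | Seq com com (infixr ";;" 60)
  | Cond exp com com | While exp com

type_synonym regs = "nat \<Rightarrow> int"
type_synonym arrs = "nat \<Rightarrow> nat \<Rightarrow> int"

text \<open>Variables live in registers 10 to 31. Arrays 0 to 31 are interleaved with stride 32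
  above the address \<open>L\<close>; array 32 consists of the memory cells from 32 below \<open>L\<close>.\<close>

abbreviation (input) "raw \<equiv> 32::nat"

fun ev :: "regs \<Rightarrow> arrs \<Rightarrow> exp \<Rightarrow> int" where
  "ev r a (K i) = i"
| "ev r a (V x) = r x"
| "ev r a (Pl e f) = ev r a e + ev r a f"
| "ev r a (Mi e f) = ev r a e - ev r a f"
| "ev r a (Ar k e) = a k (nat (ev r a e))"
| "ev r a (Ite c e f) = (if ev r a c \<noteq> 0 then ev r a e else ev r a f)"

text \<open>The raw array must stay clear of the registers below cell 32 and of the interleaved
  arrays, which begin at \<open>L\<close>.\<close>

definition idx_ok :: "nat \<Rightarrow> nat \<Rightarrow> int \<Rightarrow> bool" where
  "idx_ok L k i \<longleftrightarrow> (if k = raw then 32 \<le> i \<and> i < int L else 0 \<le> i)"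

text \<open>Out-of-range reads would hit foreign memory cells. \<open>Ite\<close> evaluates one
  branch only, so only that branch has to be safe.\<close>

fun safe :: "nat \<Rightarrow> regs \<Rightarrow> arrs \<Rightarrow> exp \<Rightarrow> bool" where
  "safe L r a (K i) = True"
| "safe L r a (V x) = True"
| "safe L r a (Pl e f) = (safe L r a e \<and> safe L r a f)"
| "safe L r a (Mi e f) = (safe L r a e \<and> safe L r a f)"
| "safe L r a (Ar k e) = (safe L r a e \<and> idx_ok L k (ev r a e))"
| "safe L r a (Ite c e f) = (safe L r a c \<and> (if ev r a c \<noteq> 0 then safe L r a e else safe L r a f))"

text \<open>The number counts executed assignments and tests.\<close>

inductive big_step :: "nat \<Rightarrow> com \<Rightarrow> regs \<Rightarrow> arrs \<Rightarrow> nat \<Rightarrow> regs \<Rightarrow> arrs \<Rightarrow> bool" for L where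
  Skip: "big_step L Skip r a 0 r a"
| Assign: "safe L r a e \<Longrightarrow> big_step L (Assign x e) r a 1 (r(x := ev r a e)) a"
| Upd: "safe L r a e \<Longrightarrow> safe L r a f \<Longrightarrow> idx_ok L k (ev r a e) \<Longrightarrow>
    big_step L (Upd k e f) r a 1 r (a(k := (a k)(nat (ev r a e) := ev r a f)))"
| Seq: "big_step L c r a m r' a' \<Longrightarrow> big_step L d r' a' n r'' a'' \<Longrightarrow> big_step L (c ;; d) r a (m + n) r'' a''"
| CondT: "safe L r a e \<Longrightarrow> ev r a e \<noteq> 0 \<Longrightarrow> big_step L c r a n r' a' \<Longrightarrow> big_step L (Cond e c d) r a (Suc n) r' a'"
| CondF: "safe L r a e \<Longrightarrow> ev r a e = 0 \<Longrightarrow> big_step L d r a n r' a' \<Longrightarrow> big_step L (Cond e c d) r a (Suc n) r' a'"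
| WhileF: "safe L r a e \<Longrightarrow> ev r a e = 0 \<Longrightarrow> big_step L (While e c) r a 1 r a"
| WhileT: "safe L r a e \<Longrightarrow> ev r a e \<noteq> 0 \<Longrightarrow> big_step L c r a m r' a' \<Longrightarrow> big_step L (While e c) r' a' n r'' a'' \<Longrightarrow>
    big_step L (While e c) r a (Suc (m + n)) r'' a''"

section \<open>Compilation of expressions\<close>

text \<open>Five doublings multiply the index by the stride 32; then the base \<open>L\<close>, kept
  in cell 0, and the array number are added. A raw index already is an address.\<close>

fun comp_addr :: "nat \<Rightarrow> nat \<Rightarrow> nat \<Rightarrow> instr list" where
  "comp_addr k d t = (if k = raw then [] else
     [Add d d d, Add d d d, Add d d d, Add d d d, Add d d d, Add d d 0, Const t (int k), Add d d t])"

fun len_exp :: "exp \<Rightarrow> nat" where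
  "len_exp (K i) = 1"
| "len_exp (V x) = 2"
| "len_exp (Pl e f) = len_exp e + len_exp f + 1"
| "len_exp (Mi e f) = len_exp e + len_exp f + 1"
| "len_exp (Ar k e) = len_exp e + (if k = raw then 0 else 8) + 1"
| "len_exp (Ite c e f) = len_exp c + 1 + len_exp e + 1 + len_exp f"

text \<open>Cells \<open>d\<close> to 9 form the evaluation stack and the value ends up in cell
  \<open>d\<close>. The program counter is a parameter because jump targets are absolute.\<close>

fun comp_exp :: "exp \<Rightarrow> nat \<Rightarrow> nat \<Rightarrow> instr list" where
  "comp_exp (K i) d pc = [Const d i]"
| "comp_exp (V x) d pc = [Const d 0, Add d d x]"
| "comp_exp (Pl e f) d pc = comp_exp e d pc @ comp_exp f (Suc d) (pc + len_exp e) @ [Add d d (Suc d)]"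
| "comp_exp (Mi e f) d pc = comp_exp e d pc @ comp_exp f (Suc d) (pc + len_exp e) @ [Sub d d (Suc d)]"
| "comp_exp (Ar k e) d pc = comp_exp e d pc @ comp_addr k d (Suc d) @ [Load d d]"
| "comp_exp (Ite c e f) d pc = (let q = pc + len_exp c + 1 in
     comp_exp c d pc @ [Jz d (q + len_exp e + 1)] @ comp_exp e d q
       @ [Jmp (q + len_exp e + 1 + len_exp f)] @ comp_exp f d (q + len_exp e + 1))"

fun wf_exp :: "exp \<Rightarrow> nat \<Rightarrow> bool" where
  "wf_exp (K i) d = (d < 10)"
| "wf_exp (V x) d = (d < 10 \<and> 10 \<le> x \<and> x < 32)"
| "wf_exp (Pl e f) d = (wf_exp e d \<and> wf_exp f (Suc d))"
| "wf_exp (Mi e f) d = (wf_exp e d \<and> wf_exp f (Suc d))"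
| "wf_exp (Ar k e) d = (wf_exp e d \<and> Suc d < 10 \<and> k \<le> raw)"
| "wf_exp (Ite c e f) d = (wf_exp c d \<and> wf_exp e d \<and> wf_exp f d)"

lemma length_comp_exp [simp]: "length (comp_exp e d pc) = len_exp e"
  by (induction e arbitrary: d pc) (auto simp: Let_def)

lemma wf_exp_less: "wf_exp e d \<Longrightarrow> d < 10"
  by (induction e arbitrary: d) auto

definition rep :: "nat \<Rightarrow> regs \<Rightarrow> arrs \<Rightarrow> (nat \<Rightarrow> int) \<Rightarrow> bool" where
  "rep L r a m \<longleftrightarrow> m 0 = int L \<and> 32 \<le> L \<and> (\<forall>x. 10 \<le> x \<and> x < 32 \<longrightarrow> m x = r x) \<and>
     (\<forall>k<32. \<forall>i. m (L + 32 * i + k) = a k i) \<and> (\<forall>i. 32 \<le> i \<and> i < L \<longrightarrow> m i = a raw i)"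

definition agree :: "nat \<Rightarrow> (nat \<Rightarrow> int) \<Rightarrow> (nat \<Rightarrow> int) \<Rightarrow> bool" where
  "agree d m m' \<longleftrightarrow> (\<forall>q. q < d \<or> 10 \<le> q \<longrightarrow> m' q = m q)"

lemma rep_agree: "rep L r a m \<Longrightarrow> agree d m m' \<Longrightarrow> 1 \<le> d \<Longrightarrow> rep L r a m'"
  unfolding rep_def agree_def by auto

lemma agree_trans: "agree d m m' \<Longrightarrow> agree d' m' m'' \<Longrightarrow> d \<le> d' \<Longrightarrow> agree d m m''"
  unfolding agree_def by auto

definition addr :: "nat \<Rightarrow> nat \<Rightarrow> int \<Rightarrow> nat" where
  "addr L k i = (if k = raw then nat i else L + 32 * nat i + k)"

lemma rep_addr:
  assumes "rep L r a m" "k \<le> raw" "idx_ok L k i"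
  shows "m (addr L k i) = a k (nat i)"
proof (cases "k = raw")
  case True
  then have "32 \<le> nat i" "nat i < L" using assms(3) by (auto simp: idx_ok_def)
  with assms(1) True show ?thesis by (simp add: rep_def addr_def)
next
  case False
  with assms show ?thesis by (simp add: rep_def addr_def)
qed

lemma run_comp_addr:
  assumes "code_at P pc (comp_addr k d t)" "rep L r a m" "idx_ok L k (m d)" "1 \<le> d" "t \<noteq> d" "1 \<le> t"
  shows "\<exists>m'. run P (length (comp_addr k d t)) (pc, m) (pc + length (comp_addr k d t), m') \<and>
     m' d = int (addr L k (m d)) \<and> (\<forall>q. q \<noteq> d \<and> q \<noteq> t \<longrightarrow> m' q = m q)"
proof (cases "k = raw")
  case True
  then show ?thesis using assms(3) by (auto simp: idx_ok_def addr_def intro!: exI[of _ m] run_refl)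
next
  case False
  define v where "v = int L + 32 * m d + int k"
  have 0: "m 0 = int L" using assms(2) by (simp add: rep_def)
  have v: "int (addr L k (m d)) = v" using False assms(3) by (simp add: addr_def idx_ok_def v_def)
  show ?thesis
    using assms(1,4-) False unfolding v
    by (intro exI[of _ "m(t := int k, d := v)"])
       (auto intro!: run_instr run_same simp: eval_nat_numeral v_def 0 fun_eq_iff)
qed

text \<open>Expression code jumps only forward, so its length also bounds its running time.\<close>

lemma run_comp_exp:
  assumes "code_at P pc (comp_exp e d pc)" "wf_exp e d" "1 \<le> d" "rep L r a m" "safe L r a e"
  shows "\<exists>m'. run P (len_exp e) (pc, m) (pc + len_exp e, m') \<and> m' d = ev r a e \<and> agree d m m'"
  using assms
proof (induction e arbitrary: d pc m)
  case (K i)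
  then show ?case by (intro exI[of _ "m(d := i)"]) (auto intro!: run_instr run_same simp: agree_def fun_eq_iff)
next
  case (V x)
  then show ?case
    by (intro exI[of _ "m(d := r x)"])
       (auto intro!: run_instr run_same simp: agree_def rep_def numeral_2_eq_2 fun_eq_iff)
next
  case (Pl e f)
  then obtain m1 where m1: "run P (len_exp e) (pc, m) (pc + len_exp e, m1)" "m1 d = ev r a e" "agree d m m1"
    by fastforce
  have "rep L r a m1" using rep_agree Pl.prems m1 by blast
  with Pl obtain m2 where m2: "run P (len_exp f) (pc + len_exp e, m1) (pc + len_exp e + len_exp f, m2)"
    "m2 (Suc d) = ev r a f" "agree (Suc d) m1 m2" by fastforce
  have d: "m2 d = ev r a e" using m2 m1 by (auto simp: agree_def)
  let ?m = "m2(d := ev r a e + ev r a f)"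
  have "run P 1 (pc + len_exp e + len_exp f, m2) (Suc (pc + len_exp e + len_exp f), ?m)"
    using Pl.prems m2 d unfolding One_nat_def by (intro run_instr) (auto intro: run_refl)
  from run_trans[OF run_trans[OF m1(1) m2(1)] this]
  have "run P (len_exp (Pl e f)) (pc, m) (pc + len_exp (Pl e f), ?m)" by (simp add: add.assoc)
  moreover have "agree d m ?m" using m1(3) m2(3) wf_exp_less Pl.prems by (fastforce simp: agree_def)
  ultimately show ?case by (intro exI[of _ ?m] conjI) (assumption | simp only: fun_upd_same ev.simps)+
next
  case (Mi e f)
  then obtain m1 where m1: "run P (len_exp e) (pc, m) (pc + len_exp e, m1)" "m1 d = ev r a e" "agree d m m1"
    by fastforce
  have "rep L r a m1" using rep_agree Mi.prems m1 by blast
  with Mi obtain m2 where m2: "run P (len_exp f) (pc + len_exp e, m1) (pc + len_exp e + len_exp f, m2)"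
    "m2 (Suc d) = ev r a f" "agree (Suc d) m1 m2" by fastforce
  have d: "m2 d = ev r a e" using m2 m1 by (auto simp: agree_def)
  let ?m = "m2(d := ev r a e - ev r a f)"
  have "run P 1 (pc + len_exp e + len_exp f, m2) (Suc (pc + len_exp e + len_exp f), ?m)"
    using Mi.prems m2 d unfolding One_nat_def by (intro run_instr) (auto intro: run_refl)
  from run_trans[OF run_trans[OF m1(1) m2(1)] this]
  have "run P (len_exp (Mi e f)) (pc, m) (pc + len_exp (Mi e f), ?m)" by (simp add: add.assoc)
  moreover have "agree d m ?m" using m1(3) m2(3) wf_exp_less Mi.prems by (fastforce simp: agree_def)
  ultimately show ?case by (intro exI[of _ ?m] conjI) (assumption | simp only: fun_upd_same ev.simps)+
next
  case (Ar k e)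
  then obtain m1 where m1: "run P (len_exp e) (pc, m) (pc + len_exp e, m1)" "m1 d = ev r a e" "agree d m m1"
    by fastforce
  have rep: "rep L r a m1" using rep_agree Ar.prems m1 by blast
  have "code_at P (pc + len_exp e) (comp_addr k d (Suc d))" using Ar.prems by simp
  from run_comp_addr[OF this rep] obtain m2
    where m2: "run P (length (comp_addr k d (Suc d))) (pc + len_exp e, m1)
        (pc + len_exp e + length (comp_addr k d (Suc d)), m2)" "m2 d = int (addr L k (ev r a e))"
      "\<forall>q. q \<noteq> d \<and> q \<noteq> Suc d \<longrightarrow> m2 q = m1 q" using Ar.prems m1 by auto
  have agr: "agree d m m2" using m1(3) m2(3) Ar.prems by (auto simp: agree_def)
  then have "rep L r a m2" using rep_agree Ar.prems by blast
  then have val: "m2 (addr L k (ev r a e)) = a k (nat (ev r a e))"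
    using Ar.prems by (intro rep_addr) simp_all
  let ?m = "m2(d := a k (nat (ev r a e)))" and ?l = "length (comp_addr k d (Suc d))"
  have "pc + len_exp e + ?l < length P \<and> P ! (pc + len_exp e + ?l) = Load d d"
    using Ar.prems by (simp del: comp_addr.simps)
  then have "run P 1 (pc + len_exp e + ?l, m2) (Suc (pc + len_exp e + ?l), ?m)"
    using m2(2) val unfolding One_nat_def by (intro run_instr) (auto intro: run_refl)
  from run_trans[OF run_trans[OF m1(1) m2(1)] this]
  have "run P (len_exp e + ?l + 1) (pc, m) (pc + (len_exp e + ?l + 1), ?m)"
    by (simp add: add.assoc del: comp_addr.simps)
  moreover have "len_exp e + ?l + 1 = len_exp (Ar k e)" by simp
  ultimately have "run P (len_exp (Ar k e)) (pc, m) (pc + len_exp (Ar k e), ?m)" by metis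
  moreover have "agree d m ?m" using agr Ar.prems by (auto simp: agree_def)
  ultimately show ?case by (intro exI[of _ ?m] conjI) (assumption | simp only: fun_upd_same ev.simps)+
next
  case (Ite c e f)
  let ?q = "pc + len_exp c + 1" and ?end = "pc + len_exp (Ite c e f)"
  have "code_at P pc (comp_exp c d pc)" using Ite.prems(1) by (simp add: Let_def)
  from Ite.IH(1)[OF this] Ite.prems obtain m1
    where m1: "run P (len_exp c) (pc, m) (pc + len_exp c, m1)" "m1 d = ev r a c" "agree d m m1" by auto
  have rep: "rep L r a m1" using rep_agree Ite.prems m1 by blast
  have code: "code_at P (pc + len_exp c) [Jz d (?q + len_exp e + 1)]" "code_at P ?q (comp_exp e d ?q)"
    "code_at P (?q + len_exp e) [Jmp ?end]"
    "code_at P (?q + len_exp e + 1) (comp_exp f d (?q + len_exp e + 1))"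
    using Ite.prems(1) by (simp_all add: Let_def add.assoc)
  have jz: "run P 1 (pc + len_exp c, m1) (if ev r a c = 0 then ?q + len_exp e + 1 else ?q, m1)"
    unfolding One_nat_def by (intro run_instr) (use code(1) m1(2) in \<open>auto intro: run_refl\<close>)
  show ?case
  proof (cases "ev r a c = 0")
    case True
    with Ite.IH(3)[OF code(4)] Ite.prems rep obtain m2 where
      m2: "run P (len_exp f) (?q + len_exp e + 1, m1) (?q + len_exp e + 1 + len_exp f, m2)"
        "m2 d = ev r a f" "agree d m1 m2" by auto
    have "run P 1 (pc + len_exp c, m1) (?q + len_exp e + 1, m1)" using jz True by simp
    from run_trans[OF run_trans[OF m1(1) this] m2(1)]
    have "run P (len_exp c + 1 + len_exp f) (pc, m) (?end, m2)" by (simp add: ac_simps)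
    then have "run P (len_exp (Ite c e f)) (pc, m) (?end, m2)" by (rule run_mono) simp
    with m2 m1 True show ?thesis by (auto intro: agree_trans)
  next
    case False
    with Ite.IH(2)[OF code(2)] Ite.prems rep obtain m2 where
      m2: "run P (len_exp e) (?q, m1) (?q + len_exp e, m2)"
        "m2 d = ev r a e" "agree d m1 m2" by auto
    have jmp: "run P 1 (?q + len_exp e, m2) (?end, m2)"
      unfolding One_nat_def by (intro run_instr) (use code(3) in \<open>auto intro: run_refl\<close>)
    have "run P 1 (pc + len_exp c, m1) (?q, m1)" using jz False by simp
    from run_trans[OF run_trans[OF run_trans[OF m1(1) this] m2(1)] jmp]
    have "run P (len_exp (Ite c e f)) (pc, m) (?end, m2)" by (rule run_mono) simp
    with m2 m1 False show ?thesis by (auto intro: agree_trans)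
  qed
qed

section \<open>Compilation of commands\<close>

fun len_com :: "com \<Rightarrow> nat" where
  "len_com Skip = 0"
| "len_com (Assign x e) = len_exp e + 2"
| "len_com (Upd k e f) = len_exp e + len_exp f + (if k = raw then 0 else 8) + 1"
| "len_com (c ;; d) = len_com c + len_com d"
| "len_com (Cond e c d) = len_exp e + 1 + len_com c + 1 + len_com d"
| "len_com (While e c) = len_exp e + 1 + len_com c + 1"

text \<open>In an array update cell 1 holds the index and cell 2 the value, so the address
  computation uses cell 3 as its scratch cell.\<close>

fun comp :: "com \<Rightarrow> nat \<Rightarrow> instr list" where
  "comp Skip pc = []"
| "comp (Assign x e) pc = comp_exp e 1 pc @ [Const x 0, Add x x 1]"
| "comp (Upd k e f) pc = comp_exp e 1 pc @ comp_exp f 2 (pc + len_exp e) @ comp_addr k 1 3 @ [Store 1 2]"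
| "comp (c ;; d) pc = comp c pc @ comp d (pc + len_com c)"
| "comp (Cond e c d) pc = (let q = pc + len_exp e + 1 in
     comp_exp e 1 pc @ [Jz 1 (q + len_com c + 1)] @ comp c q
       @ [Jmp (q + len_com c + 1 + len_com d)] @ comp d (q + len_com c + 1))"
| "comp (While e c) pc = (let q = pc + len_exp e + 1 in
     comp_exp e 1 pc @ [Jz 1 (q + len_com c + 1)] @ comp c q @ [Jmp pc])"

fun wf_com :: "com \<Rightarrow> bool" where
  "wf_com Skip = True"
| "wf_com (Assign x e) = (wf_exp e 1 \<and> 10 \<le> x \<and> x < 32)"
| "wf_com (Upd k e f) = (wf_exp e 1 \<and> wf_exp f 2 \<and> k \<le> raw)"
| "wf_com (c ;; d) = (wf_com c \<and> wf_com d)"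
| "wf_com (Cond e c d) = (wf_exp e 1 \<and> wf_com c \<and> wf_com d)"
| "wf_com (While e c) = (wf_exp e 1 \<and> wf_com c)"

lemma length_comp [simp]: "length (comp c pc) = len_com c"
  by (induction c arbitrary: pc) (auto simp: Let_def)

text \<open>The offset from \<open>L\<close> modulo 32 reveals the array, the quotient the index;
  raw addresses lie below \<open>L\<close>.\<close>

lemma addr_inj:
  assumes "k \<le> raw" "j \<le> raw" "32 \<le> L" "idx_ok L k i" "idx_ok L j i'"
  shows "addr L k i = addr L j i' \<longleftrightarrow> k = j \<and> i = i'"
proof -
  have "L + 32 * a + k = L + 32 * b + j \<longleftrightarrow> a = b \<and> k = j" if "k < 32" "j < 32" for a b :: nat
  proof
    assume "L + 32 * a + k = L + 32 * b + j"
    then have eq: "k + 32 * a = j + 32 * b" by simp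
    then have "(k + 32 * a) mod 32 = (j + 32 * b) mod 32" by simp
    with that have "k = j" by simp
    with eq show "a = b \<and> k = j" by simp
  qed simp
  then show ?thesis using assms by (auto simp: addr_def idx_ok_def split: if_splits)
qed

lemma rep_upd:
  assumes "rep L r a m" "k \<le> raw" "idx_ok L k i"
  shows "rep L r (a(k := (a k)(nat i := v))) (m(addr L k i := v))"
proof -
  have ge: "32 \<le> addr L k i" using assms by (auto simp: addr_def idx_ok_def rep_def)
  have 1: "(m(addr L k i := v)) (L + 32 * i' + j) = (a(k := (a k)(nat i := v))) j i'" if "j < 32" for j i'
    using addr_inj[of j k L "int i'" i] that assms ge
    by (auto simp: addr_def idx_ok_def rep_def split: if_splits)
  have 2: "(m(addr L k i := v)) i' = (a(k := (a k)(nat i := v))) raw i'" if "32 \<le> i'" "i' < L" for i'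
    using addr_inj[of raw k L "int i'" i] that assms ge
    by (auto simp: addr_def idx_ok_def rep_def split: if_splits)
  show ?thesis using assms(1) ge 1 2 unfolding rep_def by auto
qed

text \<open>Each counted assignment or test accounts for a piece of code no longer than the whole
  command, so a bound \<open>B\<close> on the code length serves as cost of one counted
  step.\<close>

lemma run_comp:
  assumes "big_step L c r a n r' a'" "code_at P pc (comp c pc)" "wf_com c" "rep L r a m" "len_com c \<le> B"
  shows "\<exists>m'. run P (B * n) (pc, m) (pc + len_com c, m') \<and> rep L r' a' m'"
  using assms
proof (induction arbitrary: pc m rule: big_step.induct)
  case (Skip r a)
  then show ?case by (auto intro: run_refl)
next
  case (Assign r a e x)
  then obtain m1 where m1: "run P (len_exp e) (pc, m) (pc + len_exp e, m1)" "m1 1 = ev r a e" "agree 1 m m1"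
    using run_comp_exp[of P pc e 1 L r a m] by auto
  let ?m = "m1(x := ev r a e)"
  have "run P 2 (pc + len_exp e, m1) (pc + len_com (Assign x e), ?m)"
    using Assign.prems m1(2) by (auto intro!: run_instr run_refl simp: eval_nat_numeral)
  with m1(1) have "run P (len_com (Assign x e)) (pc, m) (pc + len_com (Assign x e), ?m)"
    by (metis len_com.simps(2) run_trans)
  then have "run P (B * 1) (pc, m) (pc + len_com (Assign x e), ?m)" by (rule run_mono) (use Assign.prems in simp)
  moreover have "rep L (r(x := ev r a e)) a ?m"
    using rep_agree[OF Assign.prems(3) m1(3)] Assign.prems(2) by (auto simp: rep_def)
  ultimately show ?case by blast
next
  case (Upd r a e f k)
  then obtain m1 where m1: "run P (len_exp e) (pc, m) (pc + len_exp e, m1)" "m1 1 = ev r a e" "agree 1 m m1"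
    using run_comp_exp[of P pc e 1 L r a m] by auto
  have rep1: "rep L r a m1" using rep_agree Upd.prems m1 by blast
  with Upd obtain m2 where m2: "run P (len_exp f) (pc + len_exp e, m1) (pc + len_exp e + len_exp f, m2)"
      "m2 2 = ev r a f" "agree 2 m1 m2"
    using run_comp_exp[of P "pc + len_exp e" f 2 L r a m1] by auto
  have rep2: "rep L r a m2" using rep_agree[OF rep1 m2(3)] by simp
  let ?l = "length (comp_addr k 1 3)" and ?q = "pc + len_exp e + len_exp f"
  have m21: "m2 1 = ev r a e" using m1 m2 by (auto simp: agree_def)
  have "code_at P ?q (comp_addr k 1 3)" using Upd.prems by (simp add: ac_simps)
  from run_comp_addr[OF this rep2] obtain m3
    where m3: "run P ?l (?q, m2) (?q + ?l, m3)" "m3 1 = int (addr L k (ev r a e))"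
      "\<forall>q. q \<noteq> 1 \<and> q \<noteq> 3 \<longrightarrow> m3 q = m2 q" using Upd.hyps m21 by auto
  have rep3: "rep L r a m3" by (rule rep_agree[OF rep2, of 1]) (use m3 in \<open>auto simp: agree_def\<close>)
  let ?m = "m3(addr L k (ev r a e) := ev r a f)" and ?n = "len_exp e + len_exp f + ?l + 1"
  have "?q + ?l < length P \<and> P ! (?q + ?l) = Store 1 2"
    using Upd.prems by (simp add: ac_simps del: comp_addr.simps)
  then have "run P 1 (?q + ?l, m3) (Suc (?q + ?l), ?m)"
    using m3 m2 unfolding One_nat_def by (intro run_instr) (auto intro: run_refl)
  from run_trans[OF run_trans[OF run_trans[OF m1(1) m2(1)] m3(1)] this]
  have "run P ?n (pc, m) (pc + ?n, ?m)" by (simp add: ac_simps del: comp_addr.simps)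
  moreover have "?n = len_com (Upd k e f)" by simp
  ultimately have "run P (B * 1) (pc, m) (pc + len_com (Upd k e f), ?m)"
    using Upd.prems(4) by (metis mult.right_neutral run_mono)
  moreover have "rep L r (a(k := (a k)(nat (ev r a e) := ev r a f))) ?m"
    using Upd.prems(2) by (intro rep_upd[OF rep3 _ Upd.hyps(3)]) simp
  ultimately show ?case by blast
next
  case (Seq c r a n1 r' a' d n2 r'' a'')
  then obtain m1 where m1: "run P (B * n1) (pc, m) (pc + len_com c, m1)" "rep L r' a' m1" by fastforce
  with Seq obtain m2 where m2: "run P (B * n2) (pc + len_com c, m1) (pc + len_com c + len_com d, m2)"
    "rep L r'' a'' m2" by fastforce
  from run_trans[OF m1(1) m2(1)] have "run P (B * (n1 + n2)) (pc, m) (pc + len_com (c ;; d), m2)"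
    by (simp add: algebra_simps)
  with m2 show ?case by blast
next
  case (CondT r a e c n r' a' d)
  let ?q = "pc + len_exp e + 1" and ?end = "pc + len_com (Cond e c d)"
  have code: "code_at P (pc + len_exp e) [Jz 1 (?q + len_com c + 1)]" "code_at P ?q (comp c ?q)"
    "code_at P (?q + len_com c) [Jmp ?end]" "code_at P pc (comp_exp e 1 pc)"
    using CondT.prems(1) by (simp_all add: Let_def add.assoc)
  obtain m1 where m1: "run P (len_exp e) (pc, m) (pc + len_exp e, m1)" "m1 1 = ev r a e" "agree 1 m m1"
    using run_comp_exp[OF code(4) _ _ CondT.prems(3) CondT.hyps(1)] CondT.prems by auto
  have jz: "run P 1 (pc + len_exp e, m1) (?q, m1)"
    unfolding One_nat_def by (intro run_instr) (use code(1) m1(2) CondT.hyps in \<open>auto intro: run_refl\<close>)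
  obtain m2 where m2: "run P (B * n) (?q, m1) (?q + len_com c, m2)" "rep L r' a' m2"
    using CondT.IH[OF code(2) _ rep_agree[OF CondT.prems(3) m1(3)]] CondT.prems by auto
  have "run P 1 (?q + len_com c, m2) (?end, m2)"
    unfolding One_nat_def by (intro run_instr) (use code(3) in \<open>auto intro: run_refl\<close>)
  from run_trans[OF run_trans[OF run_trans[OF m1(1) jz] m2(1)] this]
  have "run P (B * Suc n) (pc, m) (?end, m2)" by (rule run_mono) (use CondT.prems(4) in simp)
  with m2 show ?case by blast
next
  case (CondF r a e d n r' a' c)
  let ?q = "pc + len_exp e + 1 + len_com c + 1" and ?end = "pc + len_com (Cond e c d)"
  have code: "code_at P (pc + len_exp e) [Jz 1 ?q]" "code_at P ?q (comp d ?q)"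
    "code_at P pc (comp_exp e 1 pc)"
    using CondF.prems(1) by (simp_all add: Let_def add.assoc)
  obtain m1 where m1: "run P (len_exp e) (pc, m) (pc + len_exp e, m1)" "m1 1 = ev r a e" "agree 1 m m1"
    using run_comp_exp[OF code(3) _ _ CondF.prems(3) CondF.hyps(1)] CondF.prems by auto
  have jz: "run P 1 (pc + len_exp e, m1) (?q, m1)"
    unfolding One_nat_def by (intro run_instr) (use code(1) m1(2) CondF.hyps in \<open>auto intro: run_refl\<close>)
  obtain m2 where m2: "run P (B * n) (?q, m1) (?q + len_com d, m2)" "rep L r' a' m2"
    using CondF.IH[OF code(2) _ rep_agree[OF CondF.prems(3) m1(3)]] CondF.prems by auto
  from run_trans[OF run_trans[OF m1(1) jz] m2(1)]
  have "run P (B * Suc n) (pc, m) (?q + len_com d, m2)" by (rule run_mono) (use CondF.prems(4) in simp)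
  with m2 show ?case by (auto simp: ac_simps)
next
  case (WhileF r a e c)
  let ?end = "pc + len_com (While e c)"
  have code: "code_at P (pc + len_exp e) [Jz 1 ?end]" "code_at P pc (comp_exp e 1 pc)"
    using WhileF.prems(1) by (simp_all add: Let_def add.assoc)
  obtain m1 where m1: "run P (len_exp e) (pc, m) (pc + len_exp e, m1)" "m1 1 = ev r a e" "agree 1 m m1"
    using run_comp_exp[OF code(2) _ _ WhileF.prems(3) WhileF.hyps(1)] WhileF.prems by auto
  have jz: "run P 1 (pc + len_exp e, m1) (?end, m1)"
    unfolding One_nat_def by (intro run_instr) (use code(1) m1(2) WhileF.hyps in \<open>auto intro: run_refl\<close>)
  from run_trans[OF m1(1) jz]
  have "run P (B * 1) (pc, m) (?end, m1)" by (rule run_mono) (use WhileF.prems(4) in simp)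
  with rep_agree[OF WhileF.prems(3) m1(3)] show ?case by auto
next
  case (WhileT r a e c n1 r' a' n2 r'' a'')
  let ?q = "pc + len_exp e + 1" and ?end = "pc + len_com (While e c)"
  have code: "code_at P (pc + len_exp e) [Jz 1 ?end]" "code_at P ?q (comp c ?q)"
    "code_at P (?q + len_com c) [Jmp pc]" "code_at P pc (comp_exp e 1 pc)"
    using WhileT.prems(1) by (simp_all add: Let_def add.assoc)
  obtain m1 where m1: "run P (len_exp e) (pc, m) (pc + len_exp e, m1)" "m1 1 = ev r a e" "agree 1 m m1"
    using run_comp_exp[OF code(4) _ _ WhileT.prems(3) WhileT.hyps(1)] WhileT.prems by auto
  have jz: "run P 1 (pc + len_exp e, m1) (?q, m1)"
    unfolding One_nat_def by (intro run_instr) (use code(1) m1(2) WhileT.hyps in \<open>auto intro: run_refl\<close>)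
  obtain m2 where m2: "run P (B * n1) (?q, m1) (?q + len_com c, m2)" "rep L r' a' m2"
    using WhileT.IH(1)[OF code(2) _ rep_agree[OF WhileT.prems(3) m1(3)]] WhileT.prems by auto
  have "run P 1 (?q + len_com c, m2) (pc, m2)"
    unfolding One_nat_def by (intro run_instr) (use code(3) in \<open>auto intro: run_refl\<close>)
  from run_trans[OF run_trans[OF run_trans[OF m1(1) jz] m2(1)] this]
  \<comment> \<open>The one step counted for the test also pays for the conditional jump and for the
    jump back.\<close>
  have *: "run P (B + B * n1) (pc, m) (pc, m2)" by (rule run_mono) (use WhileT.prems(4) in simp)
  obtain m3 where m3: "run P (B * n2) (pc, m2) (?end, m3)" "rep L r'' a'' m3"
    using WhileT.IH(2)[OF WhileT.prems(1,2) m2(2) WhileT.prems(4)] by auto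
  from run_trans[OF * m3(1)] have "run P (B * Suc (n1 + n2)) (pc, m) (?end, m3)"
    by (simp add: algebra_simps)
  with m3 show ?case by blast
qed


section \<open>Weakest preconditions\<close>

text \<open>Total correctness with a clock: \<open>t\<close> is the time already spent, and the
  postcondition sees it increased by the cost of the run. The run asserted here is the one that
  \<open>run_comp\<close> transfers to the machine.\<close>

definition wp :: "nat \<Rightarrow> com \<Rightarrow> (regs \<Rightarrow> arrs \<Rightarrow> nat \<Rightarrow> bool) \<Rightarrow> regs \<Rightarrow> arrs \<Rightarrow> nat \<Rightarrow> bool" where
  "wp L c Q r a t \<longleftrightarrow> (\<exists>n r' a'. big_step L c r a n r' a' \<and> Q r' a' (t + n))"

inductive_cases SkipE: "big_step L Skip r a n r' a'"
inductive_cases AssignE: "big_step L (Assign x e) r a n r' a'"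
inductive_cases UpdE: "big_step L (Upd k e f) r a n r' a'"
inductive_cases SeqE: "big_step L (c ;; d) r a n r' a'"
inductive_cases CondE: "big_step L (Cond e c d) r a n r' a'"

lemma wp_Skip [simp]: "wp L Skip Q r a t = Q r a t"
  unfolding wp_def by (auto elim!: SkipE intro: big_step.Skip) (metis add.right_neutral big_step.Skip)

lemma wp_Assign [simp]:
  "wp L (Assign x e) Q r a t \<longleftrightarrow> safe L r a e \<and> Q (r(x := ev r a e)) a (Suc t)"
  unfolding wp_def by (auto elim!: AssignE) (metis Suc_eq_plus1 big_step.Assign)

lemma wp_Upd [simp]:
  "wp L (Upd k e f) Q r a t \<longleftrightarrow> safe L r a e \<and> safe L r a f \<and> idx_ok L k (ev r a e) \<and>
     Q r (a(k := (a k)(nat (ev r a e) := ev r a f))) (Suc t)"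
  unfolding wp_def by (auto elim!: UpdE) (metis Suc_eq_plus1 big_step.Upd)

lemma wp_Seq [simp]: "wp L (c ;; d) Q r a t \<longleftrightarrow> wp L c (wp L d Q) r a t"
  unfolding wp_def by (auto elim!: SeqE simp: add.assoc) (metis big_step.Seq add.assoc)+

lemma wp_Cond [simp]:
  "wp L (Cond e c d) Q r a t \<longleftrightarrow> safe L r a e \<and>
     (if ev r a e \<noteq> 0 then wp L c Q r a (Suc t) else wp L d Q r a (Suc t))"
  unfolding wp_def by (auto elim!: CondE) (metis big_step.CondT big_step.CondF add_Suc_right)+

lemma wp_mono:
  assumes "wp L c Q r a t" "\<And>r a t. Q r a t \<Longrightarrow> Q' r a t"
  shows "wp L c Q' r a t"
  using assms unfolding wp_def by blast

fun assigned :: "com \<Rightarrow> nat set" where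
  "assigned (Assign x e) = {x}"
| "assigned (c ;; d) = assigned c \<union> assigned d"
| "assigned (Cond e c d) = assigned c \<union> assigned d"
| "assigned (While e c) = assigned c"
| "assigned c = {}"

fun updated :: "com \<Rightarrow> nat set" where
  "updated (Upd k e f) = {k}"
| "updated (c ;; d) = updated c \<union> updated d"
| "updated (Cond e c d) = updated c \<union> updated d"
| "updated (While e c) = updated c"
| "updated c = {}"

definition frame :: "com \<Rightarrow> regs \<Rightarrow> arrs \<Rightarrow> regs \<Rightarrow> arrs \<Rightarrow> bool" where
  "frame c r a r' a' \<longleftrightarrow> (\<forall>x. x \<notin> assigned c \<longrightarrow> r' x = r x) \<and> (\<forall>k. k \<notin> updated c \<longrightarrow> a' k = a k)"

lemma big_step_frame: "big_step L c r a n r' a' \<Longrightarrow> frame c r a r' a'"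
  by (induction rule: big_step.induct) (auto simp: frame_def)

lemma wp_frame:
  assumes "wp L c Q r a t" "\<And>r' a' t'. Q r' a' t' \<Longrightarrow> frame c r a r' a' \<Longrightarrow> Q' r' a' t'"
  shows "wp L c Q' r a t"
  using assms big_step_frame unfolding wp_def by blast

lemma frame_trans: "frame c r a r' a' \<Longrightarrow> frame c r' a' r'' a'' \<Longrightarrow> frame c r a r'' a''"
  by (simp add: frame_def)

text \<open>The natural number \<open>n\<close> is the variant. The frame relative to the initial
  state comes for free in every round, so invariants mention only what the body changes.\<close>

lemma wp_While:
  assumes "I n r a t"
    and "\<And>n r' a' t'. I n r' a' t' \<Longrightarrow> frame c r a r' a' \<Longrightarrow> safe L r' a' e"
    and "\<And>n r' a' t'. I n r' a' t' \<Longrightarrow> frame c r a r' a' \<Longrightarrow> ev r' a' e = 0 \<Longrightarrow> Q r' a' (Suc t')"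
    and "\<And>n r' a' t'. I n r' a' t' \<Longrightarrow> frame c r a r' a' \<Longrightarrow> ev r' a' e \<noteq> 0 \<Longrightarrow>
       wp L c (\<lambda>r'' a'' t''. \<exists>n'<(n::nat). I n' r'' a'' t'') r' a' (Suc t')"
  shows "wp L (While e c) Q r a t"
proof -
  have "wp L (While e c) Q r' a' t'" if "I n r' a' t'" "frame c r a r' a'" for n r' a' t'
    using that
  proof (induction n arbitrary: r' a' t' rule: less_induct)
    case (less n)
    show ?case
    proof (cases "ev r' a' e = 0")
      case True
      then have "big_step L (While e c) r' a' 1 r' a'" using assms(2) less.prems by (intro big_step.WhileF)
      then show ?thesis using assms(3)[OF less.prems True] unfolding wp_def by fastforce
    next
      case False
      have "wp L c (\<lambda>r'' a'' t''. (\<exists>n'<n. I n' r'' a'' t'') \<and> frame c r a r'' a'') r' a' (Suc t')"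
        by (rule wp_frame[OF assms(4)[OF less.prems False]]) (use frame_trans[OF less.prems(2)] in auto)
      then obtain m r'' a'' n' where
        m: "big_step L c r' a' m r'' a''" "I n' r'' a'' (Suc t' + m)" "n' < n" "frame c r a r'' a''"
        unfolding wp_def by blast
      from less.IH[OF m(3,2,4)] obtain k r3 a3 where
        k: "big_step L (While e c) r'' a'' k r3 a3" "Q r3 a3 (Suc t' + m + k)" unfolding wp_def by blast
      have "big_step L (While e c) r' a' (Suc (m + k)) r3 a3"
        by (rule big_step.WhileT[OF assms(2)[OF less.prems] False m(1) k(1)])
      then show ?thesis using k(2) unfolding wp_def by (metis add.assoc add_Suc_shift)
    qed
  qed
  from this[OF assms(1)] show ?thesis by (simp add: frame_def)
qed

definition For :: "nat \<Rightarrow> nat \<Rightarrow> com \<Rightarrow> com" where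
  "For i n c = Assign i (K 0) ;; While (Mi (V n) (V i)) (c ;; Assign i (Pl (V i) (K 1)))"

lemma For_simps [simp]: "wf_com (For i n c) \<longleftrightarrow> 10 \<le> i \<and> i < 32 \<and> 10 \<le> n \<and> n < 32 \<and> wf_com c"
  "assigned (For i n c) = insert i (assigned c)" "updated (For i n c) = updated c"
  by (auto simp: For_def)

text \<open>The loop condition tests for inequality, so the counter must not be changed by the body.\<close>

lemma wp_For:
  assumes "I 0 (r(i := 0)) a (Suc t)" "r n = int N" "i \<noteq> n" "i \<notin> assigned c" "n \<notin> assigned c"
    and step: "\<And>j r' a' t'. j < N \<Longrightarrow> I j r' a' t' \<Longrightarrow> r' i = int j \<Longrightarrow> r' n = int N \<Longrightarrow>
       frame (For i n c) r a r' a' \<Longrightarrow>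
       wp L c (\<lambda>r' a' t'. I (Suc j) (r'(i := int (Suc j))) a' (Suc t')) r' a' (Suc t')"
    and fin: "\<And>r' a' t'. I N r' a' t' \<Longrightarrow> r' i = int N \<Longrightarrow> frame (For i n c) r a r' a' \<Longrightarrow> Q r' a' (Suc t')"
  shows "wp L (For i n c) Q r a t"
proof -
  have fr: "frame (For i n c) r a r' a'"
    if "frame (c ;; Assign i (Pl (V i) (K 1))) (r(i := 0)) a r' a'" for r' a'
    using that by (auto simp: frame_def)
  show ?thesis
    unfolding For_def wp_Seq wp_Assign safe.simps ev.simps simp_thms
  proof (rule wp_While[where n = N and I = "\<lambda>k r a t. r n = int N \<and> (\<exists>j\<le>N. k = N - j \<and> r i = int j \<and> I j r a t)"])
    show "(r(i := 0)) n = int N \<and> (\<exists>j\<le>N. N = N - j \<and> (r(i := 0)) i = int j \<and> I j (r(i := 0)) a (Suc t))"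
      using assms by auto
  next
    fix k r' a' t'
    assume "r' n = int N \<and> (\<exists>j\<le>N. k = N - j \<and> r' i = int j \<and> I j r' a' t')"
      "frame (c ;; Assign i (Pl (V i) (K 1))) (r(i := 0)) a r' a'" "ev r' a' (Mi (V n) (V i)) = 0"
    then show "Q r' a' (Suc t')" using fin fr by auto
  next
    fix k r' a' t'
    assume 1: "r' n = int N \<and> (\<exists>j\<le>N. k = N - j \<and> r' i = int j \<and> I j r' a' t')"
      and 2: "frame (c ;; Assign i (Pl (V i) (K 1))) (r(i := 0)) a r' a'" "ev r' a' (Mi (V n) (V i)) \<noteq> 0"
    then obtain j where j: "j < N" "k = N - j" "r' i = int j" "I j r' a' t'" "r' n = int N" by force
    from step[OF j(1,4,3,5) fr[OF 2(1)]]
    have "wp L c (\<lambda>r'' a'' t''. (I (Suc j) (r''(i := int (Suc j))) a'' (Suc t'')) \<and> r'' n = int N \<and> r'' i = int j)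
      r' a' (Suc t')"
      by (rule wp_frame) (use assms(4,5) j in \<open>auto simp: frame_def\<close>)
    then show "wp L (c ;; Assign i (Pl (V i) (K 1))) (\<lambda>r'' a'' t''. \<exists>n'<k. r'' n = int N \<and>
        (\<exists>j\<le>N. n' = N - j \<and> r'' i = int j \<and> I j r'' a'' t'')) r' a' (Suc t')"
      unfolding wp_Seq
    proof (rule wp_mono)
      fix r a t assume h: "I (Suc j) (r(i := int (Suc j))) a (Suc t) \<and> r n = int N \<and> r i = int j"
      let ?r = "r(i := r i + 1)"
      have "?r i = int (Suc j) \<and> I (Suc j) ?r a (Suc t) \<and> ?r n = int N"
        using h \<open>i \<noteq> n\<close> by (simp add: add.commute)
      then have "N - Suc j < k \<and> ?r n = int N \<and>
          (\<exists>j'\<le>N. N - Suc j = N - j' \<and> ?r i = int j' \<and> I j' ?r a (Suc t))"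
        using j by (auto intro!: exI[of _ "Suc j"])
      then have "\<exists>n'<k. ?r n = int N \<and> (\<exists>j\<le>N. n' = N - j \<and> ?r i = int j \<and> I j ?r a (Suc t))"
        by blast
      then show "wp L (Assign i (Pl (V i) (K 1))) (\<lambda>r a t. \<exists>n'<k. r n = int N \<and>
          (\<exists>j\<le>N. n' = N - j \<and> r i = int j \<and> I j r a t)) r a t" by simp
    qed
  qed auto
qed

section \<open>Graph search\<close>

abbreviation (input) "rP \<equiv> 10::nat"
abbreviation (input) "rND \<equiv> 11::nat"
abbreviation (input) "rNB \<equiv> 12::nat"
abbreviation (input) "rX \<equiv> 13::nat"
abbreviation (input) "rY \<equiv> 14::nat"
abbreviation (input) "rM \<equiv> 15::nat"
abbreviation (input) "rN \<equiv> 16::nat"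
abbreviation (input) "rI \<equiv> 17::nat"
abbreviation (input) "rSP \<equiv> 18::nat"
abbreviation (input) "rU \<equiv> 19::nat"
abbreviation (input) "rE \<equiv> 20::nat"
abbreviation (input) "rW \<equiv> 21::nat"
abbreviation (input) "rZ \<equiv> 22::nat"
abbreviation (input) "rF \<equiv> 23::nat"

abbreviation (input) "aIN \<equiv> 0::nat"
abbreviation (input) "aSRC \<equiv> 1::nat"
abbreviation (input) "aDST \<equiv> 2::nat"
abbreviation (input) "aCI \<equiv> 3::nat"
abbreviation (input) "aCOND \<equiv> 4::nat"
abbreviation (input) "aINIT \<equiv> 5::nat"
abbreviation (input) "aHEAD \<equiv> 6::nat"
abbreviation (input) "aNEXT \<equiv> 7::nat"
abbreviation (input) "aMARK \<equiv> 8::nat"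
abbreviation (input) "aSTK \<equiv> 9::nat"

text \<open>An arc \<open>(s, d, c)\<close> leads from \<open>s\<close> to \<open>d\<close> and is enabled if cell \<open>c\<close> of the condition array is non-zero.\<close>

type_synonym arc = "nat \<times> nat \<times> nat"

definition arcs_rep :: "regs \<Rightarrow> arrs \<Rightarrow> arc list \<Rightarrow> bool" where
  "arcs_rep r a T \<longleftrightarrow> r rM = int (length T) \<and> (\<forall>e<length T. a aSRC e = int (fst (T ! e)) \<and>
     a aDST e = int (fst (snd (T ! e))) \<and> a aCI e = int (snd (snd (T ! e))))"

definition arc_rel :: "arc list \<Rightarrow> (nat \<Rightarrow> bool) \<Rightarrow> (nat \<times> nat) set" where
  "arc_rel T P = {(s, d). \<exists>c. (s, d, c) \<in> set T \<and> P c}"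

definition stack :: "int \<Rightarrow> (nat \<Rightarrow> int) \<Rightarrow> nat list \<Rightarrow> bool" where
  "stack sp st xs \<longleftrightarrow> sp = int (length xs) \<and> (\<forall>i<length xs. st i = int (xs ! i))"

text \<open>Links hold the arc index plus one, so that 0 can mark the end of a list.\<close>

fun chain :: "(nat \<Rightarrow> int) \<Rightarrow> int \<Rightarrow> nat list \<Rightarrow> bool" where
  "chain nx h [] \<longleftrightarrow> h = 0"
| "chain nx h (e # es) \<longleftrightarrow> h = int e + 1 \<and> chain nx (nx e) es"

lemma stack_Nil: "stack 0 st []"
  by (simp add: stack_def)

lemma stack_push: "stack sp st xs \<Longrightarrow> stack (sp + 1) (st(nat sp := int v)) (xs @ [v])"
  by (auto simp: stack_def nth_append)

lemma stack_pop: "stack sp st (xs @ [v]) \<Longrightarrow> stack (sp - 1) st xs \<and> st (nat (sp - 1)) = int v"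
  by (auto simp: stack_def nth_append split: if_splits)

lemma chain_upd: "chain nx h es \<Longrightarrow> j \<notin> set es \<Longrightarrow> chain (nx(j := v)) h es"
  by (induction es arbitrary: h) auto

text \<open>Arcs are handled in increasing order and pushed at the front of their list, hence the
  descending order.\<close>

definition adj :: "arc list \<Rightarrow> (nat \<Rightarrow> bool) \<Rightarrow> nat \<Rightarrow> nat \<Rightarrow> nat list" where
  "adj T P j v = filter (\<lambda>e. P (snd (snd (T ! e))) \<and> fst (T ! e) = v) (rev [0..<j])"

lemma adj_0: "adj T P 0 v = []"
  by (simp add: adj_def)

lemma adj_Suc: "adj T P (Suc j) v =
    (if P (snd (snd (T ! j))) \<and> fst (T ! j) = v then j # adj T P j v else adj T P j v)"
  by (simp add: adj_def)

lemma adj_less: "e \<in> set (adj T P j v) \<Longrightarrow> e < j"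
  by (auto simp: adj_def)

lemma sum_length_filter_le:
  "finite D \<Longrightarrow> (\<Sum>v\<in>D. length (filter (\<lambda>e. P e \<and> f e = v) xs)) \<le> length xs"
proof (induction xs)
  case (Cons x xs)
  have "(\<Sum>v\<in>D. length (filter (\<lambda>e. P e \<and> f e = v) (x # xs))) =
      (\<Sum>v\<in>D. (if f x = v then of_bool (P x) else 0) + length (filter (\<lambda>e. P e \<and> f e = v) xs))"
    by (intro sum.cong) auto
  also have "\<dots> \<le> 1 + length xs" using Cons by (simp add: sum.distrib)
  finally show ?case by simp
qed simp

text \<open>An arc occurs in the list of its source only. Expanding a set of nodes thus scans at
  most as many list entries as there are arcs, which makes the search linear.\<close>

lemma sum_adj_le: "finite D \<Longrightarrow> (\<Sum>v\<in>D. length (adj T P j v)) \<le> j"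
  using sum_length_filter_le[of D _ "\<lambda>e. fst (T ! e)" "rev [0..<j]"] by (simp add: adj_def)

text \<open>The first assignment undoes the shift of the link. Nodes are marked when pushed, so none
  enters the stack twice.\<close>

definition visit :: com where
  "visit =
     Assign rE (Mi (V rE) (K 1)) ;;
     Assign rW (Ar aDST (V rE)) ;;
     Cond (Ar aMARK (V rW)) Skip
       (Upd aMARK (V rW) (K 1) ;; Upd aSTK (V rSP) (V rW) ;; Assign rSP (Pl (V rSP) (K 1))) ;;
     Assign rE (Ar aNEXT (V rE))"

definition pop_loop :: com where
  "pop_loop = While (V rE) visit"

text \<open>Adjacency lists are rebuilt by every search, because the enabled arcs depend on the
  query; the cost has the same order as the search itself.\<close>

definition search :: com where
  "search =
     Assign rSP (K 0) ;;
     For rI rN (Upd aHEAD (V rI) (K 0) ;; Upd aMARK (V rI) (Ar aINIT (V rI)) ;;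
       Cond (Ar aINIT (V rI)) (Upd aSTK (V rSP) (V rI) ;; Assign rSP (Pl (V rSP) (K 1))) Skip) ;;
     For rI rM (Cond (Ar aCOND (Ar aCI (V rI)))
       (Upd aNEXT (V rI) (Ar aHEAD (Ar aSRC (V rI))) ;; Upd aHEAD (Ar aSRC (V rI)) (Pl (V rI) (K 1))) Skip) ;;
     While (V rSP) (
       Assign rSP (Mi (V rSP) (K 1)) ;;
       Assign rE (Ar aHEAD (Ar aSTK (V rSP))) ;;
       pop_loop)"

text \<open>\<open>D\<close> is the set of expanded nodes and \<open>xs\<close> the stack.\<close>

definition dfs_inv :: "nat \<Rightarrow> (nat \<times> nat) set \<Rightarrow> nat set \<Rightarrow> nat set \<Rightarrow> nat list \<Rightarrow> regs \<Rightarrow> arrs \<Rightarrow> bool" where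
  "dfs_inv N R S D xs r a \<longleftrightarrow> distinct xs \<and> stack (r rSP) (a aSTK) xs \<and> D \<inter> set xs = {} \<and>
     {v. v < N \<and> a aMARK v \<noteq> 0} = D \<union> set xs \<and>
     (\<forall>v<N. a aMARK v \<noteq> 0 \<longrightarrow> (\<exists>s\<in>S. (s, v) \<in> R\<^sup>*)) \<and> (\<forall>s\<in>S. s < N \<and> a aMARK s \<noteq> 0)"

lemma dfs_inv_push:
  assumes "dfs_inv N R S D xs r a" "w < N" "a aMARK w = 0" "\<exists>s\<in>S. (s, w) \<in> R\<^sup>*"
    and "r' rSP = r rSP + 1" "a' aSTK = (a aSTK)(nat (r rSP) := int w)" "a' aMARK = (a aMARK)(w := 1)"
  shows "dfs_inv N R S D (xs @ [w]) r' a'"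
proof -
  have w: "w \<notin> D \<union> set xs" using assms(1,3) unfolding dfs_inv_def by blast
  have "{v. v < N \<and> a' aMARK v \<noteq> 0} = insert w {v. v < N \<and> a aMARK v \<noteq> 0}"
    using assms(2,7) by auto
  then have "{v. v < N \<and> a' aMARK v \<noteq> 0} = D \<union> set (xs @ [w])"
    using assms(1) by (simp add: dfs_inv_def)
  then show ?thesis
    using assms w unfolding dfs_inv_def by (auto intro: stack_push)
qed

lemma dfs_inv_cong:
  "dfs_inv N R S D xs r a \<Longrightarrow> r' rSP = r rSP \<Longrightarrow> a' aSTK = a aSTK \<Longrightarrow> a' aMARK = a aMARK \<Longrightarrow>
   dfs_inv N R S D xs r' a'"
  by (simp add: dfs_inv_def)

lemma wp_pop_loop:
  assumes T: "\<And>e. e < M \<Longrightarrow> a aDST e = int (dst e) \<and> dst e < N"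
    and inv: "dfs_inv N R S D xs r a" and es: "chain (a aNEXT) (r rE) es" "set es \<subseteq> {..<M}"
    and reach: "\<And>e. e \<in> set es \<Longrightarrow> \<exists>s\<in>S. (s, dst e) \<in> R\<^sup>*"
    and fin: "\<And>r' a' t' ys. dfs_inv N R S D ys r' a' \<Longrightarrow> \<forall>e\<in>set es. a' aMARK (dst e) \<noteq> 0 \<Longrightarrow>
      \<forall>v. a aMARK v \<noteq> 0 \<longrightarrow> a' aMARK v \<noteq> 0 \<Longrightarrow> t' \<le> t + 8 * length es + 1 \<Longrightarrow>
      frame pop_loop r a r' a' \<Longrightarrow> Q r' a' t'"
  shows "wp L pop_loop Q r a t"
  unfolding pop_loop_def
\<comment> \<open>\<open>us\<close> is the scanned part of the list and \<open>vs\<close> the rest.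
  The factor 8 is one loop test plus at most 7 steps of \<open>visit\<close>.\<close>
proof (rule wp_While[where n = "length es" and I = "\<lambda>n r' a' t'. \<exists>us vs ys. es = us @ vs \<and> n = length vs \<and>
      chain (a aNEXT) (r' rE) vs \<and> dfs_inv N R S D ys r' a' \<and> (\<forall>e\<in>set us. a' aMARK (dst e) \<noteq> 0) \<and>
      (\<forall>v. a aMARK v \<noteq> 0 \<longrightarrow> a' aMARK v \<noteq> 0) \<and> t' \<le> t + 8 * length us"], goal_cases)
  case 1
  then show ?case using es inv by fastforce
next
  case (2 n r' a' t')
  then show ?case by simp
next
  case (3 n r' a' t')
  then obtain us vs ys where *: "es = us @ vs" "chain (a aNEXT) (r' rE) vs" "dfs_inv N R S D ys r' a'"
    "\<forall>e\<in>set us. a' aMARK (dst e) \<noteq> 0" "\<forall>v. a aMARK v \<noteq> 0 \<longrightarrow> a' aMARK v \<noteq> 0" "t' \<le> t + 8 * length us"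
    by blast
  have "vs = []" using *(2) 3(3) by (cases vs) auto
  with * 3(2) show ?case by (intro fin[of ys]) (auto simp: frame_def pop_loop_def visit_def)
next
  case (4 n r' a' t')
  then obtain us vs ys where *: "es = us @ vs" "n = length vs" "chain (a aNEXT) (r' rE) vs"
    "dfs_inv N R S D ys r' a'" "\<forall>e\<in>set us. a' aMARK (dst e) \<noteq> 0"
    "\<forall>v. a aMARK v \<noteq> 0 \<longrightarrow> a' aMARK v \<noteq> 0" "t' \<le> t + 8 * length us"
    by blast
  from 4(3) *(3) obtain e vs' where vs: "vs = e # vs'" by (cases vs) auto
  then have rE: "r' rE = int e + 1" and ch: "chain (a aNEXT) (a aNEXT e) vs'" using *(3) by auto
  have e: "e < M" "e \<in> set es" using es(2) *(1) vs by auto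
  have fr: "a' aDST = a aDST" "a' aNEXT = a aNEXT" using 4(2) by (auto simp: frame_def visit_def)
  have dst: "a' aDST e = int (dst e)" "dst e < N" using T[OF e(1)] fr by auto
  define J where "J = (\<lambda>r'' a'' t''. \<exists>n'<n. \<exists>us vs ys. es = us @ vs \<and> n' = length vs \<and>
      chain (a aNEXT) (r'' rE) vs \<and> dfs_inv N R S D ys r'' a'' \<and> (\<forall>e\<in>set us. a'' aMARK (dst e) \<noteq> 0) \<and>
      (\<forall>v. a aMARK v \<noteq> 0 \<longrightarrow> a'' aMARK v \<noteq> 0) \<and> t'' \<le> t + 8 * length us)"
  have I: "J r'' a'' t''" if "dfs_inv N R S D zs r'' a''" "r'' rE = a aNEXT e"
    "\<forall>v. a' aMARK v \<noteq> 0 \<longrightarrow> a'' aMARK v \<noteq> 0" "a'' aMARK (dst e) \<noteq> 0" "t'' \<le> t' + 8" for r'' a'' t'' zs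
    unfolding J_def using that * vs ch
    by (intro exI[of _ "length vs'"] conjI exI[of _ "us @ [e]"] exI[of _ vs'] exI[of _ zs]) auto
  have sp: "0 \<le> r' rSP" using *(4) by (simp add: dfs_inv_def stack_def)
  have "wp L visit J r' a' (Suc t')"
  proof (cases "a' aMARK (dst e) = 0")
    case True
    have "J r'' a'' t''" if "r'' rSP = r' rSP + 1"
      "a'' aSTK = (a' aSTK)(nat (r' rSP) := int (dst e))" "a'' aMARK = (a' aMARK)(dst e := 1)"
      "r'' rE = a aNEXT e" "t'' \<le> t' + 8" for r'' a'' t''
    proof (rule I)
      show "dfs_inv N R S D (ys @ [dst e]) r'' a''"
        by (rule dfs_inv_push[where r = r' and a = a']) (fact *(4) dst(2) True reach[OF e(2)] that)+
    qed (use that(3-5) in auto)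
    then show ?thesis
      using rE dst sp fr True by (auto simp: visit_def idx_ok_def)
  next
    case False
    then show ?thesis
      using rE dst sp fr by (auto simp: visit_def idx_ok_def intro!: I dfs_inv_cong[OF *(4)])
  qed
  then show ?case by (rule wp_mono) (simp add: J_def)
qed


lemma wp_search:
  assumes N: "r rN = int N" and T: "arcs_rep r a T" and bd: "\<And>s d c. (s, d, c) \<in> set T \<Longrightarrow> s < N \<and> d < N"
    and fin: "\<And>r' a' t'. \<forall>v<N. a' aMARK v \<noteq> 0 \<longleftrightarrow>
        (\<exists>s<N. a aINIT s \<noteq> 0 \<and> (s, v) \<in> (arc_rel T (\<lambda>c. a aCOND c \<noteq> 0))\<^sup>*) \<Longrightarrow>
      t' \<le> t + 30 * (N + length T + 1) \<Longrightarrow> frame search r a r' a' \<Longrightarrow> Q r' a' t'"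
  shows "wp L search Q r a t"
proof -
  define P where "P = (\<lambda>c. a aCOND c \<noteq> 0)"
  define R where "R = arc_rel T P"
  define S where "S = {s. s < N \<and> a aINIT s \<noteq> 0}"
  define M where "M = length T"
  define src where "src e = fst (T ! e)" for e
  define dst where "dst e = fst (snd (T ! e))" for e
  define ci where "ci e = snd (snd (T ! e))" for e
  have rM: "r rM = int M" using T by (simp add: arcs_rep_def M_def)
  have arr: "a aSRC e = int (src e)" "a aDST e = int (dst e)" "a aCI e = int (ci e)" if "e < M" for e
    using T that by (simp_all add: arcs_rep_def M_def src_def dst_def ci_def)
  have bd': "src e < N" "dst e < N" if "e < M" for e
    using bd[of "src e" "dst e" "ci e"] that by (simp_all add: M_def src_def dst_def ci_def)
  have mem: "(src e, dst e) \<in> R" if "e \<in> set (adj T P M v)" for e v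
    using that by (auto simp: adj_def R_def arc_rel_def src_def dst_def M_def) (metis nth_mem prod.collapse)
  have adj_src: "src e = v" "e < M" if "e \<in> set (adj T P M v)" for e v
    using that by (auto simp: adj_def src_def)
  have R_adj: "\<exists>e\<in>set (adj T P M u). dst e = v" if "(u, v) \<in> R" for u v
    using that by (fastforce simp: R_def arc_rel_def adj_def dst_def M_def in_set_conv_nth)
  \<comment> \<open>The 2 stands for the initial assignments to the stack pointer and the counter,
    the 7 for test, increment and at most 5 steps of the body.\<close>
  let ?I1 = "\<lambda>j r' a' t'. (\<forall>v<j. a' aHEAD v = 0 \<and> a' aMARK v = a aINIT v) \<and> t' \<le> t + 2 + 7 * j \<and>
     (\<exists>xs. distinct xs \<and> set xs = {v. v < j \<and> a aINIT v \<noteq> 0} \<and> stack (r' rSP) (a' aSTK) xs)"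
  show ?thesis
    unfolding search_def wp_Seq wp_Assign safe.simps ev.simps simp_thms
  proof (rule wp_For[where N = N and I = ?I1], goal_cases)
    case 1
    then show ?case by (auto simp: stack_Nil)
  next
    case (6 j r' a' t')
    then have INIT: "a' aINIT = a aINIT" by (auto simp: frame_def)
    from 6 obtain xs where xs: "distinct xs" "set xs = {v. v < j \<and> a aINIT v \<noteq> 0}" "stack (r' rSP) (a' aSTK) xs"
      by blast
    have sp: "0 \<le> r' rSP" using xs by (simp add: stack_def)
    have ex: "\<exists>xs. distinct xs \<and> set xs = {v. (v < j \<or> v = j) \<and> a aINIT v \<noteq> 0} \<and> stack s st xs"
      if "if a aINIT j = 0 then s = r' rSP \<and> st = a' aSTK
          else s = r' rSP + 1 \<and> st = (a' aSTK)(nat (r' rSP) := int j)" for s st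
    proof (cases "a aINIT j = 0")
      case True
      then show ?thesis using that xs by (intro exI[of _ xs]) auto
    next
      case False
      then show ?thesis using that xs
        by (intro exI[of _ "xs @ [j]"]) (auto intro: stack_push)
    qed
    show ?case using 6 INIT sp by (auto simp: idx_ok_def less_Suc_eq intro!: ex)
  next
    case (7 r1 a1 t1)
    then obtain xs where xs: "distinct xs" "set xs = S" "stack (r1 rSP) (a1 aSTK) xs" by (auto simp: S_def)
    have HM: "a1 aHEAD v = 0" "a1 aMARK v = a aINIT v" if "v < N" for v using 7 that by auto
    have t1: "t1 \<le> t + 2 + 7 * N" using 7 by simp
    from 7(3) have fr1: "\<And>x. x \<noteq> rI \<Longrightarrow> x \<noteq> rSP \<Longrightarrow> r1 x = r x"
      "\<And>k. k \<noteq> aHEAD \<Longrightarrow> k \<noteq> aMARK \<Longrightarrow> k \<noteq> aSTK \<Longrightarrow> a1 k = a k"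
      by (auto simp: frame_def)
    let ?I2 = "\<lambda>j r' a' t'. (\<forall>v<N. chain (a' aNEXT) (a' aHEAD v) (adj T P j v)) \<and> t' \<le> t1 + 2 + 5 * j"
    show ?case
    proof (rule wp_For[where N = M and I = ?I2], goal_cases)
      case 1
      then show ?case by (simp add: HM adj_0)
    next
      case 2
      then show ?case using fr1 rM by simp
    next
      case (6 j r' a' t')
      then have fr: "a' aSRC = a aSRC" "a' aCI = a aCI" "a' aCOND = a aCOND"
        using fr1 by (auto simp: frame_def)
      \<comment> \<open>Arc \<open>j\<close> occurs in no list built so far, so setting its link
        destroys none of them.\<close>
      have ch: "chain ((a' aNEXT)(j := h)) (a' aHEAD v) (adj T P j v)" if "v < N" for v h
        using 6 that by (auto intro!: chain_upd dest: adj_less)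
      have "adj T P (Suc j) v = (if P (ci j) \<and> src j = v then j # adj T P j v else adj T P j v)" for v
        by (simp add: adj_Suc ci_def src_def)
      with 6 ch bd' arr fr show ?case by (auto simp: idx_ok_def P_def)
    next
      case (7 r2 a2 t2)
      then have chain: "\<And>v. v < N \<Longrightarrow> chain (a2 aNEXT) (a2 aHEAD v) (adj T P M v)"
        and t2: "t2 \<le> t1 + 2 + 5 * M" by auto
      from 7(3) fr1 have fr2: "\<And>x. x \<noteq> rI \<Longrightarrow> x \<noteq> rSP \<Longrightarrow> r2 x = r x" "r2 rSP = r1 rSP"
        "\<And>k. k \<noteq> aHEAD \<Longrightarrow> k \<noteq> aMARK \<Longrightarrow> k \<noteq> aSTK \<Longrightarrow> k \<noteq> aNEXT \<Longrightarrow> a2 k = a k"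
        "a2 aSTK = a1 aSTK" "a2 aMARK = a1 aMARK"
        by (auto simp: frame_def)
      have inv0: "dfs_inv N R S {} xs r2 a2"
        using xs fr2 HM unfolding dfs_inv_def by (auto simp: S_def)
      \<comment> \<open>A popped node enters \<open>D\<close> before its arcs are scanned, which
        decreases the variant. It pays 4 for the outer test, two assignments and the last inner
        test, and 8 for each of its arcs.\<close>
      let ?I3 = "\<lambda>n r' a' t'. \<exists>D xs. D \<subseteq> {..<N} \<and> n = N - card D \<and> dfs_inv N R S D xs r' a' \<and>
          (\<forall>u\<in>D. \<forall>e\<in>set (adj T P M u). a' aMARK (dst e) \<noteq> 0) \<and>
          t' \<le> t2 + 1 + (\<Sum>u\<in>D. 4 + 8 * length (adj T P M u))"
      show ?case
      proof (rule wp_While[where n = N and I = ?I3], goal_cases)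
        case 1
        show ?case using inv0 by (intro exI[of _ "{}"] exI[of _ xs]) simp
      next
        case (2 n r' a' t')
        then show ?case by simp
      next
        case (3 n r' a' t')
        then obtain D xs where D: "D \<subseteq> {..<N}" "dfs_inv N R S D xs r' a'"
          "\<forall>u\<in>D. \<forall>e\<in>set (adj T P M u). a' aMARK (dst e) \<noteq> 0"
          "t' \<le> t2 + 1 + (\<Sum>u\<in>D. 4 + 8 * length (adj T P M u))" by blast
        have "xs = []" using D(2) 3(3) by (simp add: dfs_inv_def stack_def)
        with D(2) have mark: "{v. v < N \<and> a' aMARK v \<noteq> 0} = D"
          "\<And>v. v < N \<Longrightarrow> a' aMARK v \<noteq> 0 \<Longrightarrow> \<exists>s\<in>S. (s, v) \<in> R\<^sup>*" "\<And>s. s \<in> S \<Longrightarrow> s < N \<and> a' aMARK s \<noteq> 0"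
          by (simp_all add: dfs_inv_def)
        \<comment> \<open>With an empty stack the marked nodes are exactly the expanded ones, so the
          marks are closed under arcs.\<close>
        have clos: "a' aMARK v \<noteq> 0 \<and> v < N" if "(s, v) \<in> R\<^sup>*" "s \<in> S" for s v
          using that
        proof (induction rule: rtrancl_induct)
          case base
          then show ?case using mark(3) by blast
        next
          case (step u v)
          then have "u \<in> D" using mark(1) by blast
          moreover obtain e where "e \<in> set (adj T P M u)" "dst e = v" using R_adj[OF step.hyps(2)] by blast
          ultimately show ?case using D(3) adj_src(2) bd'(2) by blast
        qed
        have finD: "finite D" "card D \<le> N" using D(1) finite_subset card_mono[of "{..<N}" D] by auto
        show ?case
        proof (rule fin)
          show "\<forall>v<N. a' aMARK v \<noteq> 0 \<longleftrightarrow>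
              (\<exists>s<N. a aINIT s \<noteq> 0 \<and> (s, v) \<in> (arc_rel T (\<lambda>c. a aCOND c \<noteq> 0))\<^sup>*)"
            using mark(2) clos unfolding S_def R_def P_def by blast
          have "(\<Sum>u\<in>D. 4 + 8 * length (adj T P M u)) = 4 * card D + 8 * (\<Sum>u\<in>D. length (adj T P M u))"
            by (simp add: sum.distrib sum_distrib_left)
          also have "\<dots> \<le> 4 * N + 8 * M" using sum_adj_le[of D T P M] finD by simp
          finally show "Suc t' \<le> t + 30 * (N + length T + 1)" using D(4) t1 t2 by (simp add: M_def)
          show "frame search r a r' a'"
            using 3(2) fr2 by (auto simp: frame_def search_def pop_loop_def visit_def)
        qed
      next
        case (4 n r' a' t')
        then obtain D xs where D: "D \<subseteq> {..<N}" "n = N - card D" "dfs_inv N R S D xs r' a'"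
          "\<forall>u\<in>D. \<forall>e\<in>set (adj T P M u). a' aMARK (dst e) \<noteq> 0"
          "t' \<le> t2 + 1 + (\<Sum>u\<in>D. 4 + 8 * length (adj T P M u))" by blast
        have "xs \<noteq> []" using D(3) 4(3) by (auto simp: dfs_inv_def stack_def)
        then obtain ys u where xs: "xs = ys @ [u]" by (metis rev_exhaust)
        have u: "u < N" "a' aMARK u \<noteq> 0" "u \<notin> D" "u \<notin> set ys"
          using D(3) unfolding dfs_inv_def xs by auto
        have sp: "0 < r' rSP" "stack (r' rSP - 1) (a' aSTK) ys" "a' aSTK (nat (r' rSP - 1)) = int u"
          using D(3) stack_pop[of "r' rSP" "a' aSTK" ys u] unfolding dfs_inv_def xs by (auto simp: stack_def)
        have fr: "a' aHEAD = a2 aHEAD" "a' aNEXT = a2 aNEXT" "a' aDST = a aDST"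
          using 4(2) fr2 by (auto simp: frame_def pop_loop_def visit_def)
        let ?r = "r'(rSP := r' rSP - 1, rE := a' aHEAD u)" and ?es = "adj T P M u"
        have inv: "dfs_inv N R S (insert u D) ys ?r a'"
          using D(3) sp u unfolding dfs_inv_def xs by auto
        have finD: "finite D" using D(1) finite_subset by auto
        have cardD: "N - card (insert u D) < N - card D"
        proof -
          have "card (insert u D) \<le> card {..<N}" by (rule card_mono) (use D(1) u in auto)
          then show ?thesis using finD u by simp
        qed
        have "wp L pop_loop (\<lambda>r'' a'' t''. \<exists>n'<n. ?I3 n' r'' a'' t'') ?r a' (Suc (Suc (Suc t')))"
        proof (rule wp_pop_loop[where dst = dst and M = M, OF _ inv])
          show "a' aDST e = int (dst e) \<and> dst e < N" if "e < M" for e using that fr arr bd' by simp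
          show "chain (a' aNEXT) (?r rE) ?es" using chain[OF u(1)] fr by simp
          show "set ?es \<subseteq> {..<M}" using adj_src by auto
          show "\<exists>s\<in>S. (s, dst e) \<in> R\<^sup>*" if e: "e \<in> set ?es" for e
          proof -
            obtain s where "s \<in> S" "(s, u) \<in> R\<^sup>*" using D(3) u unfolding dfs_inv_def by blast
            with mem[OF e] adj_src(1)[OF e] show ?thesis by (auto intro: rtrancl_into_rtrancl)
          qed
        next
          fix r'' a'' t'' zs
          assume h: "dfs_inv N R S (insert u D) zs r'' a''" "\<forall>e\<in>set ?es. a'' aMARK (dst e) \<noteq> 0"
            "\<forall>v. a' aMARK v \<noteq> 0 \<longrightarrow> a'' aMARK v \<noteq> 0" "t'' \<le> Suc (Suc (Suc t')) + 8 * length ?es + 1"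
          have "?I3 (N - card (insert u D)) r'' a'' t''"
            using h D u finD by (intro exI[of _ "insert u D"] exI[of _ zs]) auto
          with cardD D(2) show "\<exists>n'<n. ?I3 n' r'' a'' t''" by blast
        qed
        then show ?case using sp u by (auto simp: idx_ok_def)
      qed
    qed auto
  qed (use N in auto)
qed

abbreviation (input) dbl :: "exp \<Rightarrow> exp" where "dbl e \<equiv> Pl e e"

section \<open>Loops that fill arrays\<close>

definition mapv :: "nat \<Rightarrow> exp \<Rightarrow> com" where
  "mapv k e = For rI rP (Upd k (V rI) e)"

lemma mapv_simps [simp]: "wf_com (mapv k e) \<longleftrightarrow> wf_exp e 2 \<and> k \<le> raw"
  "assigned (mapv k e) = {rI}" "updated (mapv k e) = {k}"
  by (auto simp: mapv_def)

text \<open>The expression is evaluated while array \<open>k\<close> is partly overwritten; hence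
  its value is required for every \<open>b\<close> that agrees with \<open>a\<close> outside
  \<open>k\<close>.\<close>

lemma wp_mapv:
  assumes p: "r rP = int p" and k: "k \<noteq> raw"
    and e: "\<And>v b. v < p \<Longrightarrow> (\<And>q. q \<noteq> k \<Longrightarrow> b q = a q) \<Longrightarrow>
      safe L (r(rI := int v)) b e \<and> ev (r(rI := int v)) b e = g v"
    and fin: "Q (r(rI := int p)) (a(k := (\<lambda>v. if v < p then g v else a k v))) (t + 3 * p + 2)"
  shows "wp L (mapv k e) Q r a t"
  unfolding mapv_def
proof (rule wp_For[where N = p and I = "\<lambda>j r' a' t'. r' = r(rI := int j) \<and>
     a' = a(k := (\<lambda>v. if v < j then g v else a k v)) \<and> t' = t + 1 + 3 * j"], goal_cases)
  case (6 j r' a' t')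
  have "safe L r' a' e \<and> ev r' a' e = g j" using e[of j a'] 6 by simp
  with 6 k show ?case by (auto simp: idx_ok_def fun_eq_iff)
next
  case (7 r' a' t')
  then show ?case using fin by simp
qed (use p in auto)

definition same :: "nat set \<Rightarrow> nat set \<Rightarrow> regs \<Rightarrow> arrs \<Rightarrow> regs \<Rightarrow> arrs \<Rightarrow> bool" where
  "same X Y r a r' a' \<longleftrightarrow> (\<forall>x. x \<notin> X \<longrightarrow> r' x = r x) \<and> (\<forall>k. k \<notin> Y \<longrightarrow> a' k = a k)"

lemma same_refl [simp]: "same X Y r a r a"
  by (simp add: same_def)

lemma same_trans:
  "same X Y r a r' a' \<Longrightarrow> same X' Y' r' a' r'' a'' \<Longrightarrow> X \<subseteq> X'' \<Longrightarrow> X' \<subseteq> X'' \<Longrightarrow> Y \<subseteq> Y'' \<Longrightarrow> Y' \<subseteq> Y'' \<Longrightarrow>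
   same X'' Y'' r a r'' a''"
  unfolding same_def by (metis subsetD)

lemma same_mono: "same X Y r a r' a' \<Longrightarrow> X \<subseteq> X' \<Longrightarrow> Y \<subseteq> Y' \<Longrightarrow> same X' Y' r a r' a'"
  by (rule same_trans[OF _ same_refl]) auto

lemma frame_same:
  "frame c r a r' a' \<Longrightarrow> assigned c \<subseteq> X \<Longrightarrow> updated c \<subseteq> Y \<Longrightarrow> same X Y r a r' a'"
  by (auto simp: frame_def same_def)

text \<open>Each node \<open>v\<close> owns a block of cells starting at the value of
  \<open>b\<close>; the cells with offset \<open>c\<close> are filled for all nodes by a loop of
  their own.\<close>

fun setc :: "nat \<Rightarrow> exp \<Rightarrow> (nat \<Rightarrow> exp) \<Rightarrow> nat \<Rightarrow> com" where
  "setc k b e 0 = Skip"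
| "setc k b e (Suc n) = setc k b e n ;; For rI rP (Upd k (Pl b (K (int n))) (e n))"

lemma wp_setc:
  assumes p: "r rP = int p" and k: "k \<noteq> raw" and n: "n \<le> m"
    and b: "\<And>v r' a'. r' rI = int v \<Longrightarrow> safe L r' a' b \<and> ev r' a' b = int (m * v)"
    and e: "\<And>v c r' a'. v < p \<Longrightarrow> c < n \<Longrightarrow> same {rI} {k} r a r' a' \<Longrightarrow> r' rI = int v \<Longrightarrow>
      safe L r' a' (e c) \<and> g c v (ev r' a' (e c))"
    and fin: "\<And>r' a' t'. \<forall>c<n. \<forall>v<p. g c v (a' k (m * v + c)) \<Longrightarrow> same {rI} {k} r a r' a' \<Longrightarrow>
      t' \<le> t + n * (3 * p + 2) \<Longrightarrow> Q r' a' t'"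
  shows "wp L (setc k b e n) Q r a t"
  using n e fin
proof (induction n arbitrary: Q)
  case 0
  show ?case by (simp, rule 0(3)) auto
next
  case (Suc n)
  show ?case
    unfolding setc.simps wp_Seq
  proof (rule Suc.IH, goal_cases)
    case 1
    then show ?case using Suc.prems(1) by simp
  next
    case (2 v c r' a')
    then show ?case using Suc.prems(2) by simp
  next
    case (3 a1 r1 t1)
    then have p1: "r1 rP = int p" using p by (auto simp: same_def)
    have fr: "same {rI} {k} r a r' a'"
      if "frame (For rI rP (Upd k (Pl b (K (int n))) (e n))) r1 a1 r' a'" for r' a'
      by (rule same_trans[OF 3(2) frame_same[OF that, of "{rI}" "{k}"]]) auto
    \<comment> \<open>Offsets are below the block size \<open>m\<close>, so the residue modulo
      \<open>m\<close> recovers the offset and later loops spare earlier results.\<close>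
    have ne: "m * v + c \<noteq> m * j + n" if "c < n" for v c j
    proof
      assume "m * v + c = m * j + n"
      then have "(m * v + c) mod m = (m * j + n) mod m" by simp
      then show False using that Suc.prems(1) by simp
    qed
    show ?case
    proof (rule wp_For[where N = p and I = "\<lambda>j r' a' t'. (\<forall>c<n. \<forall>v<p. g c v (a' k (m * v + c))) \<and>
        (\<forall>v<j. g n v (a' k (m * v + n))) \<and> t' = t1 + 1 + 3 * j"], goal_cases)
      case (6 j r' a' t')
      then have *: "safe L r' a' (e n) \<and> g n j (ev r' a' (e n))" using Suc.prems(2)[of j n] fr by simp
      have **: "safe L r' a' b \<and> ev r' a' b = int (m * j)" using b 6(3) by simp
      have "int (m * j) + int n = int (m * j + n)" by simp
      then have "nat (int (m * j) + int n) = m * j + n" by (simp only: nat_int)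
      then show ?case using 6 * ** k ne Suc.prems(1) by (auto simp: idx_ok_def less_Suc_eq simp del: of_nat_mult)
    next
      case (7 r' a' t')
      have "\<forall>c<Suc n. \<forall>v<p. g c v (a' k (m * v + c))" using 7(1) by (auto simp: less_Suc_eq)
      moreover have "Suc t' \<le> t + Suc n * (3 * p + 2)" using 7(1) 3(3) by simp
      ultimately show ?case using Suc.prems(3) fr[OF 7(3)] by blast
    qed (use 3 p1 in auto)
  qed
qed

text \<open>Six arc classes use blocks of size 8, reachable by three doublings; a node has two
  initial cells, one per entry mark.\<close>

definition setcond :: "(nat \<Rightarrow> exp) \<Rightarrow> (bool \<Rightarrow> exp) \<Rightarrow> com" where
  "setcond e i = setc aCOND (dbl (dbl (dbl (V rI)))) e 6 ;; setc aINIT (dbl (V rI)) (\<lambda>c. i (c = 1)) 2"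

lemma wp_setcond:
  assumes p: "r rP = int p"
    and e: "\<And>v c r' a'. v < p \<Longrightarrow> c < 6 \<Longrightarrow> same {rI} {aCOND, aINIT} r a r' a' \<Longrightarrow> r' rI = int v \<Longrightarrow>
      safe L r' a' (e c) \<and> g c v (ev r' a' (e c))"
    and i: "\<And>v c r' a'. v < p \<Longrightarrow> same {rI} {aCOND, aINIT} r a r' a' \<Longrightarrow> r' rI = int v \<Longrightarrow>
      safe L r' a' (i c) \<and> h c v (ev r' a' (i c))"
    and fin: "\<And>r' a' t'. \<forall>c<6. \<forall>v<p. g c v (a' aCOND (8 * v + c)) \<Longrightarrow>
      \<forall>c. \<forall>v<p. h c v (a' aINIT (2 * v + of_bool c)) \<Longrightarrow>
      same {rI} {aCOND, aINIT} r a r' a' \<Longrightarrow> t' \<le> t + 30 * (p + 1) \<Longrightarrow> Q r' a' t'"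
  shows "wp L (setcond e i) Q r a t"
  unfolding setcond_def wp_Seq
proof (rule wp_setc[where m = 8 and p = p and g = g], goal_cases)
  case (5 v c r' a')
  then show ?case using e same_mono[OF 5(3)] by auto
next
  case (6 r1 a1 t1)
  show ?case
  proof (rule wp_setc[where m = 2 and p = p and g = "\<lambda>c. h (c = 1)"], goal_cases)
    case 1
    show ?case using 6(2) p by (simp add: same_def)
  next
    case (5 v c r' a')
    then show ?case using i same_trans[OF 6(2) 5(3)] by auto
  next
    case (6 r2 a2 t2)
    note 1 = \<open>\<forall>c<6. \<forall>v<p. g c v (a1 aCOND (8 * v + c))\<close> \<open>same {rI} {aCOND} r a r1 a1\<close>
      \<open>t1 \<le> t + 6 * (3 * p + 2)\<close>
    have "a2 aCOND = a1 aCOND" using 6(2) by (auto simp: same_def)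
    moreover have "\<forall>c. \<forall>v<p. h c v (a2 aINIT (2 * v + of_bool c))"
      using 6(1)[rule_format, of 0] 6(1)[rule_format, of 1] by (auto simp: of_bool_def)
    moreover have "same {rI} {aCOND, aINIT} r a r2 a2" using same_trans[OF 1(2) 6(2)] by auto
    ultimately show ?case using fin 1 6(3) by auto
  qed auto
qed (use p in auto)

section \<open>Reachability queries\<close>

definition enc :: "nat \<times> bool \<Rightarrow> nat" where
  "enc s = 2 * fst s + of_bool (snd s)"

lemma inj_enc: "inj enc"
proof (rule injI)
  fix s t assume *: "enc s = enc t"
  then have "even (enc s) = even (enc t)" by simp
  then have "snd s = snd t" by (auto simp: enc_def of_bool_def split: if_splits)
  with * show "s = t" by (simp add: enc_def prod_eq_iff)
qed

text \<open>Injectivity prevents paths from being joined at codes of different states.\<close>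

lemma rtrancl_map_prod:
  assumes "inj f"
  shows "(f s, f t) \<in> (map_prod f f ` A)\<^sup>* \<longleftrightarrow> (s, t) \<in> A\<^sup>*"
proof
  assume "(f s, f t) \<in> (map_prod f f ` A)\<^sup>*"
  then have "\<exists>t'. f t = f t' \<and> (s, t') \<in> A\<^sup>*"
  proof (induction rule: rtrancl_induct)
    case (step y z)
    then obtain u v t' where "(u, v) \<in> A" "y = f u" "z = f v" "y = f t'" "(s, t') \<in> A\<^sup>*" by auto
    then show ?case using assms by (metis injD rtrancl.rtrancl_into_rtrancl)
  qed auto
  then show "(s, t) \<in> A\<^sup>*" using assms by (metis injD)
next
  assume "(s, t) \<in> A\<^sup>*"
  then show "(f s, f t) \<in> (map_prod f f ` A)\<^sup>*"
    by (induction rule: rtrancl_induct) (auto intro: rtrancl_into_rtrancl)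
qed

text \<open>The second component of a state records whether its node was entered through an arrowhead.
  Condition \<open>g c v\<close> enables the arcs of class \<open>c\<close> at \<open>v\<close>; classes 3 and 5 pass \<open>v\<close> as a collider.\<close>

definition state_rel :: "nat admg \<Rightarrow> (nat \<Rightarrow> nat \<Rightarrow> bool) \<Rightarrow> ((nat \<times> bool) \<times> (nat \<times> bool)) set" where
  "state_rel G g =
     {((u, b), (v, True)) | u v b. (u, v) \<in> dir G \<and> g (if b then 1 else 0) u} \<union>
     {((v, b), (u, False)) | u v b. (u, v) \<in> dir G \<and> g (if b then 3 else 2) v} \<union>
     {((u, b), (v, True)) | u v b. (u, v) \<in> bi G \<and> g (if b then 5 else 4) u}"

text \<open>Four arcs per edge: two directions and two entry marks. The condition cell belongs to
  the node that is left, so a query sets a constant number of cells per node, whatever the number of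
  edges.\<close>

fun dir_arcs :: "nat \<times> nat \<Rightarrow> arc list" where
  "dir_arcs (u, v) = [(2 * u, 2 * v + 1, 8 * u), (2 * u + 1, 2 * v + 1, 8 * u + 1),
     (2 * v, 2 * u, 8 * v + 2), (2 * v + 1, 2 * u, 8 * v + 3)]"

fun bi_arcs :: "nat \<times> nat \<Rightarrow> arc list" where
  "bi_arcs (u, v) = [(2 * u, 2 * v + 1, 8 * u + 4), (2 * u + 1, 2 * v + 1, 8 * u + 5),
     (2 * v, 2 * u + 1, 8 * v + 4), (2 * v + 1, 2 * u + 1, 8 * v + 5)]"

definition arcs_of :: "nat admg \<Rightarrow> arc list \<Rightarrow> bool" where
  "arcs_of G T \<longleftrightarrow> (\<exists>ds bs. set ds = dir G \<and> set bs \<union> (set bs)\<inverse> = bi G \<and>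
     T = concat (map dir_arcs ds) @ concat (map bi_arcs bs))"

lemma arc_rel_arcs_of:
  assumes "arcs_of G T"
  shows "arc_rel T (\<lambda>c. g (c mod 8) (c div 8)) = map_prod enc enc ` state_rel G g"
proof -
  obtain ds bs where d: "set ds = dir G" and b: "set bs \<union> (set bs)\<inverse> = bi G"
    and T: "T = concat (map dir_arcs ds) @ concat (map bi_arcs bs)"
    using assms by (auto simp: arcs_of_def)
  have mod8: "(8 * u + k) mod 8 = k \<and> (8 * u + k) div 8 = u" if "k < 8" for u k :: nat using that by simp
  have ap: "arc_rel (xs @ ys) P = arc_rel xs P \<union> arc_rel ys P" for xs ys P by (auto simp: arc_rel_def)
  let ?P = "\<lambda>c. g (c mod 8) (c div 8)"
  have cc: "arc_rel (concat (map f es)) P = (\<Union>e\<in>set es. arc_rel (f e) P)" for f P and es :: "(nat \<times> nat) list"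
    by (auto simp: arc_rel_def)
  \<comment> \<open>Splitting off the mark turns both sides into explicit finite sets, which are
    compared by cases on the four conditions.\<close>
  have bool_comp: "{F b | b. P b} = (if P True then {F True} else {}) \<union> (if P False then {F False} else {})"
    for F :: "bool \<Rightarrow> (nat \<times> bool) \<times> (nat \<times> bool)" and P by (auto split: if_splits) (metis (full_types))+
  note mods = mod8[of 0] mod8[of 1] mod8[of 2] mod8[of 3] mod8[of 4] mod8[of 5]
  have d1: "arc_rel (dir_arcs (u, v)) ?P = map_prod enc enc `
     ({((u, b), (v, True)) | b. g (if b then 1 else 0) u} \<union> {((v, b), (u, False)) | b. g (if b then 3 else 2) v})" for u v
    unfolding bool_comp using mods
    by (cases "g 0 u"; cases "g 1 u"; cases "g 2 v"; cases "g 3 v") (auto simp: arc_rel_def enc_def)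
  have b1: "arc_rel (bi_arcs (u, v)) ?P = map_prod enc enc `
     ({((u, b), (v, True)) | b. g (if b then 5 else 4) u} \<union> {((v, b), (u, True)) | b. g (if b then 5 else 4) v})" for u v
    unfolding bool_comp using mods
    by (cases "g 4 u"; cases "g 5 u"; cases "g 4 v"; cases "g 5 v") (auto simp: arc_rel_def enc_def)
  have 1: "arc_rel (concat (map dir_arcs ds)) ?P = map_prod enc enc ` (
     {((u, b), (v, True)) | u v b. (u, v) \<in> dir G \<and> g (if b then 1 else 0) u} \<union>
     {((v, b), (u, False)) | u v b. (u, v) \<in> dir G \<and> g (if b then 3 else 2) v})"
  proof -
    have "arc_rel (dir_arcs e) ?P = (case e of (u, v) \<Rightarrow> map_prod enc enc `
       ({((u, b), (v, True)) | b. g (if b then 1 else 0) u} \<union> {((v, b), (u, False)) | b. g (if b then 3 else 2) v}))" for e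
      by (cases e) (simp only: d1 prod.case)
    then have "arc_rel (concat (map dir_arcs ds)) ?P = (\<Union>(u, v)\<in>dir G. map_prod enc enc `
       ({((u, b), (v, True)) | b. g (if b then 1 else 0) u} \<union> {((v, b), (u, False)) | b. g (if b then 3 else 2) v}))"
      unfolding cc d by simp
    also have "\<dots> = map_prod enc enc ` (\<Union>(u, v)\<in>dir G. {((u, b), (v, True)) | b. g (if b then 1 else 0) u} \<union>
        {((v, b), (u, False)) | b. g (if b then 3 else 2) v})"
      by (simp add: image_UN case_prod_unfold)
    also have "(\<Union>(u, v)\<in>dir G. {((u, b), (v, True)) | b. g (if b then 1 else 0) u} \<union>
        {((v, b), (u, False)) | b. g (if b then 3 else 2) v}) =
      {((u, b), (v, True)) | u v b. (u, v) \<in> dir G \<and> g (if b then 1 else 0) u} \<union>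
      {((v, b), (u, False)) | u v b. (u, v) \<in> dir G \<and> g (if b then 3 else 2) v}"
      by blast
    finally show ?thesis .
  qed
  have 2: "arc_rel (concat (map bi_arcs bs)) ?P = map_prod enc enc `
     {((u, b), (v, True)) | u v b. (u, v) \<in> bi G \<and> g (if b then 5 else 4) u}"
  proof -
    have "arc_rel (bi_arcs e) ?P = (case e of (u, v) \<Rightarrow> map_prod enc enc `
       ({((u, b), (v, True)) | b. g (if b then 5 else 4) u} \<union> {((v, b), (u, True)) | b. g (if b then 5 else 4) v}))" for e
      by (cases e) (simp only: b1 prod.case)
    then have "arc_rel (concat (map bi_arcs bs)) ?P = (\<Union>(u, v)\<in>set bs. map_prod enc enc `
       ({((u, b), (v, True)) | b. g (if b then 5 else 4) u} \<union> {((v, b), (u, True)) | b. g (if b then 5 else 4) v}))"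
      unfolding cc by simp
    also have "\<dots> = map_prod enc enc ` (\<Union>(u, v)\<in>set bs. {((u, b), (v, True)) | b. g (if b then 5 else 4) u} \<union>
        {((v, b), (u, True)) | b. g (if b then 5 else 4) v})"
      by (simp add: image_UN case_prod_unfold)
    also have "(\<Union>(u, v)\<in>set bs. {((u, b), (v, True)) | b. g (if b then 5 else 4) u} \<union>
        {((v, b), (u, True)) | b. g (if b then 5 else 4) v}) =
      {((u, b), (v, True)) | u v b. (u, v) \<in> bi G \<and> g (if b then 5 else 4) u}"
      \<comment> \<open>Every listed bidirected edge contributes both of its orientations, which
        accounts for the converse in \<open>bi G\<close>.\<close>
      unfolding b[symmetric] by blast
    finally show ?thesis .
  qed
  show ?thesis unfolding T ap 1 2 state_rel_def by (simp add: image_Un)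
qed


text \<open>Guarantees that the search reads only condition cells that have been set; offsets 6 and
  7 of a block are left unset.\<close>

lemma arcs_of_bounds:
  assumes "arcs_of G T" "dir G \<subseteq> {..<p} \<times> {..<p}" "bi G \<subseteq> {..<p} \<times> {..<p}" "(s, d, c) \<in> set T"
  shows "s < 2 * p \<and> d < 2 * p \<and> c mod 8 < 6 \<and> c div 8 < p"
proof -
  obtain ds bs where ds: "set ds = dir G" and bs: "set bs \<union> (set bs)\<inverse> = bi G"
    and T: "T = concat (map dir_arcs ds) @ concat (map bi_arcs bs)"
    using assms(1) by (auto simp: arcs_of_def)
  have "\<exists>x\<in>dir G \<union> bi G. (s, d, c) \<in> set (dir_arcs x) \<union> set (bi_arcs x)"
    using assms(4) unfolding T ds[symmetric] bs[symmetric] set_append set_concat set_map by blast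
  then obtain u v where "(u, v) \<in> dir G \<union> bi G" "(s, d, c) \<in> set (dir_arcs (u, v)) \<union> set (bi_arcs (u, v))"
    by fast
  moreover from this(1) have "u < p" "v < p" using assms(2,3) by auto
  ultimately have "s < 2 * p \<and> d < 2 * p" "u < p" "v < p"
    "c \<in> {8 * u + 0, 8 * u + 1, 8 * u + 4, 8 * u + 5} \<union> {8 * v + 2, 8 * v + 3, 8 * v + 4, 8 * v + 5}"
    by auto
  moreover from this(4) have "\<exists>w k. c = 8 * w + k \<and> k < 6 \<and> (w = u \<or> w = v)"
    by (elim UnE insertE emptyE) (rule exI, rule exI, intro conjI, assumption, simp, simp)+
  then have "c mod 8 < 6 \<and> (c div 8 = u \<or> c div 8 = v)" by auto
  ultimately show ?thesis by auto
qed

definition query :: "(nat \<Rightarrow> exp) \<Rightarrow> (bool \<Rightarrow> exp) \<Rightarrow> com" where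
  "query e i = setcond e i ;; search"

lemma wp_query:
  assumes p: "r rP = int p" "r rN = int (2 * p)" and T: "arcs_rep r a T" "arcs_of G T"
    and G: "dir G \<subseteq> {..<p} \<times> {..<p}" "bi G \<subseteq> {..<p} \<times> {..<p}"
    and e: "\<And>v c r' a'. v < p \<Longrightarrow> c < 6 \<Longrightarrow> same {rI} {aCOND, aINIT} r a r' a' \<Longrightarrow> r' rI = int v \<Longrightarrow>
      safe L r' a' (e c) \<and> (ev r' a' (e c) \<noteq> 0 \<longleftrightarrow> g c v)"
    and i: "\<And>v c r' a'. v < p \<Longrightarrow> same {rI} {aCOND, aINIT} r a r' a' \<Longrightarrow> r' rI = int v \<Longrightarrow>
      safe L r' a' (i c) \<and> (ev r' a' (i c) \<noteq> 0 \<longleftrightarrow> h c v)"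
    and fin: "\<And>r' a' t'. \<forall>v<p. \<forall>b. a' aMARK (2 * v + of_bool b) \<noteq> 0 \<longleftrightarrow>
        (\<exists>u<p. \<exists>b'. h b' u \<and> ((u, b'), (v, b)) \<in> (state_rel G g)\<^sup>*) \<Longrightarrow>
      same {rI, rSP, rE, rW} {aCOND, aINIT, aHEAD, aMARK, aSTK, aNEXT} r a r' a' \<Longrightarrow>
      t' \<le> t + 100 * (p + length T + 1) \<Longrightarrow> Q r' a' t'"
  shows "wp L (query e i) Q r a t"
  unfolding query_def wp_Seq
proof (rule wp_setcond[where p = p and g = "\<lambda>c v x. x \<noteq> 0 \<longleftrightarrow> g c v" and h = "\<lambda>c v x. x \<noteq> 0 \<longleftrightarrow> h c v"],
    goal_cases)
  case (4 r1 a1 t1)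
  have T1: "arcs_rep r1 a1 T" using T(1) 4(3) by (simp add: arcs_rep_def same_def)
  have N1: "r1 rN = int (2 * p)" using p(2) 4(3) by (simp add: same_def)
  note bounds = arcs_of_bounds[OF T(2) G]
  have "a1 aCOND c \<noteq> 0 \<longleftrightarrow> g (c mod 8) (c div 8)" if "(s, d, c) \<in> set T" for s d c
  proof -
    have "a1 aCOND (8 * (c div 8) + c mod 8) \<noteq> 0 \<longleftrightarrow> g (c mod 8) (c div 8)"
      using 4(1) bounds[OF that] by blast
    then show ?thesis by simp
  qed
  then have "arc_rel T (\<lambda>c. a1 aCOND c \<noteq> 0) = arc_rel T (\<lambda>c. g (c mod 8) (c div 8))"
    by (auto simp: arc_rel_def)
  then have rel: "arc_rel T (\<lambda>c. a1 aCOND c \<noteq> 0) = map_prod enc enc ` state_rel G g"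
    using arc_rel_arcs_of[OF T(2)] by simp
  have dec: "\<exists>u<p. \<exists>b. s = enc (u, b)" if "s < 2 * p" for s
    using that by (intro exI[of _ "s div 2"] conjI exI[of _ "odd s"]) (auto simp: enc_def of_bool_def)
  have enc_less: "enc (u, b) < 2 * p" if "u < p" for u b using that by (auto simp: enc_def of_bool_def)
  have init: "a1 aINIT (enc (u, b)) \<noteq> 0 \<longleftrightarrow> h b u" if "u < p" for u b
    using 4(2) that unfolding enc_def fst_conv snd_conv by blast
  show ?case
  proof (rule wp_search[OF N1 T1], goal_cases)
    case (1 s d c)
    then show ?case using bounds by blast
  next
    case (2 r2 a2 t2)
    have "a2 aMARK (enc (v, b)) \<noteq> 0 \<longleftrightarrow> (\<exists>u<p. \<exists>b'. h b' u \<and> ((u, b'), (v, b)) \<in> (state_rel G g)\<^sup>*)"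
      if v: "v < p" for v b
    proof -
      have "a2 aMARK (enc (v, b)) \<noteq> 0 \<longleftrightarrow>
          (\<exists>s<2 * p. a1 aINIT s \<noteq> 0 \<and> (s, enc (v, b)) \<in> (map_prod enc enc ` state_rel G g)\<^sup>*)"
        using 2(1) enc_less[OF v] unfolding rel by blast
      also have "\<dots> \<longleftrightarrow> (\<exists>u<p. \<exists>b'. a1 aINIT (enc (u, b')) \<noteq> 0 \<and>
          (enc (u, b'), enc (v, b)) \<in> (map_prod enc enc ` state_rel G g)\<^sup>*)"
        using dec enc_less by metis
      also have "\<dots> \<longleftrightarrow> (\<exists>u<p. \<exists>b'. h b' u \<and> ((u, b'), (v, b)) \<in> (state_rel G g)\<^sup>*)"
        using init unfolding rtrancl_map_prod[OF inj_enc] by blast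
      finally show ?thesis .
    qed
    moreover have "same {rI, rSP, rE, rW} {aCOND, aINIT, aHEAD, aMARK, aSTK, aNEXT} r a r2 a2"
    proof (rule same_trans[OF 4(3) frame_same[OF 2(3) subset_refl subset_refl]])
    qed (auto simp: search_def pop_loop_def visit_def)
    ultimately show ?case using 2(2) 4(4) by (intro fin) (auto simp: enc_def)
  qed
qed (use p e i in auto)

text \<open>Enabling a single class turns the walk search into plain reachability. Class 1 steps
  forward from a state entered by an arrowhead, which is how forward steps arrive; dually class 2
  searches ancestors from states entered by a tail.\<close>

lemma state_rel_desc:
  "((u, True), (v, True)) \<in> (state_rel G (\<lambda>c v. c = 1))\<^sup>* \<longleftrightarrow> (u, v) \<in> (dir G)\<^sup>*"
proof
  assume "((u, True), (v, True)) \<in> (state_rel G (\<lambda>c v. c = 1))\<^sup>*"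
  then have "(fst (u, True), fst (v, True)) \<in> (dir G)\<^sup>*"
    by (induction rule: rtrancl_induct)
       (auto simp: state_rel_def split: if_splits intro: rtrancl_into_rtrancl)
  then show "(u, v) \<in> (dir G)\<^sup>*" by simp
next
  assume "(u, v) \<in> (dir G)\<^sup>*"
  then show "((u, True), (v, True)) \<in> (state_rel G (\<lambda>c v. c = 1))\<^sup>*"
  proof (induction rule: rtrancl_induct)
    case (step w v)
    then have "((w, True), (v, True)) \<in> state_rel G (\<lambda>c v. c = 1)" by (auto simp: state_rel_def)
    with step.IH show ?case by (rule rtrancl_into_rtrancl)
  qed simp
qed

lemma state_rel_anc:
  "((u, False), (v, False)) \<in> (state_rel G (\<lambda>c v. c = 2))\<^sup>* \<longleftrightarrow> (v, u) \<in> (dir G)\<^sup>*"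
proof
  assume "((u, False), (v, False)) \<in> (state_rel G (\<lambda>c v. c = 2))\<^sup>*"
  then have "(fst (v, False), fst (u, False)) \<in> (dir G)\<^sup>*"
    by (induction rule: rtrancl_induct)
       (auto simp: state_rel_def split: if_splits intro: converse_rtrancl_into_rtrancl)
  then show "(v, u) \<in> (dir G)\<^sup>*" by simp
next
  assume "(v, u) \<in> (dir G)\<^sup>*"
  then show "((u, False), (v, False)) \<in> (state_rel G (\<lambda>c v. c = 2))\<^sup>*"
  proof (induction rule: converse_rtrancl_induct)
    case (step v w)
    then have "((w, False), (v, False)) \<in> state_rel G (\<lambda>c v. c = 2)" by (auto simp: state_rel_def)
    with step.IH show ?case by (rule rtrancl_into_rtrancl)
  qed simp
qed

definition pass_cond :: "nat set \<Rightarrow> nat set \<Rightarrow> nat \<Rightarrow> nat \<Rightarrow> bool" where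
  "pass_cond C N c v \<longleftrightarrow> (if c = 3 \<or> c = 5 then v \<in> C else v \<in> N)"

lemma state_rel_step:
  "((u, b), (v, d)) \<in> state_rel G (pass_cond C N) \<longleftrightarrow> (\<exists>c. passes C N b u c \<and> estep G u c v d)"
proof
  assume "((u, b), (v, d)) \<in> state_rel G (pass_cond C N)"
  then consider "(u, v) \<in> dir G" "d" "pass_cond C N (if b then 1 else 0) u"
    | "(v, u) \<in> dir G" "\<not> d" "pass_cond C N (if b then 3 else 2) u"
    | "(u, v) \<in> bi G" "d" "pass_cond C N (if b then 5 else 4) u"
    unfolding state_rel_def by blast
  then show "\<exists>c. passes C N b u c \<and> estep G u c v d"
  proof cases
    case 1
    then show ?thesis
      by (intro exI[of _ False]) (auto simp: pass_cond_def passes_def split: if_splits intro: estep.intros)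
  next
    case 2
    then show ?thesis
      by (intro exI[of _ True]) (auto simp: pass_cond_def passes_def split: if_splits intro: estep.intros)
  next
    case 3
    then show ?thesis
      by (intro exI[of _ True]) (auto simp: pass_cond_def passes_def split: if_splits intro: estep.intros)
  qed
next
  assume "\<exists>c. passes C N b u c \<and> estep G u c v d"
  then obtain c where "passes C N b u c" "estep G u c v d" by blast
  from this(2,1) show "((u, b), (v, d)) \<in> state_rel G (pass_cond C N)"
  proof cases
    case fwd
    then show "passes C N b u c \<Longrightarrow> ?thesis"
      by (cases b) (auto simp: state_rel_def pass_cond_def passes_def)
  next
    case bwd
    then show "passes C N b u c \<Longrightarrow> ?thesis"
      by (cases b) (auto simp: state_rel_def pass_cond_def passes_def)
  next
    case bid
    then show "passes C N b u c \<Longrightarrow> ?thesis"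
      by (cases b) (auto simp: state_rel_def pass_cond_def passes_def)
  qed
qed

text \<open>Starting with the tail mark makes every first edge count as leaving a non-collider, and
  \<open>s\<close> in \<open>N\<close> enables it. The start state itself contributes the trivial
  alternative.\<close>

lemma state_rel_walk:
  assumes "s \<in> N"
  shows "((s, False), (v, b)) \<in> (state_rel G (pass_cond C N))\<^sup>* \<longleftrightarrow>
    (v = s \<and> \<not> b) \<or> (\<exists>a. mwalk G C N s a v b)"
proof
  assume "((s, False), (v, b)) \<in> (state_rel G (pass_cond C N))\<^sup>*"
  then show "(v = s \<and> \<not> b) \<or> (\<exists>a. mwalk G C N s a v b)"
  proof (induction "(v, b)" arbitrary: v b rule: rtrancl_induct)
    case (step y)
    obtain u c where y: "y = (u, c)" by fastforce
    with step.hyps obtain e where e: "passes C N c u e" "estep G u e v b" by (auto simp: state_rel_step)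
    from step.hyps(3)[OF y] show ?case using e mwalk.one mwalk.snoc by metis
  qed auto
next
  have "((s, False), (v, b)) \<in> (state_rel G (pass_cond C N))\<^sup>*" if "mwalk G C N s a v b" for a
    using that
  proof (induction rule: mwalk.induct)
    case (one v b)
    then have "((s, False), (v, b)) \<in> state_rel G (pass_cond C N)"
      using assms by (auto simp: state_rel_step passes_def)
    then show ?case by blast
  next
    case (snoc v b c w d)
    then have "((v, b), (w, d)) \<in> state_rel G (pass_cond C N)" by (auto simp: state_rel_step)
    with snoc.IH show ?case by (rule rtrancl_into_rtrancl)
  qed
  then show "(v = s \<and> \<not> b) \<or> (\<exists>a. mwalk G C N s a v b) \<Longrightarrow> ((s, False), (v, b)) \<in> (state_rel G (pass_cond C N))\<^sup>*"
    by auto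
qed

section \<open>The program\<close>

abbreviation (input) "aDE \<equiv> 10::nat"
abbreviation (input) "aCAUS \<equiv> 11::nat"
abbreviation (input) "aFORB \<equiv> 12::nat"
abbreviation (input) "aANC \<equiv> 13::nat"
abbreviation (input) "aWS \<equiv> 14::nat"
abbreviation (input) "aOUT \<equiv> 15::nat"

definition emit :: "exp \<Rightarrow> exp \<Rightarrow> exp \<Rightarrow> com" where
  "emit s d c = Upd aSRC (V rM) s ;; Upd aDST (V rM) d ;; Upd aCI (V rM) c ;; Assign rM (Pl (V rM) (K 1))"

abbreviation (input) "e2 x k \<equiv> Pl (dbl (V x)) (K k)"
abbreviation (input) "e8 x k \<equiv> Pl (dbl (dbl (dbl (V x)))) (K k)"

text \<open>Executed twice: while \<open>aCAUS\<close> is still zero it yields the arcs of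
  \<open>G\<close>, afterwards those of the graph without the causal edges at
  \<open>x\<close>.\<close>

definition build :: com where
  "build = Assign rM (K 0) ;;
     For rI rND (
       Assign rU (Ar aIN (e2 rI 2)) ;; Assign rW (Ar aIN (e2 rI 3)) ;;
       Cond (Ite (Mi (V rU) (V rX)) (K 0) (Ar aCAUS (V rW))) Skip (
         emit (e2 rU 0) (e2 rW 1) (e8 rU 0) ;; emit (e2 rU 1) (e2 rW 1) (e8 rU 1) ;;
         emit (e2 rW 0) (e2 rU 0) (e8 rW 2) ;; emit (e2 rW 1) (e2 rU 0) (e8 rW 3))) ;;
     For rI rNB (
       Assign rU (Ar aIN (Pl (dbl (V rND)) (e2 rI 2))) ;; Assign rW (Ar aIN (Pl (dbl (V rND)) (e2 rI 3))) ;;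
       emit (e2 rU 0) (e2 rW 1) (e8 rU 4) ;; emit (e2 rU 1) (e2 rW 1) (e8 rU 5) ;;
       emit (e2 rW 0) (e2 rU 1) (e8 rW 4) ;; emit (e2 rW 1) (e2 rU 1) (e8 rW 5))"

lemma wp_emit:
  assumes T: "arcs_rep r a T"
    and s: "\<And>b. safe L r b s \<and> ev r b s = int ns" and d: "\<And>b. safe L r b d \<and> ev r b d = int nd"
    and c: "\<And>b. safe L r b c \<and> ev r b c = int nc"
    and fin: "\<And>a'. arcs_rep (r(rM := r rM + 1)) a' (T @ [(ns, nd, nc)]) \<Longrightarrow> Q (r(rM := r rM + 1)) a' (t + 4)"
  shows "wp L (emit s d c) Q r a t"
proof -
  have rM: "r rM = int (length T)" using T by (simp add: arcs_rep_def)
  let ?n = "length T"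
  let ?a = "a(aSRC := (a aSRC)(?n := int ns), aDST := (a aDST)(?n := int nd), aCI := (a aCI)(?n := int nc))"
  have "arcs_rep (r(rM := r rM + 1)) ?a (T @ [(ns, nd, nc)])"
    using T by (auto simp: arcs_rep_def nth_append less_Suc_eq)
  from fin[OF this] show ?thesis unfolding emit_def using s d c rM by (simp add: idx_ok_def eval_nat_numeral)
qed

text \<open>\<open>in_rep\<close>: the input lists are stored from cell 2 of array 0 on, as pairs of consecutive cells.\<close>

definition in_rep :: "regs \<Rightarrow> arrs \<Rightarrow> (nat \<times> nat) list \<Rightarrow> (nat \<times> nat) list \<Rightarrow> bool" where
  "in_rep r a ds bs \<longleftrightarrow> r rND = int (length ds) \<and> r rNB = int (length bs) \<and>
     (\<forall>i<length ds. a aIN (2 * i + 2) = int (fst (ds ! i)) \<and> a aIN (2 * i + 3) = int (snd (ds ! i))) \<and>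
     (\<forall>i<length bs. a aIN (2 * length ds + (2 * i + 2)) = int (fst (bs ! i)) \<and>
        a aIN (2 * length ds + (2 * i + 3)) = int (snd (bs ! i)))"

lemma emit_frame [simp]: "assigned (emit s d c) = {rM}" "updated (emit s d c) = {aSRC, aDST, aCI}"
  by (auto simp: emit_def)

lemma wp_build:
  assumes inp: "in_rep r a ds bs" and x: "r rX = int x"
    and fin: "\<And>r' a' t' T. arcs_rep r' a' T \<Longrightarrow>
      T = concat (map dir_arcs (filter (\<lambda>(u, v). \<not> (u = x \<and> a aCAUS v \<noteq> 0)) ds)) @ concat (map bi_arcs bs) \<Longrightarrow>
      same {rM, rI, rU, rW} {aSRC, aDST, aCI} r a r' a' \<Longrightarrow>
      t' \<le> t + 30 * (length ds + length bs + 1) \<Longrightarrow> Q r' a' t'"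
  shows "wp L build Q r a t"
proof -
  define keep where "keep = (\<lambda>(u, v). \<not> (u = x \<and> a aCAUS v \<noteq> 0))"
  define DA where "DA j = concat (map dir_arcs (filter keep (take j ds)))" for j
  define BA where "BA j = concat (map bi_arcs (take j bs))" for j
  let ?Y = "{aSRC, aDST, aCI}"
  have ND: "r rND = int (length ds)" and NB: "r rNB = int (length bs)" using inp by (auto simp: in_rep_def)
  show ?thesis
    unfolding build_def wp_Seq wp_Assign safe.simps ev.simps simp_thms
  \<comment> \<open>Each round costs 21: loop test, two reads, the conditional, four times 4 for the
    emitted arcs, and the increment.\<close>
  proof (rule wp_For[where N = "length ds" and I = "\<lambda>j r' a' t'. arcs_rep r' a' (DA j) \<and> t' \<le> t + 2 + 21 * j"],
      goal_cases)
    case 1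
    show ?case by (simp add: DA_def arcs_rep_def)
  next
    case 2
    show ?case using ND by simp
  next
    case (6 j r' a' t')
    have fr: "a' aIN = a aIN" "a' aCAUS = a aCAUS" "r' rX = int x" using 6(5) x by (auto simp: frame_def)
    obtain u w where uw: "ds ! j = (u, w)" by fastforce
    then have IN: "a aIN (2 * j + 2) = int u" "a aIN (2 * j + 3) = int w" using inp 6(1) by (auto simp: in_rep_def)
    have idx: "nat (int j + int j + 2) = 2 * j + 2" "nat (int j + int j + 3) = 2 * j + 3" by simp_all
    have DA: "DA (Suc j) = DA j @ (if keep (u, w) then dir_arcs (u, w) else [])"
      using 6(1) uw by (simp add: DA_def take_Suc_conv_app_nth)
    let ?r = "r'(rU := int u, rW := int w)"
    have T: "arcs_rep ?r a' (DA j)" using 6(2) by (simp add: arcs_rep_def)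
    show ?case
    proof (cases "keep (u, w)")
      case False
      then have "u = x" "a aCAUS w \<noteq> 0" by (auto simp: keep_def)
      then show ?thesis using 6 fr IN idx DA False T by (auto simp: idx_ok_def arcs_rep_def)
    next
      case True
      then have c0: "u = x \<Longrightarrow> a aCAUS w = 0" by (auto simp: keep_def)
      have "wp L (emit (e2 rU 0) (e2 rW 1) (e8 rU 0) ;; emit (e2 rU 1) (e2 rW 1) (e8 rU 1) ;;
         emit (e2 rW 0) (e2 rU 0) (e8 rW 2) ;; emit (e2 rW 1) (e2 rU 0) (e8 rW 3))
         (\<lambda>r' a' t'. arcs_rep (r'(rI := int (Suc j))) a' (DA (Suc j)) \<and> Suc t' \<le> t + 2 + 21 * Suc j)
         ?r a' (Suc (Suc (Suc (Suc t'))))"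
        unfolding wp_Seq
        apply (rule wp_emit[OF T, where ns = "2 * u" and nd = "2 * w + 1" and nc = "8 * u"], simp, simp, simp)
        apply (erule wp_emit[where ns = "2 * u + 1" and nd = "2 * w + 1" and nc = "8 * u + 1"], simp, simp, simp)
        apply (erule wp_emit[where ns = "2 * w" and nd = "2 * u" and nc = "8 * w + 2"], simp, simp, simp)
        apply (erule wp_emit[where ns = "2 * w + 1" and nd = "2 * u" and nc = "8 * w + 3"], simp, simp, simp)
        using DA True 6(2) by (simp add: arcs_rep_def)
      then show ?thesis using 6 fr IN idx c0 by (auto simp: idx_ok_def)
    qed
  next
    case (7 r1 a1 t1)
    have fr1: "a1 aIN = a aIN" "r1 rX = int x" "r1 rND = int (length ds)" "r1 rNB = int (length bs)"
      using 7(3) x ND NB by (auto simp: frame_def)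
    show ?case
    proof (rule wp_For[where N = "length bs" and I = "\<lambda>j r' a' t'. arcs_rep r' a' (DA (length ds) @ BA j) \<and> t' \<le> t1 + 2 + 21 * j"],
      goal_cases)
      case 1
      show ?case using 7(1) by (simp add: BA_def arcs_rep_def)
    next
      case 2
      show ?case using fr1 by simp
    next
      case (6 j r' a' t')
      have fr: "a' aIN = a aIN" "r' rND = int (length ds)" using 6(5) fr1 by (auto simp: frame_def)
      obtain u w where uw: "bs ! j = (u, w)" by fastforce
      then have IN: "a aIN (2 * length ds + (2 * j + 2)) = int u" "a aIN (2 * length ds + (2 * j + 3)) = int w"
        using inp 6(1) by (auto simp: in_rep_def)
      have idx: "nat (int (length ds) + int (length ds) + (int j + int j + 2)) = 2 * length ds + (2 * j + 2)"
        "nat (int (length ds) + int (length ds) + (int j + int j + 3)) = 2 * length ds + (2 * j + 3)" by simp_all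
      have BA: "BA (Suc j) = BA j @ bi_arcs (u, w)"
        using 6(1) uw by (simp add: BA_def take_Suc_conv_app_nth)
      let ?r = "r'(rU := int u, rW := int w)"
      have T: "arcs_rep ?r a' (DA (length ds) @ BA j)" using 6(2) by (simp add: arcs_rep_def)
      have "wp L (emit (e2 rU 0) (e2 rW 1) (e8 rU 4) ;; emit (e2 rU 1) (e2 rW 1) (e8 rU 5) ;;
         emit (e2 rW 0) (e2 rU 1) (e8 rW 4) ;; emit (e2 rW 1) (e2 rU 1) (e8 rW 5))
         (\<lambda>r' a' t'. arcs_rep (r'(rI := int (Suc j))) a' (DA (length ds) @ BA (Suc j)) \<and> Suc t' \<le> t1 + 2 + 21 * Suc j)
         ?r a' (Suc (Suc (Suc t')))"
        unfolding wp_Seq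
        apply (rule wp_emit[OF T, where ns = "2 * u" and nd = "2 * w + 1" and nc = "8 * u + 4"], simp, simp, simp)
        apply (erule wp_emit[where ns = "2 * u + 1" and nd = "2 * w + 1" and nc = "8 * u + 5"], simp, simp, simp)
        apply (erule wp_emit[where ns = "2 * w" and nd = "2 * u + 1" and nc = "8 * w + 4"], simp, simp, simp)
        apply (erule wp_emit[where ns = "2 * w + 1" and nd = "2 * u + 1" and nc = "8 * w + 5"], simp, simp, simp)
        using BA 6(2) by (simp add: arcs_rep_def)
      then show ?case using 6 fr IN idx by (auto simp: idx_ok_def)
    next
      case (7 r2 a2 t2)
      note 1 = \<open>arcs_rep r1 a1 _ \<and> _\<close> \<open>frame _ (r(rM := 0)) a r1 a1\<close>
      show ?case
      proof (rule fin)
        show "arcs_rep r2 a2 (DA (length ds) @ BA (length bs))" using 7(1) by simp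
        show "same {rM, rI, rU, rW} {aSRC, aDST, aCI} r a r2 a2"
          using 1(2) 7(3) by (auto simp: frame_def same_def)
        show "Suc t2 \<le> t + 30 * (length ds + length bs + 1)" using 1(1) 7(1) by auto
      qed (simp add: DA_def BA_def keep_def)
    qed auto
  qed auto
qed

definition eqE :: "exp \<Rightarrow> exp \<Rightarrow> exp" where
  "eqE e f = Ite (Mi e f) (K 0) (K 1)"

lemma eqE_simps [simp]:
  "safe L r a (eqE e f) \<longleftrightarrow> safe L r a e \<and> safe L r a f"
  "ev r a (eqE e f) \<noteq> 0 \<longleftrightarrow> ev r a e = ev r a f"
  "ev r a (eqE e f) = 0 \<longleftrightarrow> ev r a e \<noteq> ev r a f"
  "wf_exp (eqE e f) d \<longleftrightarrow> wf_exp e d \<and> wf_exp f (Suc d)"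
  by (auto simp: eqE_def dest: wf_exp_less)

definition desc_query :: "exp \<Rightarrow> com" where
  "desc_query i = query (\<lambda>c. if c = 1 then K 1 else K 0) (\<lambda>b. if b then i else K 0)"

definition anc_query :: "exp \<Rightarrow> com" where
  "anc_query i = query (\<lambda>c. if c = 2 then K 1 else K 0) (\<lambda>b. if b then K 0 else i)"

definition walk_query :: "exp \<Rightarrow> exp \<Rightarrow> exp \<Rightarrow> com" where
  "walk_query c n i = query (\<lambda>k. if k = 3 \<or> k = 5 then c else n) (\<lambda>b. if b then K 0 else i)"

abbreviation (input) "query_regs \<equiv> {rI, rSP, rE, rW}"
abbreviation (input) "query_arrs \<equiv> {aCOND, aINIT, aHEAD, aMARK, aSTK, aNEXT}"

abbreviation (input) "mark0 \<equiv> Ar aMARK (e2 rI 0)"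
abbreviation (input) "mark1 \<equiv> Ar aMARK (e2 rI 1)"

text \<open>\<open>m\<close> remains the edge number of the input graph, so the inequality covers
  the reduced graph and all queries share one time bound.\<close>

definition net_rep :: "nat \<Rightarrow> nat \<Rightarrow> nat admg \<Rightarrow> arc list \<Rightarrow> regs \<Rightarrow> arrs \<Rightarrow> bool" where
  "net_rep p m G T r a \<longleftrightarrow> r rP = int p \<and> r rN = int (2 * p) \<and> arcs_rep r a T \<and> arcs_of G T \<and>
     length T \<le> 4 * m \<and> dir G \<subseteq> {..<p} \<times> {..<p} \<and> bi G \<subseteq> {..<p} \<times> {..<p}"

lemma net_rep_same:
  assumes "net_rep p m G T r a" "same X Y r a r' a'" "X \<inter> {rP, rN, rM} = {}" "Y \<inter> {aSRC, aDST, aCI} = {}"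
  shows "net_rep p m G T r' a'"
proof -
  have "r' rP = r rP" "r' rN = r rN" "r' rM = r rM" "a' aSRC = a aSRC" "a' aDST = a aDST" "a' aCI = a aCI"
    using assms(2-) unfolding same_def by blast+
  with assms(1) show ?thesis by (simp add: net_rep_def arcs_rep_def)
qed

lemma wp_desc_query:
  assumes net: "net_rep p m G T r a" and S: "S \<subseteq> {..<p}"
    and i: "\<And>v r' a'. v < p \<Longrightarrow> same {rI} {aCOND, aINIT} r a r' a' \<Longrightarrow> r' rI = int v \<Longrightarrow>
      safe L r' a' i \<and> (ev r' a' i \<noteq> 0 \<longleftrightarrow> v \<in> S)"
    and fin: "\<And>r' a' t'. \<forall>v<p. a' aMARK (2 * v + 1) \<noteq> 0 \<longleftrightarrow> (\<exists>u\<in>S. (u, v) \<in> (dir G)\<^sup>*) \<Longrightarrow>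
      same query_regs query_arrs r a r' a' \<Longrightarrow> t' \<le> t + 400 * (p + m + 1) \<Longrightarrow> Q r' a' t'"
  shows "wp L (desc_query i) Q r a t"
  unfolding desc_query_def
proof (rule wp_query[where p = p and G = G and T = T and g = "\<lambda>c v. c = 1" and h = "\<lambda>b v. b \<and> v \<in> S"], goal_cases)
  case (9 r' a' t')
  have *: "(\<exists>u<p. \<exists>b'. (b' \<and> u \<in> S) \<and> P u b') \<longleftrightarrow> (\<exists>u\<in>S. P u True)" for P :: "nat \<Rightarrow> bool \<Rightarrow> bool"
    using S by auto
  have "\<forall>v<p. a' aMARK (2 * v + 1) \<noteq> 0 \<longleftrightarrow> (\<exists>u\<in>S. (u, v) \<in> (dir G)\<^sup>*)"
  proof (intro allI impI)
    fix v assume "v < p"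
    then have "a' aMARK (2 * v + of_bool True) \<noteq> 0 \<longleftrightarrow>
       (\<exists>u<p. \<exists>b'. (b' \<and> u \<in> S) \<and> ((u, b'), (v, True)) \<in> (state_rel G (\<lambda>c v. c = 1))\<^sup>*)"
      using 9(1) by blast
    also have "\<dots> \<longleftrightarrow> (\<exists>u\<in>S. ((u, True), (v, True)) \<in> (state_rel G (\<lambda>c v. c = 1))\<^sup>*)"
      by (rule *)
    finally show "a' aMARK (2 * v + 1) \<noteq> 0 \<longleftrightarrow> (\<exists>u\<in>S. (u, v) \<in> (dir G)\<^sup>*)"
      unfolding state_rel_desc by simp
  qed
  moreover have "t' \<le> t + 400 * (p + m + 1)" using 9(3) net by (simp add: net_rep_def)
  ultimately show ?case using 9(2) by (intro fin)
next
  case (7 v c r' a')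
  then show ?case by simp
next
  case (8 v c r' a')
  then show ?case using i[OF 8(1,2,3)] by (cases c) simp_all
qed (use net in \<open>simp_all add: net_rep_def\<close>)

lemma wp_anc_query:
  assumes net: "net_rep p m G T r a" and S: "S \<subseteq> {..<p}"
    and i: "\<And>v r' a'. v < p \<Longrightarrow> same {rI} {aCOND, aINIT} r a r' a' \<Longrightarrow> r' rI = int v \<Longrightarrow>
      safe L r' a' i \<and> (ev r' a' i \<noteq> 0 \<longleftrightarrow> v \<in> S)"
    and fin: "\<And>r' a' t'. \<forall>v<p. a' aMARK (2 * v) \<noteq> 0 \<longleftrightarrow> (\<exists>u\<in>S. (v, u) \<in> (dir G)\<^sup>*) \<Longrightarrow>
      same query_regs query_arrs r a r' a' \<Longrightarrow> t' \<le> t + 400 * (p + m + 1) \<Longrightarrow> Q r' a' t'"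
  shows "wp L (anc_query i) Q r a t"
  unfolding anc_query_def
proof (rule wp_query[where p = p and G = G and T = T and g = "\<lambda>c v. c = 2" and h = "\<lambda>b v. \<not> b \<and> v \<in> S"], goal_cases)
  case (9 r' a' t')
  have *: "(\<exists>u<p. \<exists>b'. (\<not> b' \<and> u \<in> S) \<and> P u b') \<longleftrightarrow> (\<exists>u\<in>S. P u False)" for P :: "nat \<Rightarrow> bool \<Rightarrow> bool"
    using S by auto
  have "\<forall>v<p. a' aMARK (2 * v) \<noteq> 0 \<longleftrightarrow> (\<exists>u\<in>S. (v, u) \<in> (dir G)\<^sup>*)"
  proof (intro allI impI)
    fix v assume "v < p"
    then have "a' aMARK (2 * v + of_bool False) \<noteq> 0 \<longleftrightarrow>
       (\<exists>u<p. \<exists>b'. (\<not> b' \<and> u \<in> S) \<and> ((u, b'), (v, False)) \<in> (state_rel G (\<lambda>c v. c = 2))\<^sup>*)"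
      using 9(1) by blast
    also have "\<dots> \<longleftrightarrow> (\<exists>u\<in>S. ((u, False), (v, False)) \<in> (state_rel G (\<lambda>c v. c = 2))\<^sup>*)"
      by (rule *)
    finally show "a' aMARK (2 * v) \<noteq> 0 \<longleftrightarrow> (\<exists>u\<in>S. (v, u) \<in> (dir G)\<^sup>*)"
      unfolding state_rel_anc by simp
  qed
  moreover have "t' \<le> t + 400 * (p + m + 1)" using 9(3) net by (simp add: net_rep_def)
  ultimately show ?case using 9(2) by (intro fin)
next
  case (7 v c r' a')
  then show ?case by simp
next
  case (8 v c r' a')
  then show ?case using i[OF 8(1,2,3)] by (cases c) simp_all
qed (use net in \<open>simp_all add: net_rep_def\<close>)

lemma wp_walk_query:
  assumes net: "net_rep p m G T r a" and s: "s < p" "s \<in> N"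
    and c: "\<And>v r' a'. v < p \<Longrightarrow> same {rI} {aCOND, aINIT} r a r' a' \<Longrightarrow> r' rI = int v \<Longrightarrow>
      safe L r' a' c \<and> (ev r' a' c \<noteq> 0 \<longleftrightarrow> v \<in> C)"
    and n: "\<And>v r' a'. v < p \<Longrightarrow> same {rI} {aCOND, aINIT} r a r' a' \<Longrightarrow> r' rI = int v \<Longrightarrow>
      safe L r' a' n \<and> (ev r' a' n \<noteq> 0 \<longleftrightarrow> v \<in> N)"
    and i: "\<And>v r' a'. v < p \<Longrightarrow> same {rI} {aCOND, aINIT} r a r' a' \<Longrightarrow> r' rI = int v \<Longrightarrow>
      safe L r' a' i \<and> (ev r' a' i \<noteq> 0 \<longleftrightarrow> v = s)"
    and fin: "\<And>r' a' t'. \<forall>v<p. a' aMARK (2 * v) \<noteq> 0 \<or> a' aMARK (2 * v + 1) \<noteq> 0 \<longleftrightarrow>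
        v = s \<or> (\<exists>a b. mwalk G C N s a v b) \<Longrightarrow>
      same query_regs query_arrs r a r' a' \<Longrightarrow> t' \<le> t + 400 * (p + m + 1) \<Longrightarrow> Q r' a' t'"
  shows "wp L (walk_query c n i) Q r a t"
  unfolding walk_query_def
proof (rule wp_query[where p = p and G = G and T = T and g = "pass_cond C N" and h = "\<lambda>b v. \<not> b \<and> v = s"], goal_cases)
  case (9 r' a' t')
  have *: "(\<exists>u<p. \<exists>b'. (\<not> b' \<and> u = s) \<and> P u b') \<longleftrightarrow> P s False" for P :: "nat \<Rightarrow> bool \<Rightarrow> bool"
    using s(1) by auto
  have "\<forall>v<p. a' aMARK (2 * v) \<noteq> 0 \<or> a' aMARK (2 * v + 1) \<noteq> 0 \<longleftrightarrow> v = s \<or> (\<exists>a b. mwalk G C N s a v b)"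
  proof (intro allI impI)
    fix v assume v: "v < p"
    have "a' aMARK (2 * v + of_bool b) \<noteq> 0 \<longleftrightarrow> (v = s \<and> \<not> b) \<or> (\<exists>a. mwalk G C N s a v b)" for b
      unfolding 9(1)[rule_format, OF v] * by (rule state_rel_walk[OF s(2)])
    from this[of False] this[of True]
    show "a' aMARK (2 * v) \<noteq> 0 \<or> a' aMARK (2 * v + 1) \<noteq> 0 \<longleftrightarrow> v = s \<or> (\<exists>a b. mwalk G C N s a v b)"
      by (auto simp: ex_bool_eq)
  qed
  moreover have "t' \<le> t + 400 * (p + m + 1)" using 9(3) net by (simp add: net_rep_def)
  ultimately show ?case using 9(2) by (intro fin)
next
  case (7 v k r' a')
  then show ?case using c[OF 7(1,3,4)] n[OF 7(1,3,4)] by (simp add: pass_cond_def)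
next
  case (8 v k r' a')
  then show ?case using i[OF 8(1,2,3)] by (cases k) simp_all
qed (use net in \<open>simp_all add: net_rep_def\<close>)

definition try_anc :: com where
  "try_anc = anc_query (Ite (Mi (V rI) (V rY)) (eqE (V rI) (V rZ)) (K 1)) ;; mapv aANC mark0"

text \<open>The two nested tests describe \<open>A - R\<close> through forbidden nodes and
  \<open>y\<close>. The start \<open>y\<close> qualifies, being in \<open>A\<close> and outside
  \<open>R\<close>.\<close>

definition try_sep :: com where
  "try_sep =
     walk_query (Ar aANC (V rI)) (Ite (Ar aANC (V rI)) (Ite (Ar aFORB (V rI)) (K 1) (eqE (V rI) (V rY))) (K 0))
       (eqE (V rI) (V rY)) ;;
     mapv aWS (Ite (Ar aANC (V rI)) (Ite (Ar aFORB (V rI)) (K 0) (Ite (Mi (V rI) (V rY))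
       (Ite mark0 (K 1) mark1) (K 0))) (K 0))"

text \<open>If \<open>z\<close> is in its own separator it fails as an instrument. Otherwise it is
  an admissible non-collider, as the start of a walk search has to be.\<close>

definition try_conn :: com where
  "try_conn = Cond (Ar aWS (V rZ)) Skip (
     walk_query (Ar aWS (V rI)) (Ite (Ar aWS (V rI)) (K 0) (K 1)) (eqE (V rI) (V rZ)) ;;
     Cond (Ite (Ar aMARK (e2 rX 0)) (K 1) (Ar aMARK (e2 rX 1))) (Assign rF (K 1)) Skip)"

definition try_node :: com where
  "try_node = Cond (Ar aFORB (V rZ)) Skip (Cond (eqE (V rZ) (V rY)) Skip (try_anc ;; try_sep ;; try_conn))"

lemma nat_e2: "nat (int v + int v) = 2 * v" "nat (int v + int v + 1) = Suc (2 * v)"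
  "nat (2 * int v) = 2 * v" "nat (2 * int v + 1) = Suc (2 * v)"
  by simp_all

lemma mapv_same: "same {rI} {k} r a (r(rI := i)) (a(k := A))"
  by (simp add: same_def)

lemma wp_try_anc:
  assumes net: "net_rep p m H T r a" and r: "r rY = int y" "r rZ = int z" and yz: "y < p" "z < p"
    and fin: "\<And>r' a' t'. \<forall>v<p. a' aANC v \<noteq> 0 \<longleftrightarrow> v \<in> an H y \<union> an H z \<Longrightarrow>
      same query_regs (insert aANC query_arrs) r a r' a' \<Longrightarrow> t' \<le> t + 410 * (p + m + 1) \<Longrightarrow> Q r' a' t'"
  shows "wp L try_anc Q r a t"
  unfolding try_anc_def wp_Seq
proof (rule wp_anc_query[OF net, where S = "{y, z}"], goal_cases)
  case 1
  then show ?case using yz by simp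
next
  case (2 v r' a')
  then have "r' rY = int y" "r' rZ = int z" using r by (auto simp: same_def)
  with 2(3) show ?case by auto
next
  case (3 r1 a1 t1)
  show ?case
  proof (rule wp_mapv[where p = p and g = "\<lambda>v. a1 aMARK (2 * v)"], goal_cases)
    case 1
    then show ?case using 3(2) net by (simp add: same_def net_rep_def)
  next
    case (3 v b)
    then show ?case by (simp add: idx_ok_def nat_e2)
  next
    case 4
    show ?case using 3(1,3) same_trans[OF 3(2) mapv_same]
      by (intro fin) (auto simp: an_def)
  qed simp
qed

lemma wp_try_sep:
  assumes net: "net_rep p m H T r a" and y: "r rY = int y" "y < p" "y \<in> A"
    and A: "\<forall>v<p. a aANC v \<noteq> 0 \<longleftrightarrow> v \<in> A"
    and R: "\<forall>v<p. v \<in> R \<longleftrightarrow> a aFORB v = 0 \<and> v \<noteq> y" 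
    and fin: "\<And>r' a' t'. \<forall>v<p. a' aWS v \<noteq> 0 \<longleftrightarrow> v \<in> A \<inter> R \<and> (\<exists>a b. mwalk H A (A - R) y a v b) \<Longrightarrow>
      same query_regs (insert aWS query_arrs) r a r' a' \<Longrightarrow> t' \<le> t + 410 * (p + m + 1) \<Longrightarrow> Q r' a' t'"
  shows "wp L try_sep Q r a t"
  unfolding try_sep_def wp_Seq
proof (rule wp_walk_query[OF net, where s = y and C = A and N = "A - R"], goal_cases)
  case 1
  then show ?case using y by simp
next
  case 2
  then show ?case using y R by simp
next
  case (3 v r' a')
  then have "a' aANC = a aANC" by (auto simp: same_def)
  with 3 A show ?case by (auto simp: idx_ok_def)
next
  case (4 v r' a')
  then have "a' aANC = a aANC" "a' aFORB = a aFORB" "r' rY = int y" using y by (auto simp: same_def)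
  with 4 A R show ?case by (auto simp: idx_ok_def)
next
  case (5 v r' a')
  then have "r' rY = int y" using y by (auto simp: same_def)
  with 5 show ?case by auto
next
  case (6 r1 a1 t1)
  have same: "r1 rP = int p" "r1 rY = int y" "a1 aANC = a aANC" "a1 aFORB = a aFORB"
    using 6(2) net y by (auto simp: same_def net_rep_def)
  let ?g = "\<lambda>v. if a aANC v \<noteq> 0 then if a aFORB v \<noteq> 0 then 0 else if v \<noteq> y then
     if a1 aMARK (2 * v) \<noteq> 0 then 1 else a1 aMARK (Suc (2 * v)) else 0 else 0"
  show ?case
  proof (rule wp_mapv[where p = p and g = ?g], goal_cases)
    case (3 v b)
    then have "b aANC = a aANC" "b aFORB = a aFORB" "b aMARK = a1 aMARK" using same by auto
    then show ?case using same by (simp add: idx_ok_def nat_e2)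
  next
    case 4
    \<comment> \<open>The search also marks its start \<open>y\<close>; this is filtered out because
      \<open>y\<close> is not in \<open>R\<close>.\<close>
    have "?g v \<noteq> 0 \<longleftrightarrow> v \<in> A \<inter> R \<and> (\<exists>a b. mwalk H A (A - R) y a v b)" if "v < p" for v
      using 6(1) A R that by auto
    then show ?case using 6(3) same_trans[OF 6(2) mapv_same] by (intro fin) auto
  qed (use same in simp_all)
qed

lemma wp_try_conn:
  assumes net: "net_rep p m H T r a" and r: "r rX = int x" "r rZ = int z" "r rF = 0"
    and xz: "x < p" "z < p" "x \<noteq> z"
    and W: "\<forall>v<p. a aWS v \<noteq> 0 \<longleftrightarrow> v \<in> W"
    and fin: "\<And>r' a' t'. r' rF \<noteq> 0 \<longleftrightarrow> z \<notin> W \<and> conn H W z x \<Longrightarrow>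
      same (insert rF query_regs) query_arrs r a r' a' \<Longrightarrow> t' \<le> t + 410 * (p + m + 1) \<Longrightarrow> Q r' a' t'"
  shows "wp L try_conn Q r a t"
proof (cases "z \<in> W")
  case True
  then show ?thesis using W xz r unfolding try_conn_def by (auto simp: idx_ok_def intro!: fin)
next
  case False
  have "wp L (walk_query (Ar aWS (V rI)) (Ite (Ar aWS (V rI)) (K 0) (K 1)) (eqE (V rI) (V rZ)))
     (wp L (Cond (Ite (Ar aMARK (e2 rX 0)) (K 1) (Ar aMARK (e2 rX 1))) (Assign rF (K 1)) Skip) Q) r a (Suc t)"
  proof (rule wp_walk_query[OF net, where s = z and C = W and N = "- W"], goal_cases)
    case (3 v r' a')
    then have "a' aWS = a aWS" by (auto simp: same_def)
    with 3 W show ?case by (auto simp: idx_ok_def)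
  next
    case (4 v r' a')
    then have "a' aWS = a aWS" by (auto simp: same_def)
    with 4 W show ?case by (auto simp: idx_ok_def)
  next
    case (5 v r' a')
    then have "r' rZ = int z" using r by (auto simp: same_def)
    with 5 show ?case by auto
  next
    case (6 r1 a1 t1)
    have r1: "r1 rX = int x" "r1 rF = 0" using 6(2) r by (auto simp: same_def)
    \<comment> \<open>The trivial alternative of the search is excluded by \<open>x\<close> and
      \<open>z\<close> being distinct.\<close>
    have F: "a1 aMARK (2 * x) \<noteq> 0 \<or> a1 aMARK (2 * x + 1) \<noteq> 0 \<longleftrightarrow> conn H W z x"
      using 6(1) xz by (auto simp: conn_def)
    have same: "same (insert rF query_regs) query_arrs r a r1 a1"
      "same (insert rF query_regs) query_arrs r a (r1(rF := 1)) a1"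
      using 6(2) by (auto simp: same_def)
    show ?case
    proof (cases "conn H W z x")
      case True
      with F have "a1 aMARK (2 * x) \<noteq> 0 \<or> a1 aMARK (Suc (2 * x)) \<noteq> 0" by simp
      then show ?thesis using r1 6(3) same(2) False True by (auto simp: idx_ok_def nat_e2 intro!: fin)
    next
      case nc: False
      with F have "a1 aMARK (2 * x) = 0" "a1 aMARK (Suc (2 * x)) = 0" by simp_all
      then show ?thesis using r1 6(3) same(1) nc by (auto simp: idx_ok_def nat_e2 intro!: fin)
    qed
  qed (use xz False in auto)
  then show ?thesis using False W xz r unfolding try_conn_def by (simp add: idx_ok_def)
qed

lemma wp_try_node:
  assumes net: "net_rep p m (tilde G x y) T r a"
    and forb: "\<forall>v<p. a aFORB v \<noteq> 0 \<longleftrightarrow> v \<in> forb G x y"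
    and r: "r rX = int x" "r rY = int y" "r rZ = int z" "r rF = 0" and xyz: "x < p" "y < p" "z < p"
    and nodes: "nodes G = {..<p}"
    and fin: "\<And>r' a' t'. r' rF \<noteq> 0 \<longleftrightarrow> good_instr G x y z \<Longrightarrow>
      (r' rF \<noteq> 0 \<Longrightarrow> \<forall>v<p. a' aWS v \<noteq> 0 \<longleftrightarrow> v \<in> instr_sep G x y z) \<Longrightarrow>
      same (insert rF query_regs) ({aANC, aWS} \<union> query_arrs) r a r' a' \<Longrightarrow>
      t' \<le> t + 1300 * (p + m + 1) \<Longrightarrow> Q r' a' t'"
  shows "wp L try_node Q r a t"
proof -
  define H where "H = tilde G x y"
  define R where "R = allowed G x y"
  define A where "A = an H y \<union> an H z"
  define Ws where "Ws = instr_sep G x y z"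
  let ?X = "insert rF query_regs" and ?Y = "{aANC, aWS} \<union> query_arrs"
  have Ws: "v \<in> Ws \<longleftrightarrow> v \<in> A \<inter> R \<and> (\<exists>a b. mwalk H A (A - R) y a v b)" for v
    by (simp add: Ws_def canon_sep_def A_def R_def H_def Let_def)
  have good: "good_instr G x y z \<longleftrightarrow> z \<in> R \<and> z \<notin> Ws \<and> conn H Ws z x"
    by (simp add: good_instr_def H_def R_def Ws_def)
  have R: "\<forall>v<p. v \<in> R \<longleftrightarrow> a aFORB v = 0 \<and> v \<noteq> y"
    using forb nodes by (auto simp: R_def allowed_def)
  show ?thesis
  proof (cases "z \<in> R")
    case False
    then have "a aFORB z \<noteq> 0 \<or> z = y" using R xyz by blast
    with False show ?thesis using r good by (auto simp: try_node_def idx_ok_def intro!: fin)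
  next
    case True
    then have zR: "a aFORB z = 0" "z \<noteq> y" using R xyz(3) by auto
    have zx: "x \<noteq> z" using True by (auto simp: R_def allowed_def forb_def)
    have net: "net_rep p m H T r a" using net by (simp add: H_def)
    have "wp L (try_anc ;; try_sep ;; try_conn) Q r a (Suc (Suc t))"
      unfolding wp_Seq
    proof (rule wp_try_anc[OF net r(2,3) xyz(2,3)], goal_cases)
      case (1 r1 a1 t1)
      have s1: "same ?X ?Y r a r1 a1" by (rule same_mono[OF 1(2)]) auto
      have net1: "net_rep p m H T r1 a1" by (rule net_rep_same[OF net s1]) auto
      have y1: "r1 rY = int y" "a1 aFORB = a aFORB" using s1 r by (auto simp: same_def)
      show ?case
      proof (rule wp_try_sep[where y = y and A = A and R = R, OF net1], goal_cases)
        case (6 r2 a2 t2)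
        have s2: "same ?X ?Y r a r2 a2" by (rule same_trans[OF s1 6(2)]) auto
        have net2: "net_rep p m H T r2 a2" by (rule net_rep_same[OF net s2]) auto
        have "r2 rX = int x" "r2 rZ = int z" "r2 rF = 0" using 1(2) 6(2) r by (auto simp: same_def)
        moreover have W2: "\<forall>v<p. a2 aWS v \<noteq> 0 \<longleftrightarrow> v \<in> Ws" using 6(1) Ws by blast
        ultimately show ?case
        proof (rule wp_try_conn[OF net2 _ _ _ xyz(1,3) zx, where W = Ws], goal_cases)
          case (1 r3 a3 t3)
          have "same ?X ?Y r a r3 a3" by (rule same_trans[OF s2 1(2)]) auto
          moreover have "a3 aWS = a2 aWS" using 1(2) by (auto simp: same_def)
          ultimately show ?case
            using 1(1,3) 6(3) \<open>t1 \<le> _\<close> good True W2 by (intro fin) (auto simp: Ws_def)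
        qed
      qed (use y1 xyz R 1(1) in \<open>auto simp: A_def an_def\<close>)
    qed
    then show ?thesis using r zR by (simp add: try_node_def idx_ok_def)
  qed
qed

definition find_causal :: com where
  "find_causal = desc_query (eqE (V rI) (V rX)) ;; mapv aDE mark1 ;; anc_query (eqE (V rI) (V rY)) ;;
     mapv aCAUS (Ite (Mi (V rI) (V rX)) (Ite (Ar aDE (V rI)) mark0 (K 0)) (K 0))"

definition find_forb :: com where
  "find_forb = desc_query (Ar aCAUS (V rI)) ;; mapv aFORB (Ite (Mi (V rI) (V rX)) mark1 (K 1))"

definition prepare :: com where
  "prepare = Assign rN (dbl (V rP)) ;; build ;; find_causal ;; find_forb ;; build"

lemma causal_iff: "v \<in> causal G x y \<longleftrightarrow> v \<noteq> x \<and> (x, v) \<in> (dir G)\<^sup>* \<and> (v, y) \<in> (dir G)\<^sup>*"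
  by (auto simp: causal_def de_def an_def)

lemma forb_iff: "v \<in> forb G x y \<longleftrightarrow> v = x \<or> (\<exists>u\<in>causal G x y. (u, v) \<in> (dir G)\<^sup>*)"
  by (auto simp: forb_def de_set_def de_def)

lemma wp_find_causal:
  assumes net: "net_rep p m G T r a" and r: "r rX = int x" "r rY = int y" and xy: "x < p" "y < p"
    and fin: "\<And>r' a' t'. \<forall>v<p. a' aCAUS v \<noteq> 0 \<longleftrightarrow> v \<in> causal G x y \<Longrightarrow>
      same query_regs ({aDE, aCAUS} \<union> query_arrs) r a r' a' \<Longrightarrow> t' \<le> t + 820 * (p + m + 1) \<Longrightarrow> Q r' a' t'"
  shows "wp L find_causal Q r a t"
  unfolding find_causal_def wp_Seq
proof (rule wp_desc_query[OF net, where S = "{x}"], goal_cases)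
  case 1
  then show ?case using xy by simp
next
  case (2 v r' a')
  then have "r' rX = int x" using r by (auto simp: same_def)
  with 2(3) show ?case by auto
next
  case (3 r1 a1 t1)
  note d = 3
  show ?case
  proof (rule wp_mapv[where p = p and g = "\<lambda>v. a1 aMARK (2 * v + 1)"], goal_cases)
    case 1
    then show ?case using d(2) net by (simp add: same_def net_rep_def)
  next
    case (3 v b)
    then show ?case by (simp add: idx_ok_def nat_e2)
  next
    case 4
    let ?r2 = "r1(rI := int p)" and ?a2 = "a1(aDE := (\<lambda>v. if v < p then a1 aMARK (2 * v + 1) else a1 aDE v))"
    have s2: "same query_regs (insert aDE query_arrs) r a ?r2 ?a2"
      by (rule same_trans[OF d(2) mapv_same]) auto
    have DE: "\<forall>v<p. ?a2 aDE v \<noteq> 0 \<longleftrightarrow> (x, v) \<in> (dir G)\<^sup>*" using d(1) by simp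
    have net2: "net_rep p m G T ?r2 ?a2" by (rule net_rep_same[OF net s2]) auto
    show ?case
    proof (rule wp_anc_query[OF net2, where S = "{y}"], goal_cases)
      case 1
      then show ?case using xy by simp
    next
      case (2 v r' a')
      then have "r' rY = int y" using r s2 by (auto simp: same_def)
      with 2(3) show ?case by auto
    next
      case (3 r3 a3 t3)
      have s3: "same query_regs (insert aDE query_arrs) r a r3 a3" by (rule same_trans[OF s2 3(2)]) auto
      have r3: "r3 rP = int p" "r3 rX = int x" using s3 net r by (auto simp: same_def net_rep_def)
      have DE3: "\<forall>v<p. a3 aDE v \<noteq> 0 \<longleftrightarrow> (x, v) \<in> (dir G)\<^sup>*" using DE 3(2) by (simp add: same_def)
      let ?g = "\<lambda>v. if v \<noteq> x then if a3 aDE v \<noteq> 0 then a3 aMARK (2 * v) else 0 else 0"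
      show ?case
      proof (rule wp_mapv[where p = p and g = ?g], goal_cases)
        case 1
        then show ?case using r3 by simp
      next
        case (3 v b)
        then have "b aDE = a3 aDE" "b aMARK = a3 aMARK" by auto
        then show ?case using r3 by (simp add: idx_ok_def nat_e2)
      next
        case 4
        have "\<forall>v<p. ?g v \<noteq> 0 \<longleftrightarrow> v \<in> causal G x y" using DE3 3(1) by (auto simp: causal_iff)
        then show ?case
          using 3(3) d(3) same_trans[OF s3 mapv_same] by (intro fin) auto
      qed simp
    qed
  qed simp
qed

lemma wp_find_forb:
  assumes net: "net_rep p m G T r a" and r: "r rX = int x" "x < p"
    and caus: "\<forall>v<p. a aCAUS v \<noteq> 0 \<longleftrightarrow> v \<in> causal G x y" "causal G x y \<subseteq> {..<p}"
    and fin: "\<And>r' a' t'. \<forall>v<p. a' aFORB v \<noteq> 0 \<longleftrightarrow> v \<in> forb G x y \<Longrightarrow>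
      same query_regs (insert aFORB query_arrs) r a r' a' \<Longrightarrow> t' \<le> t + 410 * (p + m + 1) \<Longrightarrow> Q r' a' t'"
  shows "wp L find_forb Q r a t"
  unfolding find_forb_def wp_Seq
proof (rule wp_desc_query[OF net caus(2)], goal_cases)
  case (1 v r' a')
  then have "a' aCAUS = a aCAUS" by (auto simp: same_def)
  with 1 caus(1) show ?case by (auto simp: idx_ok_def)
next
  case (2 r1 a1 t1)
  have r1: "r1 rP = int p" "r1 rX = int x" using 2(2) net r by (auto simp: same_def net_rep_def)
  let ?g = "\<lambda>v. if v \<noteq> x then a1 aMARK (2 * v + 1) else 1"
  show ?case
  proof (rule wp_mapv[where p = p and g = ?g], goal_cases)
    case (3 v b)
    then show ?case using r1 by (simp add: idx_ok_def nat_e2)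
  next
    case 4
    have "\<forall>v<p. ?g v \<noteq> 0 \<longleftrightarrow> v \<in> forb G x y" using 2(1) by (auto simp: forb_iff)
    then show ?case using 2(3) same_trans[OF 2(2) mapv_same] by (intro fin) auto
  qed (use r1 in simp_all)
qed

lemma length_arcs: "length (concat (map dir_arcs ds)) = 4 * length ds"
  "length (concat (map bi_arcs ds)) = 4 * length ds"
  by (induction ds) auto

lemma in_rep_same:
  "in_rep r a ds bs \<Longrightarrow> same X Y r a r' a' \<Longrightarrow> X \<inter> {rND, rNB} = {} \<Longrightarrow> aIN \<notin> Y \<Longrightarrow> in_rep r' a' ds bs"
proof -
  assume 1: "in_rep r a ds bs" "same X Y r a r' a'" "X \<inter> {rND, rNB} = {}" "aIN \<notin> Y"
  then have "r' rND = r rND" "r' rNB = r rNB" "a' aIN = a aIN" unfolding same_def by blast+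
  with 1(1) show "in_rep r' a' ds bs" by (simp add: in_rep_def)
qed

lemma wp_prepare:
  assumes G: "wf_admg G" "encodes G p ds bs" and xy: "x < p" "y < p"
    and r: "r rP = int p" "r rX = int x" "r rY = int y" and inp: "in_rep r a ds bs"
    and zero: "\<forall>v. a aCAUS v = 0"
    and fin: "\<And>r' a' t' T. net_rep p (length ds + length bs) (tilde G x y) T r' a' \<Longrightarrow>
      r' rX = int x \<Longrightarrow> r' rY = int y \<Longrightarrow> \<forall>v<p. a' aFORB v \<noteq> 0 \<longleftrightarrow> v \<in> forb G x y \<Longrightarrow>
      t' \<le> t + 2000 * (p + (length ds + length bs) + 1) \<Longrightarrow> Q r' a' t'"
  shows "wp L prepare Q r a t"
proof -
  let ?m = "length ds + length bs"
  have enc: "nodes G = {..<p}" "set ds = dir G" "set bs \<union> (set bs)\<inverse> = bi G" using G(2) by (auto simp: encodes_def)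
  have bd: "dir G \<subseteq> {..<p} \<times> {..<p}" "bi G \<subseteq> {..<p} \<times> {..<p}" using G(1) enc(1) by (auto simp: wf_admg_def)
  have caus_less: "causal G x y \<subseteq> {..<p}"
  proof
    fix v assume "v \<in> causal G x y"
    then have "v \<noteq> x" "(x, v) \<in> (dir G)\<^sup>*" by (auto simp: causal_iff)
    then have "v \<in> Range (dir G)" by (auto elim: rtranclE)
    then show "v \<in> {..<p}" using bd(1) by auto
  qed
  let ?r0 = "r(rN := int (2 * p))"
  have s0: "same {rN} {} r a ?r0 a" by (simp add: same_def)
  have inp0: "in_rep ?r0 a ds bs" by (rule in_rep_same[OF inp s0]) auto
  have "wp L (build ;; find_causal ;; find_forb ;; build) Q ?r0 a (Suc t)"
    unfolding wp_Seq
  proof (rule wp_build[OF inp0, where x = x], goal_cases)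
    case 1
    show ?case using r by simp
  next
    case (2 r1 a1 t1 T1)
    have r1: "r1 rP = int p" "r1 rN = int (2 * p)" "r1 rX = int x" "r1 rY = int y" "a1 aIN = a aIN"
      using 2(3) r by (auto simp: same_def)
    \<comment> \<open>No causal node has been recorded yet, so the filter keeps every edge.\<close>
    have T1: "T1 = concat (map dir_arcs ds) @ concat (map bi_arcs bs)" using 2(2) zero by simp
    have net1: "net_rep p ?m G T1 r1 a1"
      using 2(1) r1 bd enc T1 length_arcs unfolding net_rep_def arcs_of_def by auto
    have inp1: "in_rep r1 a1 ds bs" by (rule in_rep_same[OF inp0 2(3)]) auto
    note b1 = 2(4)
    show ?case
    proof (rule wp_find_causal[OF net1 r1(3,4) xy], goal_cases)
      case (1 r2 a2 t2)
      note c2 = 1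
      have net2: "net_rep p ?m G T1 r2 a2" by (rule net_rep_same[OF net1 c2(2)]) auto
      have inp2: "in_rep r2 a2 ds bs" by (rule in_rep_same[OF inp1 c2(2)]) auto
      have r2: "r2 rX = int x" "r2 rY = int y" using c2(2) r1 by (auto simp: same_def)
      show ?case
      proof (rule wp_find_forb[OF net2 r2(1) xy(1) c2(1) caus_less], goal_cases)
        case (1 r3 a3 t3)
        note f3 = 1
        have inp3: "in_rep r3 a3 ds bs" by (rule in_rep_same[OF inp2 f3(2)]) auto
        have net3: "net_rep p ?m G T1 r3 a3" by (rule net_rep_same[OF net2 f3(2)]) auto
        have r3: "r3 rX = int x" "r3 rY = int y" "r3 rP = int p" "r3 rN = int (2 * p)" "a3 aCAUS = a2 aCAUS"
          using f3(2) r2 net3 by (auto simp: same_def net_rep_def)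
        show ?case
        proof (rule wp_build[OF inp3 r3(1)], goal_cases)
          case (1 r4 a4 t4 T4)
          let ?ds = "filter (\<lambda>(u, v). \<not> (u = x \<and> a3 aCAUS v \<noteq> 0)) ds"
          have r4: "r4 rP = int p" "r4 rN = int (2 * p)" "r4 rX = int x" "r4 rY = int y" "a4 aFORB = a3 aFORB"
            using 1(3) r3 by (auto simp: same_def)
          \<comment> \<open>Now \<open>aCAUS\<close> holds the causal nodes, and the second run
            leaves out exactly the edges removed by \<open>tilde\<close>.\<close>
          have "set ?ds = dir G - {(x, c) |c. c \<in> causal G x y}"
            using c2(1) r3(5) enc(2) bd(1) by auto
          then have "arcs_of (tilde G x y) T4"
            using 1(2) enc(3) unfolding arcs_of_def by (intro exI[of _ ?ds] exI[of _ bs]) simp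
          moreover have "length T4 \<le> 4 * ?m"
            using 1(2) length_arcs length_filter_le[of "\<lambda>(u, v). \<not> (u = x \<and> a3 aCAUS v \<noteq> 0)" ds] by simp
          ultimately have "net_rep p ?m (tilde G x y) T4 r4 a4"
            using 1(1) r4 bd by (auto simp: net_rep_def)
          then show ?case
            using r4 f3(1,3) c2(3) b1 1(4) by (intro fin[where T = T4]) auto
        qed
      qed
    qed
  qed
  then show ?thesis using r by (simp add: prepare_def)
qed

text \<open>On success \<open>rZ\<close> is not advanced, so it still names the instrument, and
  \<open>aWS\<close> its separator, when the loop ends.\<close>

definition try_all :: com where
  "try_all = Assign rZ (K 0) ;; Assign rF (K 0) ;;
     While (Ite (V rF) (K 0) (Mi (V rP) (V rZ))) (
       try_node ;; Cond (V rF) Skip (Assign rZ (Pl (V rZ) (K 1))))"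

lemma wp_try_all:
  assumes net: "net_rep p m (tilde G x y) T r a"
    and forb: "\<forall>v<p. a aFORB v \<noteq> 0 \<longleftrightarrow> v \<in> forb G x y"
    and r: "r rX = int x" "r rY = int y" and xy: "x < p" "y < p" and nodes: "nodes G = {..<p}"
    and fin: "\<And>r' a' t'. r' rP = int p \<Longrightarrow>
      (r' rF \<noteq> 0 \<Longrightarrow> \<exists>z<p. r' rZ = int z \<and> good_instr G x y z \<and> (\<forall>v<p. a' aWS v \<noteq> 0 \<longleftrightarrow> v \<in> instr_sep G x y z)) \<Longrightarrow>
      (r' rF = 0 \<Longrightarrow> \<forall>z<p. \<not> good_instr G x y z) \<Longrightarrow>
      t' \<le> t + (p + 1) * (1310 * (p + m + 1)) \<Longrightarrow> Q r' a' t'"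
  shows "wp L try_all Q r a t"
proof -
  define B where "B = 1310 * (p + m + 1)"
  have B: "1310 * (p + m + 1) = B" "1310 \<le> B" by (simp_all add: B_def)
  \<comment> \<open>After a success the next test ends the loop, so the variant drops to 0; the
    attempt just made is charged by the factor \<open>z + 1\<close>.\<close>
  define J where "J = (\<lambda>n r' a' t'. net_rep p m (tilde G x y) T r' a' \<and> a' aFORB = a aFORB \<and> r' rX = int x \<and> r' rY = int y \<and>
    (\<exists>z\<le>p. r' rZ = int z \<and> (\<forall>z'<z. \<not> good_instr G x y z') \<and>
      (if r' rF = 0 then n = p - z \<and> t' \<le> t + 2 + z * B
       else n = 0 \<and> z < p \<and> good_instr G x y z \<and> (\<forall>v<p. a' aWS v \<noteq> 0 \<longleftrightarrow> v \<in> instr_sep G x y z) \<and>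
         t' \<le> t + 2 + (z + 1) * B)))"
  show ?thesis
    unfolding try_all_def wp_Seq wp_Assign safe.simps ev.simps simp_thms
  proof (rule wp_While[where n = p and I = J], goal_cases)
    case 1
    have "net_rep p m (tilde G x y) T (r(rZ := 0, rF := 0)) a"
      by (rule net_rep_same[OF net, of "{rZ, rF}" "{}"]) (auto simp: same_def)
    then show ?case unfolding J_def using r by simp
  next
    case (2 n r' a' t')
    then show ?case by simp
  next
    case (3 n r' a' t')
    then obtain z where z: "z \<le> p" "r' rZ = int z" "\<forall>z'<z. \<not> good_instr G x y z'"
      "if r' rF = 0 then n = p - z \<and> t' \<le> t + 2 + z * B
       else n = 0 \<and> z < p \<and> good_instr G x y z \<and> (\<forall>v<p. a' aWS v \<noteq> 0 \<longleftrightarrow> v \<in> instr_sep G x y z) \<and>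
         t' \<le> t + 2 + (z + 1) * B" by (auto simp: J_def)
    have p': "r' rP = int p" using 3(1) by (simp add: J_def net_rep_def)
    have time: "t' \<le> t + 2 + p * B"
    proof (cases "r' rF = 0")
      case True
      have "z * B \<le> p * B" by (rule mult_le_mono1[OF z(1)])
      moreover have "t' \<le> t + 2 + z * B" using True z(4) by simp
      ultimately show ?thesis by (meson add_left_mono le_trans)
    next
      case False
      with z(4) have "z + 1 \<le> p" by simp
      then have "(z + 1) * B \<le> p * B" by (rule mult_le_mono1)
      moreover have "t' \<le> t + 2 + (z + 1) * B" using False z(4) by simp
      ultimately show ?thesis by (meson add_left_mono le_trans)
    qed
    show ?case
    proof (rule fin)
      show "r' rP = int p" by (rule p')
      show "r' rF \<noteq> 0 \<Longrightarrow> \<exists>z<p. r' rZ = int z \<and> good_instr G x y z \<and> (\<forall>v<p. a' aWS v \<noteq> 0 \<longleftrightarrow> v \<in> instr_sep G x y z)"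
        using z by auto
      show "r' rF = 0 \<Longrightarrow> \<forall>z<p. \<not> good_instr G x y z"
        using z 3(3) p' by auto
      show "Suc t' \<le> t + (p + 1) * (1310 * (p + m + 1))" unfolding B(1) using time B(2) by simp
    qed
  next
    case (4 n r' a' t')
    then have F: "r' rF = 0" by (auto split: if_splits)
    with 4(1) obtain z where z: "z \<le> p" "r' rZ = int z" "\<forall>z'<z. \<not> good_instr G x y z'"
      "n = p - z" "t' \<le> t + 2 + z * B" by (auto simp: J_def)
    have n: "net_rep p m (tilde G x y) T r' a'" "a' aFORB = a aFORB" "r' rX = int x" "r' rY = int y"
      using 4(1) by (auto simp: J_def)
    then have "r' rP = int p" by (simp add: net_rep_def)
    with 4(3) F z have zp: "z < p" by auto
    show ?case
      unfolding wp_Seq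
    proof (rule wp_try_node[OF n(1) _ n(3,4) z(2) F xy zp nodes], goal_cases)
      case 1
      then show ?case using forb n(2) by simp
    next
      case (2 r1 a1 t1)
      have net1: "net_rep p m (tilde G x y) T r1 a1" by (rule net_rep_same[OF n(1) 2(3)]) auto
      have r1: "r1 rX = int x" "r1 rY = int y" "r1 rZ = int z" "a1 aFORB = a aFORB"
        using 2(3) n z by (auto simp: same_def)
      have t1: "t1 + 10 \<le> t + 2 + (z + 1) * B" using 2(4) z(5) zp by (simp add: B_def)
      show ?case
      proof (cases "r1 rF = 0")
        case True
        have net2: "net_rep p m (tilde G x y) T (r1(rZ := r1 rZ + 1)) a1"
          by (rule net_rep_same[OF net1, of "{rZ}" "{}"]) (auto simp: same_def)
        have "J (p - (z + 1)) (r1(rZ := r1 rZ + 1)) a1 (Suc (Suc t1))"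
          unfolding J_def using True net2 r1 zp z(3) 2(1) t1
          by (auto simp: less_Suc_eq intro!: exI[of _ "z + 1"])
        then show ?thesis using True zp z(4) by (auto intro!: exI[of _ "p - (z + 1)"])
      next
        case False
        have "J 0 r1 a1 (Suc t1)"
          unfolding J_def using False net1 r1 zp z(3) 2(1,2) t1 by auto
        then show ?thesis using False zp z(4) by (auto intro!: exI[of _ 0])
      qed
    qed
  qed
qed

text \<open>Array 0 shall hold the input from cell 3 on. Its first 29 entries were saved before the
  registers were overwritten; input cell 32 comes next, at index 29. The copied range reaches past
  the end of the input but stays below \<open>L\<close>.\<close>

definition copy_in :: com where
  "copy_in = Assign rX (Ar aIN (K 0)) ;; Assign rY (Ar aIN (K 1)) ;; Assign rN (dbl (Pl (V rND) (V rNB))) ;;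
     For rI rN (Upd aIN (Pl (V rI) (K 29)) (Ar raw (Pl (V rI) (K 32))))"

lemma wp_copy_in:
  assumes r: "r rND = int nd" "r rNB = int nb" and L: "32 + 2 * (nd + nb) \<le> L"
    and lo: "\<forall>i<29. a aIN i = f (i + 3)" and hi: "\<forall>i. 32 \<le> i \<and> i < L \<longrightarrow> a raw i = f i"
    and fin: "\<And>r' a' t'. \<forall>i<29 + 2 * (nd + nb). a' aIN i = f (i + 3) \<Longrightarrow> r' rX = f 3 \<Longrightarrow> r' rY = f 4 \<Longrightarrow>
      same {rX, rY, rN, rI} {aIN} r a r' a' \<Longrightarrow> t' \<le> t + 10 * (nd + nb + 1) \<Longrightarrow> Q r' a' t'"
  shows "wp L copy_in Q r a t"
proof -
  let ?r = "r(rX := f 3, rY := f 4, rN := int (2 * (nd + nb)))"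
  have "wp L (For rI rN (Upd aIN (Pl (V rI) (K 29)) (Ar raw (Pl (V rI) (K 32))))) Q ?r a (t + 3)"
  proof (rule wp_For[where N = "2 * (nd + nb)" and I = "\<lambda>j r' a' t'. (\<forall>i<29 + j. a' aIN i = f (i + 3)) \<and> t' = t + 4 + 3 * j"],
      goal_cases)
    case 1
    then show ?case using lo by simp
  next
    case (6 j r' a' t')
    have "a' raw = a raw" using 6(5) by (auto simp: frame_def)
    moreover have "nat (int j + 32) = j + 32" "nat (int j + 29) = j + 29" by simp_all
    moreover have "a raw (j + 32) = f (j + 32)" using hi L 6(1) by simp
    moreover have "f (32 + j) = f (j + 32)" by (simp add: add.commute)
    ultimately show ?case using 6 L by (auto simp: idx_ok_def less_Suc_eq)
  next
    case (7 r' a' t')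
    have "r' rX = f 3" "r' rY = f 4" "same {rX, rY, rN, rI} {aIN} r a r' a'"
      using 7(3) by (auto simp: frame_def same_def)
    then show ?case using 7(1) by (intro fin) auto
  qed auto
  moreover have "a aIN 0 = f 3" "a aIN 1 = f 4" using lo[rule_format, of 0] lo[rule_format, of 1] by simp_all
  ultimately show ?thesis using r unfolding copy_in_def by (simp add: idx_ok_def eval_nat_numeral)
qed

text \<open>Output cell \<open>i + 1\<close> is entry \<open>i\<close> of \<open>aOUT\<close>. Cells
  from 32 on can be written here; those below are still registers and are filled by the
  postamble.\<close>

definition copy_out :: com where
  "copy_out = Cond (V rF) (Upd aOUT (K 0) (V rZ) ;;
     For rI rP (Upd aOUT (Pl (V rI) (K 1)) (Ar aWS (V rI))) ;;
     For rI rP (Upd raw (Pl (V rI) (K 32)) (Ar aOUT (Pl (V rI) (K 31))))) Skip"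

lemma wp_copy_out:
  assumes p: "r rP = int p" and L: "32 + p \<le> L"
    and fin: "\<And>r' a' t'. r' rF = r rF \<Longrightarrow>
      (r rF \<noteq> 0 \<Longrightarrow> a' aOUT 0 = r rZ \<and> (\<forall>v<p. a' aOUT (Suc v) = a aWS v) \<and> (\<forall>v<p. a' raw (v + 32) = a' aOUT (v + 31))) \<Longrightarrow>
      t' \<le> t + 10 * (p + 1) \<Longrightarrow> Q r' a' t'"
  shows "wp L copy_out Q r a t"
proof (cases "r rF = 0")
  case True
  then show ?thesis by (auto simp: copy_out_def intro!: fin)
next
  case False
  let ?a = "a(aOUT := (a aOUT)(0 := r rZ))"
  have "wp L (For rI rP (Upd aOUT (Pl (V rI) (K 1)) (Ar aWS (V rI))) ;;
     For rI rP (Upd raw (Pl (V rI) (K 32)) (Ar aOUT (Pl (V rI) (K 31))))) Q r ?a (t + 2)"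
    unfolding wp_Seq
  proof (rule wp_For[where N = p and I = "\<lambda>j r' a' t'. a' aOUT 0 = r rZ \<and>
      (\<forall>v<j. a' aOUT (Suc v) = a aWS v) \<and> t' = t + 3 + 3 * j"], goal_cases)
    case (6 j r' a' t')
    have "a' aWS = a aWS" using 6(5) by (auto simp: frame_def)
    moreover have "nat (int j + 1) = Suc j" by simp
    ultimately show ?case using 6 by (auto simp: idx_ok_def less_Suc_eq)
  next
    case (7 r1 a1 t1)
    have r1: "r1 rP = int p" "r1 rF = r rF" using 7(3) p by (auto simp: frame_def)
    show ?case
    proof (rule wp_For[where N = p and I = "\<lambda>j r' a' t'. (\<forall>v<j. a' raw (v + 32) = a' aOUT (v + 31)) \<and> t' = t1 + 2 + 3 * j"],
        goal_cases)
      case (6 j r' a' t')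
      have "nat (int j + 32) = j + 32" "nat (int j + 31) = j + 31" by simp_all
      then show ?case using 6 L by (auto simp: idx_ok_def less_Suc_eq)
    next
      case (7 r2 a2 t2)
      have "a2 aOUT = a1 aOUT" "r2 rF = r rF" using 7(3) r1 by (auto simp: frame_def)
      then show ?case using 7(1) \<open>a1 aOUT 0 = r rZ \<and> _\<close> by (intro fin) auto
    qed (use r1 in auto)
  qed (use p in auto)
  then show ?thesis using False by (simp add: copy_out_def idx_ok_def)
qed

section \<open>Loading the input and unloading the output\<close>

definition solve :: com where
  "solve = copy_in ;; prepare ;; try_all ;; copy_out"

lemma wf_solve: "wf_com solve"
  by (simp add: solve_def copy_in_def prepare_def build_def emit_def find_causal_def find_forb_def
      try_all_def try_node_def try_anc_def try_sep_def try_conn_def copy_out_def desc_query_def anc_query_def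
      walk_query_def query_def setcond_def search_def pop_loop_def visit_def eval_nat_numeral)

text \<open>With \<open>p\<close> and \<open>s = p + m\<close> in cells 0 and 2, the combination \<open>L = p + 31 s\<close> exceeds the input
  length and still lets \<open>p\<close> be recovered without division; cells 3 to 31 are saved to array 0.\<close>

definition save_cells :: "nat \<Rightarrow> instr list" where
  "save_cells n = concat (map (\<lambda>j. [Add 0 0 3, Store 0 j]) [4..<4 + n])"

definition preamble :: "instr list" where
  "preamble = [Add 2 1 2, Add 2 0 2] @ replicate 31 (Add 0 0 2) @ [Store 0 3, Const 3 32] @ save_cells 28 @
     [Const 4 896, Sub 0 0 4, Const 10 0, Add 10 10 0] @ replicate 31 (Sub 10 10 2) @
     [Const 11 0, Add 11 11 1, Sub 12 2 10, Sub 12 12 11]"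

text \<open>Cell 1 is the pointer and is recomputed from \<open>L\<close> in cell 0 each time, so
  cells 2 to 31 may be overwritten freely.\<close>

definition load_cells :: "nat list \<Rightarrow> instr list" where
  "load_cells vs = concat (map (\<lambda>v. [Const 1 (int (32 * (v + 1) + aOUT)), Add 1 1 0, Load (v + 2) 1]) vs)"

text \<open>Cells 1 and 0 come last, since they hold the pointer and the base. The jump distance 96
  skips the jump itself, 90 load instructions and the 5 instructions after them.\<close>

definition postamble :: "nat \<Rightarrow> instr list" where
  "postamble pc = [Jz rF (pc + 96)] @ load_cells [0..<30] @
     [Const 1 (int aOUT), Add 1 1 0, Load 1 1, Const 0 1, Halt, Const 0 0, Halt]"

definition program :: "instr list" where
  "program = preamble @ comp solve (length preamble) @ postamble (length preamble + len_com solve)"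

lemma run_replicate_Add:
  "code_at P pc (replicate n (Add x x y)) \<Longrightarrow> x \<noteq> y \<Longrightarrow>
   run P n (pc, m) (pc + n, m(x := m x + int n * m y))"
proof (induction n arbitrary: pc m)
  case 0
  then show ?case by (simp add: run_refl)
next
  case (Suc n)
  let ?m = "m(x := m x + m y)"
  have "run P n (Suc pc, ?m) (Suc pc + n, ?m(x := ?m x + int n * ?m y))"
    using Suc by (intro Suc.IH) simp_all
  moreover have "?m(x := ?m x + int n * ?m y) = m(x := m x + int (Suc n) * m y)"
    using Suc.prems by (simp add: fun_eq_iff algebra_simps)
  moreover have ex: "pc < length P" "P ! pc = Add x x y" using Suc.prems by simp_all
  then have "exec (P ! pc) (pc, m) = (Suc pc, ?m)" by simp
  ultimately have "run P n (exec (P ! pc) (pc, m)) (pc + Suc n, m(x := m x + int (Suc n) * m y))"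
    by (simp only: add_Suc add_Suc_right)
  with ex show ?case by (intro run_instr) (simp_all only: instr.distinct not_False_eq_True)
qed

lemma run_replicate_Sub:
  "code_at P pc (replicate n (Sub x x y)) \<Longrightarrow> x \<noteq> y \<Longrightarrow>
   run P n (pc, m) (pc + n, m(x := m x - int n * m y))"
proof (induction n arbitrary: pc m)
  case 0
  then show ?case by (simp add: run_refl)
next
  case (Suc n)
  let ?m = "m(x := m x - m y)"
  have "run P n (Suc pc, ?m) (Suc pc + n, ?m(x := ?m x - int n * ?m y))"
    using Suc by (intro Suc.IH) simp_all
  moreover have "?m(x := ?m x - int n * ?m y) = m(x := m x - int (Suc n) * m y)"
    using Suc.prems by (simp add: fun_eq_iff algebra_simps)
  moreover have ex: "pc < length P" "P ! pc = Sub x x y" using Suc.prems by simp_all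
  then have "exec (P ! pc) (pc, m) = (Suc pc, ?m)" by simp
  ultimately have "run P n (exec (P ! pc) (pc, m)) (pc + Suc n, m(x := m x - int (Suc n) * m y))"
    by (simp only: add_Suc add_Suc_right)
  with ex show ?case by (intro run_instr) (simp_all only: instr.distinct not_False_eq_True)
qed

lemma run_code2:
  assumes "code_at P pc [i, j]" "i \<noteq> Halt" "j \<noteq> Halt" "fst (exec i (pc, m)) = Suc pc"
    "exec j (exec i (pc, m)) = (Suc (Suc pc), m2)"
  shows "run P 2 (pc, m) (pc + 2, m2)"
proof -
  obtain m1 where m1: "exec i (pc, m) = (Suc pc, m1)" using assms(4) by (metis prod.collapse)
  with assms show ?thesis unfolding numeral_2_eq_2 by (auto intro!: run_instr run_refl)
qed

lemma save_cells_Suc: "save_cells (Suc n) = save_cells n @ [Add 0 0 3, Store 0 (4 + n)]"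
proof -
  have "[4..<4 + Suc n] = [4..<4 + n] @ [4 + n]" by (metis add_Suc_right le_add1 upt_Suc_append)
  then show ?thesis by (simp only: save_cells_def map_append concat_append) simp
qed

lemma length_save_cells [simp]: "length (save_cells n) = 2 * n"
  by (induction n) (simp_all add: save_cells_Suc, simp add: save_cells_def)

text \<open>Cell 0 serves as the moving pointer. The cells still to be saved lie below 32 and the
  targets above \<open>L\<close>, so each is intact when its turn comes.\<close>

lemma run_save_cells:
  assumes "code_at P pc (save_cells n)" "m 0 = int L" "m 3 = 32" "32 \<le> L" "n \<le> 28"
  shows "\<exists>m'. run P (2 * n) (pc, m) (pc + 2 * n, m') \<and> m' 0 = int (L + 32 * n) \<and>
     (\<forall>i<n. m' (L + 32 * (i + 1)) = m (i + 4)) \<and>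
     (\<forall>q. q \<noteq> 0 \<longrightarrow> (\<forall>i<n. q \<noteq> L + 32 * (i + 1)) \<longrightarrow> m' q = m q)"
  using assms
proof (induction n)
  case 0
  then show ?case by (auto simp: save_cells_def intro: run_refl)
next
  case (Suc n)
  then obtain m1 where m1: "run P (2 * n) (pc, m) (pc + 2 * n, m1)" "m1 0 = int (L + 32 * n)"
     "\<forall>i<n. m1 (L + 32 * (i + 1)) = m (i + 4)"
     "\<forall>q. q \<noteq> 0 \<longrightarrow> (\<forall>i<n. q \<noteq> L + 32 * (i + 1)) \<longrightarrow> m1 q = m q"
    by (auto simp: save_cells_Suc)
  have c: "m1 3 = 32" "m1 (4 + n) = m (n + 4)" using m1(4) Suc.prems by (auto simp: add.commute)
  let ?q = "L + 32 * (n + 1)"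
  let ?m2 = "m1(0 := int ?q)" 
  have nat: "nat (int ?q) = ?q" by (rule nat_int)
  let ?m3 = "?m2(?q := m (n + 4))"
  have "run P 2 (pc + 2 * n, m1) (pc + 2 * n + 2, ?m3)"
  proof (rule run_code2)
    show "code_at P (pc + 2 * n) [Add 0 0 3, Store 0 (4 + n)]"
      using Suc.prems(1) by (simp add: save_cells_Suc)
    have 1: "exec (Add 0 0 3) (pc + 2 * n, m1) = (Suc (pc + 2 * n), ?m2)"
      using c(1) m1(2) by (simp add: fun_eq_iff)
    have 2: "exec (Store 0 (4 + n)) (Suc (pc + 2 * n), ?m2) = (Suc (Suc (pc + 2 * n)), ?m3)"
      using c(2) by (simp add: nat del: of_nat_add of_nat_mult)
    show "fst (exec (Add 0 0 3) (pc + 2 * n, m1)) = Suc (pc + 2 * n)" unfolding 1 by simp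
    show "exec (Store 0 (4 + n)) (exec (Add 0 0 3) (pc + 2 * n, m1)) = (Suc (Suc (pc + 2 * n)), ?m3)"
      unfolding 1 by (rule 2)
  qed simp_all
  from run_trans[OF m1(1) this] have "run P (2 * Suc n) (pc, m) (pc + 2 * Suc n, ?m3)" by simp
  moreover have "?m3 0 = int (L + 32 * Suc n)" using Suc.prems by simp
  moreover have "\<forall>i<Suc n. ?m3 (L + 32 * (i + 1)) = m (i + 4)" using m1(3) Suc.prems by (auto simp: less_Suc_eq)
  moreover have "\<forall>q. q \<noteq> 0 \<longrightarrow> (\<forall>i<Suc n. q \<noteq> L + 32 * (i + 1)) \<longrightarrow> ?m3 q = m q"
    using m1(4) by (auto simp: less_Suc_eq)
  ultimately show ?case by blast
qed

lemma run_preamble: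
  assumes P: "code_at P 0 preamble" and m: "m 0 = int p" "m 1 = int nd" "m 2 = int nb" "2 \<le> p"
    and L: "L = 32 * p + 31 * (nd + nb)"
  shows "\<exists>m'. run P (length preamble) (0, m) (length preamble, m') \<and> m' 0 = int L \<and>
     m' rP = int p \<and> m' rND = int nd \<and> m' rNB = int nb \<and>
     (\<forall>i<29. m' (L + 32 * i) = m (i + 3)) \<and>
     (\<forall>q. 32 \<le> q \<longrightarrow> (\<forall>i<29. q \<noteq> L + 32 * i) \<longrightarrow> m' q = m q)"
proof -
  let ?s = "int (p + nd + nb)"
  \<comment> \<open>Two nodes already push \<open>L\<close> above all register cells.\<close>
  have L32: "64 \<le> L" using L m by simp
  have ms: "m (Suc 0) = int nd" using m(2) by simp
  have code: "code_at P 0 [Add 2 1 2, Add 2 0 2]" "code_at P 2 (replicate 31 (Add 0 0 2))"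
    "code_at P 33 [Store 0 3, Const 3 32]" "code_at P 35 (save_cells 28)"
    "code_at P 91 [Const 4 896, Sub 0 0 4]" "code_at P 93 [Const 10 0, Add 10 10 0]"
    "code_at P 95 (replicate 31 (Sub 10 10 2))"
    "code_at P 126 [Const 11 0, Add 11 11 1]" "code_at P 128 [Sub 12 2 10, Sub 12 12 11]"
    using P unfolding preamble_def by (simp_all add: numeral_2_eq_2)
  have len: "length preamble = 130" by (simp add: preamble_def)
  define m1 where "m1 = m(2 := ?s)"
  have 1: "run P 2 (0, m) (0 + 2, m1)"
    by (rule run_code2[OF code(1)]) (auto simp: m1_def m ms fun_eq_iff)
  define m2 where "m2 = m1(0 := int L)"
  have "m1 0 + int 31 * m1 2 = int L" by (simp add: m1_def m ms L)
  then have 2: "run P 31 (2, m1) (2 + 31, m2)" using run_replicate_Add[OF code(2), of m1] by (simp add: m2_def)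
  define m3 where "m3 = m2(L := m 3, 3 := 32)"
  have 3: "run P 2 (33, m2) (33 + 2, m3)"
    by (rule run_code2[OF code(3)]) (use L32 in \<open>auto simp: m3_def m2_def m1_def fun_eq_iff\<close>)
  have "m3 0 = int L" "m3 3 = 32" using L32 by (simp_all add: m3_def m2_def)
  from run_save_cells[OF code(4) this] L32 obtain m4 where
    4: "run P 56 (35, m3) (35 + 56, m4)" "m4 0 = int (L + 896)"
     "\<forall>i<28. m4 (L + 32 * (i + 1)) = m3 (i + 4)"
     "\<forall>q. q \<noteq> 0 \<longrightarrow> (\<forall>i<28. q \<noteq> L + 32 * (i + 1)) \<longrightarrow> m4 q = m3 q" by auto
  have m4: "m4 (Suc 0) = int nd" "m4 2 = ?s" "m4 L = m 3"
    using 4(4) L32 by (auto simp: m3_def m2_def m1_def m ms)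
  \<comment> \<open>\<open>896 = 28 * 32\<close> takes the pointer back to \<open>L\<close> after 28
    saved cells.\<close>
  define m5 where "m5 = m4(4 := 896, 0 := int L)"
  have 5: "run P 2 (91, m4) (91 + 2, m5)"
    by (rule run_code2[OF code(5)]) (auto simp: m5_def 4(2) fun_eq_iff)
  define m6 where "m6 = m5(10 := int L)"
  have 6: "run P 2 (93, m5) (93 + 2, m6)"
    by (rule run_code2[OF code(6)]) (auto simp: m6_def m5_def fun_eq_iff)
  define m7 where "m7 = m6(10 := int p)"
  \<comment> \<open>Since \<open>L = p + 31 * s\<close> and cell 2 still holds \<open>s\<close>,
    subtracting it 31 times recovers \<open>p\<close>.\<close>
  have "m6 10 - int 31 * m6 2 = int p" by (simp add: m6_def m5_def m4 L)
  then have 7: "run P 31 (95, m6) (95 + 31, m7)" using run_replicate_Sub[OF code(7), of m6] by (simp add: m7_def)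
  define m8 where "m8 = m7(11 := int nd)"
  have 8: "run P 2 (126, m7) (126 + 2, m8)"
    by (rule run_code2[OF code(8)]) (auto simp: m8_def m7_def m6_def m5_def m4 fun_eq_iff)
  define m9 where "m9 = m8(12 := int nb)"
  have 9: "run P 2 (128, m8) (128 + 2, m9)"
    by (rule run_code2[OF code(9)]) (auto simp: m9_def m8_def m7_def m6_def m5_def m4 fun_eq_iff)
  have eqs: "0 + 2 = (2::nat)" "2 + 31 = (33::nat)" "33 + 2 = (35::nat)" "35 + 56 = (91::nat)" "91 + 2 = (93::nat)"
    "93 + 2 = (95::nat)" "95 + 31 = (126::nat)" "126 + 2 = (128::nat)" "128 + 2 = (130::nat)" by simp_all
  note seq = 1[unfolded eqs] 2[unfolded eqs] 3[unfolded eqs] 4(1)[unfolded eqs] 5[unfolded eqs] 6[unfolded eqs]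
    7[unfolded eqs] 8[unfolded eqs] 9[unfolded eqs]
  have "run P (2 + 31 + 2 + 56 + 2 + 2 + 31 + 2 + 2) (0, m) (130, m9)"
    by (rule run_trans[OF run_trans[OF run_trans[OF run_trans[OF run_trans[OF run_trans[OF run_trans[OF run_trans]]]]]]])
       (fact seq)+
  then have "run P (length preamble) (0, m) (length preamble, m9)" by (simp add: len)
  moreover have hi: "m9 q = m4 q" if "32 \<le> q" for q
    using that by (simp add: m9_def m8_def m7_def m6_def m5_def)
  moreover have "m9 (L + 32 * i) = m (i + 3)" if "i < 29" for i
  proof (cases i)
    case 0
    then show ?thesis using hi L32 m4(3) by simp
  next
    case (Suc j)
    then have "m9 (L + 32 * i) = m3 (j + 4)" using hi L32 4(3) that by simp
    also have "\<dots> = m (j + 4)" using L32 that Suc by (simp add: m3_def m2_def m1_def)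
    finally show ?thesis using Suc by (simp add: add.commute)
  qed
  moreover have "m9 q = m q" if q: "32 \<le> q" "\<forall>i<29. q \<noteq> L + 32 * i" for q
  proof -
    have "q \<noteq> L + 32 * (i + 1)" if "i < 28" for i using q(2)[rule_format, of "i + 1"] that by simp
    then have "m9 q = m3 q" using hi q(1) 4(4) by simp
    also have "\<dots> = m q" using q(1) q(2)[rule_format, of 0] by (simp add: m3_def m2_def m1_def)
    finally show ?thesis .
  qed
  ultimately show ?thesis
    by (intro exI[of _ m9]) (simp add: m9_def m8_def m7_def m6_def m5_def)
qed

lemma length_load_cells [simp]: "length (load_cells vs) = 3 * length vs"
  by (induction vs) (auto simp: load_cells_def)

text \<open>Sources lie above \<open>L\<close> and targets below 32, so no load destroys the source
  of another.\<close>

lemma run_load_cells: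
  assumes "code_at P pc (load_cells vs)" "m 0 = int L" "32 \<le> L" "set vs \<subseteq> {..<30}" "distinct vs"
  shows "\<exists>m'. run P (3 * length vs) (pc, m) (pc + 3 * length vs, m') \<and>
     (\<forall>v\<in>set vs. m' (v + 2) = m (L + 32 * (v + 1) + aOUT)) \<and>
     (\<forall>q. q \<noteq> 1 \<longrightarrow> (\<forall>v\<in>set vs. q \<noteq> v + 2) \<longrightarrow> m' q = m q)"
  using assms
proof (induction vs arbitrary: pc m)
  case Nil
  then show ?case by (auto intro: run_refl)
next
  case (Cons v vs)
  let ?q = "L + 32 * (v + 1) + aOUT"
  define m1 where "m1 = m(1 := int ?q, v + 2 := m ?q)"
  have code: "code_at P pc [Const 1 (int (32 * (v + 1) + aOUT)), Add 1 1 0, Load (v + 2) 1]"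
    "code_at P (pc + 3) (load_cells vs)"
    using Cons.prems(1) by (simp_all add: load_cells_def eval_nat_numeral)
  have nat: "nat (int ?q) = ?q" by (rule nat_int)
  have A: "run P 2 (pc, m) (pc + 2, m(1 := int ?q))"
    by (rule run_code2) (use code(1) Cons.prems(2) in \<open>auto simp: fun_eq_iff\<close>)
  have e: "exec (Load (v + 2) 1) (pc + 2, m(1 := int ?q)) = (Suc (pc + 2), m1)"
    using nat by (simp add: m1_def del: of_nat_add of_nat_mult)
  have m1: "m1 0 = int L" "m1 (v + 2) = m ?q" "\<And>q. q \<noteq> 1 \<Longrightarrow> q \<noteq> v + 2 \<Longrightarrow> m1 q = m q"
    using Cons.prems(2) by (simp_all add: m1_def)
  have "pc + 2 < length P" "P ! (pc + 2) = Load (v + 2) 1" using code(1) by simp_all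
  then have "run P (Suc 0) (pc + 2, m(1 := int ?q)) (Suc (pc + 2), m1)"
    using e by (intro run_instr) (simp_all only: e run_refl instr.distinct not_False_eq_True)
  from run_trans[OF A this] have 1: "run P 3 (pc, m) (pc + 3, m1)"
    by (simp only: numeral_3_eq_3 numeral_2_eq_2 add_Suc_right add_0_right)
  have "set vs \<subseteq> {..<30}" "distinct vs" "v \<notin> set vs" "v < 30" using Cons.prems(4,5) by auto
  with Cons.IH[of "pc + 3" m1] code(2) m1(1) Cons.prems(3) obtain m' where
    m': "run P (3 * length vs) (pc + 3, m1) (pc + 3 + 3 * length vs, m')"
     "\<forall>w\<in>set vs. m' (w + 2) = m1 (L + 32 * (w + 1) + aOUT)"
     "\<forall>q. q \<noteq> 1 \<longrightarrow> (\<forall>w\<in>set vs. q \<noteq> w + 2) \<longrightarrow> m' q = m1 q" by blast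
  have "run P (3 + 3 * length vs) (pc, m) (pc + 3 + 3 * length vs, m')" by (rule run_trans[OF 1 m'(1)])
  moreover have "3 + 3 * length vs = 3 * length (v # vs)" "pc + 3 + 3 * length vs = pc + 3 * length (v # vs)" by simp_all
  ultimately have "run P (3 * length (v # vs)) (pc, m) (pc + 3 * length (v # vs), m')" by metis
  moreover have "m' (w + 2) = m (L + 32 * (w + 1) + aOUT)" if "w \<in> set (v # vs)" for w
  proof (cases "w = v")
    case True
    then have "m' (w + 2) = m1 (v + 2)" using m'(3)[rule_format, of "w + 2"] \<open>v \<notin> set vs\<close> by auto
    then show ?thesis using m1(2) True by simp
  next
    case False
    then have "m' (w + 2) = m1 (L + 32 * (w + 1) + aOUT)" using m'(2) that by auto
    also have "\<dots> = m (L + 32 * (w + 1) + aOUT)" using Cons.prems(3) \<open>v < 30\<close> by (intro m1(3)) auto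
    finally show ?thesis .
  qed
  moreover have "m' q = m q" if "q \<noteq> 1" "\<forall>w\<in>set (v # vs). q \<noteq> w + 2" for q
    using m'(3)[rule_format, of q] m1(3)[of q] that by simp
  ultimately show ?case by blast
qed


lemma length_concat_pairs: "length (concat (map (\<lambda>(u, v). [int u, int v]) ds)) = 2 * length ds"
  by (induction ds) auto

lemma nth_concat_pairs:
  "i < length ds \<Longrightarrow> concat (map (\<lambda>(u, v). [int u, int v]) ds) ! (2 * i) = int (fst (ds ! i)) \<and>
     concat (map (\<lambda>(u, v). [int u, int v]) ds) ! Suc (2 * i) = int (snd (ds ! i))"
proof (induction ds arbitrary: i)
  case (Cons e ds)
  obtain u v where "e = (u, v)" by fastforce
  with Cons show ?case by (cases i) simp_all
qed simp

lemma init_mem_values: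
  "init_mem p x y ds bs 0 = int p" "init_mem p x y ds bs 1 = int (length ds)"
  "init_mem p x y ds bs 2 = int (length bs)" "init_mem p x y ds bs 3 = int x" "init_mem p x y ds bs 4 = int y"
  "i < length ds \<Longrightarrow> init_mem p x y ds bs (2 * i + 5) = int (fst (ds ! i))"
  "i < length ds \<Longrightarrow> init_mem p x y ds bs (2 * i + 6) = int (snd (ds ! i))"
  "j < length bs \<Longrightarrow> init_mem p x y ds bs (2 * length ds + 2 * j + 5) = int (fst (bs ! j))"
  "j < length bs \<Longrightarrow> init_mem p x y ds bs (2 * length ds + 2 * j + 6) = int (snd (bs ! j))"
  "5 + 2 * (length ds + length bs) \<le> q \<Longrightarrow> init_mem p x y ds bs q = 0"
proof -
  let ?f = "\<lambda>es. concat (map (\<lambda>(u, v). [int u, int v]) es)"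
  have len: "length (input_list p x y ds bs) = 5 + 2 * (length ds + length bs)"
    by (simp add: input_list_def length_concat_pairs)
  have nth5: "input_list p x y ds bs ! (q + 5) = (?f ds @ ?f bs) ! q" for q
    by (simp add: input_list_def nth_append eval_nat_numeral)
  show "init_mem p x y ds bs 0 = int p" "init_mem p x y ds bs 1 = int (length ds)"
    "init_mem p x y ds bs 2 = int (length bs)" "init_mem p x y ds bs 3 = int x" "init_mem p x y ds bs 4 = int y"
    using len by (simp_all add: init_mem_def Let_def) (simp_all add: input_list_def)
  show "5 + 2 * (length ds + length bs) \<le> q \<Longrightarrow> init_mem p x y ds bs q = 0"
    using len by (simp add: init_mem_def Let_def)
  have D: "init_mem p x y ds bs (q + 5) = ?f ds ! q" if "q < 2 * length ds" for q
    using that len nth5 by (simp add: init_mem_def Let_def nth_append length_concat_pairs)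
  have B: "init_mem p x y ds bs (2 * length ds + q + 5) = ?f bs ! q" if "q < 2 * length bs" for q
    using that len nth5 by (simp add: init_mem_def Let_def nth_append length_concat_pairs)
  show "init_mem p x y ds bs (2 * i + 5) = int (fst (ds ! i))"
    "init_mem p x y ds bs (2 * i + 6) = int (snd (ds ! i))" if "i < length ds"
    using D[of "2 * i"] D[of "2 * i + 1"] nth_concat_pairs[OF that] that by (simp_all add: add.commute)
  show "init_mem p x y ds bs (2 * length ds + 2 * j + 5) = int (fst (bs ! j))"
    "init_mem p x y ds bs (2 * length ds + 2 * j + 6) = int (snd (bs ! j))" if "j < length bs"
    using B[of "2 * j"] B[of "2 * j + 1"] nth_concat_pairs[OF that] that by (simp_all add: add.commute add.left_commute)
qed

lemma wp_solve:
  assumes G: "wf_admg G" "encodes G p ds bs" and xy: "x < p" "y < p" "x \<noteq> y"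
    and r: "r rP = int p" "r rND = int (length ds)" "r rNB = int (length bs)"
    and L: "L = 32 * p + 31 * (length ds + length bs)"
    and lo: "\<forall>i<29. a aIN i = init_mem p x y ds bs (i + 3)"
    and hi: "\<forall>i. 32 \<le> i \<and> i < L \<longrightarrow> a raw i = init_mem p x y ds bs i"
    and zero: "\<forall>v. a aCAUS v = 0"
    and fin: "\<And>r' a' t'. (r' rF \<noteq> 0 \<Longrightarrow> \<exists>z<p. good_instr G x y z \<and> a' aOUT 0 = int z \<and>
         (\<forall>v<p. a' aOUT (Suc v) \<noteq> 0 \<longleftrightarrow> v \<in> instr_sep G x y z) \<and> (\<forall>v<p. a' raw (v + 32) = a' aOUT (v + 31))) \<Longrightarrow>
      (r' rF = 0 \<Longrightarrow> \<forall>z<p. \<not> good_instr G x y z) \<Longrightarrow>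
      t' \<le> t + 4000 * (p + 1) * (p + (length ds + length bs) + 1) \<Longrightarrow> Q r' a' t'"
  shows "wp L solve Q r a t"
proof -
  let ?m = "length ds + length bs" and ?f = "init_mem p x y ds bs"
  have p2: "2 \<le> p" using xy by linarith
  have nodes: "nodes G = {..<p}" using G(2) by (simp add: encodes_def)
  show ?thesis
    unfolding solve_def wp_Seq
  proof (rule wp_copy_in[OF r(2,3) _ lo hi], goal_cases)
    case 1
    show ?case using L p2 by simp
  next
    case (2 r1 a1 t1)
    have r1: "r1 rP = int p" "r1 rX = int x" "r1 rY = int y" "r1 rND = int (length ds)" "r1 rNB = int (length bs)"
      "a1 aCAUS = a aCAUS"
      using 2(2-4) r init_mem_values by (auto simp: same_def)
    have "in_rep r1 a1 ds bs"
      unfolding in_rep_def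
    proof (intro conjI allI impI)
      fix i assume "i < length ds"
      then show "a1 aIN (2 * i + 2) = int (fst (ds ! i))" "a1 aIN (2 * i + 3) = int (snd (ds ! i))"
        using 2(1)[rule_format, of "2 * i + 2"] 2(1)[rule_format, of "2 * i + 3"] init_mem_values(6,7)[of i ds p x y bs]
        by (simp_all add: add.commute)
    next
      fix j assume "j < length bs"
      then show "a1 aIN (2 * length ds + (2 * j + 2)) = int (fst (bs ! j))"
        "a1 aIN (2 * length ds + (2 * j + 3)) = int (snd (bs ! j))"
        using 2(1)[rule_format, of "2 * length ds + (2 * j + 2)"] 2(1)[rule_format, of "2 * length ds + (2 * j + 3)"]
          init_mem_values(8,9)[of j bs p x y ds]
        by (simp_all add: ac_simps)
    qed (use r1 in auto)
    note in1 = this and copy = 2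
    show ?case
    proof (rule wp_prepare[OF G xy(1,2) r1(1-3) in1], goal_cases)
      case 1
      show ?case using r1 zero by simp
    next
      case (2 r2 a2 t2 T)
      note prep = 2
      show ?case
      proof (rule wp_try_all[OF prep(1,4,2,3) xy(1,2) nodes], goal_cases)
        case (1 r3 a3 t3)
        note tr = 1
        show ?case
        proof (rule wp_copy_out[where p = p], goal_cases)
          case 1
          show ?case by (rule tr(1))
        next
          case 2
          show ?case using L p2 by simp
        next
          case (3 r4 a4 t4)
          note 2 = 3
          \<comment> \<open>Only the loop over all nodes multiplies a linear cost by
            \<open>p + 1\<close>; the remaining linear terms are absorbed by the same
            factor.\<close>
          have "t4 \<le> t + 10 * (?m + 1) + 2000 * (p + ?m + 1) + (p + 1) * (1310 * (p + ?m + 1)) + 10 * (p + 1)"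
            using 2(3) tr(4) prep(5) copy(5) by linarith
          also have "\<dots> \<le> t + 2020 * (p + ?m + 1) + (p + 1) * (1310 * (p + ?m + 1))" by simp
          also have "\<dots> \<le> t + (p + 1) * (2020 * (p + ?m + 1)) + (p + 1) * (1310 * (p + ?m + 1))" by simp
          also have "\<dots> \<le> t + 4000 * (p + 1) * (p + ?m + 1)"
            unfolding add.assoc add_mult_distrib2[symmetric] by (simp add: algebra_simps)
          finally have time: "t4 \<le> t + 4000 * (p + 1) * (p + ?m + 1)" .
          show ?case
          proof (rule fin)
            assume "r4 rF \<noteq> 0"
            then have F: "r3 rF \<noteq> 0" using 2(1) by simp
            from tr(2)[OF F] obtain z where z: "z < p" "r3 rZ = int z" "good_instr G x y z"
              "\<forall>v<p. a3 aWS v \<noteq> 0 \<longleftrightarrow> v \<in> instr_sep G x y z" by blast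
            with 2(2)[OF F] show "\<exists>z<p. good_instr G x y z \<and> a4 aOUT 0 = int z \<and>
              (\<forall>v<p. a4 aOUT (Suc v) \<noteq> 0 \<longleftrightarrow> v \<in> instr_sep G x y z) \<and> (\<forall>v<p. a4 raw (v + 32) = a4 aOUT (v + 31))"
              by (intro exI[of _ z]) simp
          next
            show "r4 rF = 0 \<Longrightarrow> \<forall>z<p. \<not> good_instr G x y z" using 2(1) tr(3) by simp
          qed (rule time)
        qed
      qed
    qed
  qed
qed

lemma halted_Halt: "pc < length P \<Longrightarrow> P ! pc = Halt \<Longrightarrow> halted P (pc, m)"
  by (simp add: halted_def)

lemma run_postamble_fail:
  assumes "code_at P pc (postamble pc)" "m rF = 0"
  shows "\<exists>pc' m'. run P 2 (pc, m) (pc', m') \<and> halted P (pc', m') \<and> m' 0 = 0"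
proof -
  have jz: "pc < length P" "P ! pc = Jz rF (pc + 96)" using assms(1) by (simp_all add: postamble_def)
  have "code_at P (pc + 1 + 90 + 5) [Const 0 0, Halt]"
    using assms(1) by (simp add: postamble_def eval_nat_numeral)
  then have c: "pc + 96 < length P" "P ! (pc + 96) = Const 0 0" "Suc (pc + 96) < length P" "P ! Suc (pc + 96) = Halt"
    by (simp_all add: add.commute)
  have "run P (Suc (Suc 0)) (pc, m) (Suc (pc + 96), m(0 := 0))"
    by (rule run_instr[OF jz(1)]) (auto simp only: jz assms(2) exec.simps instr.distinct if_True refl
      intro!: run_instr[OF c(1)] run_refl c(2) simp: c(2))
  then show ?thesis
    using halted_Halt[OF c(3,4)] by (intro exI[of _ "Suc (pc + 96)"] exI[of _ "m(0 := 0)"]) (simp add: numeral_2_eq_2)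
qed


lemma run_postamble_found:
  assumes "code_at P pc (postamble pc)" "m rF \<noteq> 0" "m 0 = int L" "32 \<le> L"
  shows "\<exists>pc' m'. run P 95 (pc, m) (pc', m') \<and> halted P (pc', m') \<and> m' 0 = 1 \<and>
     m' 1 = m (L + aOUT) \<and> (\<forall>v<30. m' (v + 2) = m (L + 32 * (v + 1) + aOUT)) \<and> (\<forall>q\<ge>32. m' q = m q)"
proof -
  let ?h = "pc + 91"
  have jz: "pc < length P" "P ! pc = Jz rF (pc + 96)" and lc: "code_at P (pc + 1) (load_cells [0..<30])"
    using assms(1) by (simp_all add: postamble_def)
  have "code_at P (pc + 1 + 90) [Const 1 (int aOUT), Add 1 1 0, Load 1 1, Const 0 1, Halt]"
    using assms(1) by (simp add: postamble_def eval_nat_numeral)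
  then have c: "code_at P ?h [Const 1 (int aOUT), Add 1 1 0]" "?h + 2 < length P" "P ! (?h + 2) = Load 1 1"
    "?h + 3 < length P" "P ! (?h + 3) = Const 0 1" "?h + 4 < length P" "P ! (?h + 4) = Halt"
    by (simp_all add: eval_nat_numeral)
  have 1: "run P (Suc 0) (pc, m) (pc + 1, m)"
    using jz assms(2) by (intro run_instr) (simp_all add: run_refl)
  obtain m1 where 2: "run P 90 (pc + 1, m) (pc + 1 + 90, m1)"
    "\<forall>v<30. m1 (v + 2) = m (L + 32 * (v + 1) + aOUT)" "\<forall>q. q \<noteq> 1 \<longrightarrow> (\<forall>v<30. q \<noteq> v + 2) \<longrightarrow> m1 q = m q"
    using run_load_cells[of P "pc + 1" "[0..<30]" m L] lc assms(3,4) by (auto simp: atLeast0LessThan)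
  have m1: "m1 0 = int L" "\<And>q. 32 \<le> q \<Longrightarrow> m1 q = m q" using 2(3) assms(3) by auto
  define m2 where "m2 = m1(1 := int (L + aOUT))"
  have 3: "run P 2 (?h, m1) (?h + 2, m2)"
    by (rule run_code2[OF c(1)]) (use m1(1) in \<open>auto simp: m2_def fun_eq_iff\<close>)
  define m3 where "m3 = m2(1 := m (L + aOUT))"
  have "m2 (nat (m2 1)) = m (L + aOUT)"
    using m1(2)[of "L + aOUT"] assms(4) unfolding m2_def fun_upd_same nat_int by simp
  then have "exec (Load 1 1) (?h + 2, m2) = (Suc (?h + 2), m3)" by (simp add: m3_def)
  then have 4: "run P (Suc 0) (?h + 2, m2) (Suc (?h + 2), m3)"
    using c(2,3) by (intro run_instr) (simp_all only: run_refl instr.distinct not_False_eq_True)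
  define m4 where "m4 = m3(0 := 1)"
  have "exec (Const 0 1) (?h + 3, m3) = (Suc (?h + 3), m4)" by (simp add: m4_def)
  then have 5: "run P (Suc 0) (?h + 3, m3) (Suc (?h + 3), m4)"
    using c(4,5) by (intro run_instr) (simp_all only: run_refl instr.distinct not_False_eq_True)
  have eqs: "pc + 1 + 90 = ?h" "Suc (?h + 2) = ?h + 3" "Suc (?h + 3) = ?h + 4" by simp_all
  note seq = 1 2(1)[unfolded eqs] 3 4[unfolded eqs] 5[unfolded eqs]
  have "run P (Suc 0 + 90 + 2 + Suc 0 + Suc 0) (pc, m) (?h + 4, m4)"
    by (rule run_trans[OF run_trans[OF run_trans[OF run_trans]]]) (fact seq)+
  then have "run P 95 (pc, m) (?h + 4, m4)" by simp
  moreover have "halted P (?h + 4, m4)" by (rule halted_Halt[OF c(6,7)])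
  moreover have "m4 0 = 1" "m4 1 = m (L + aOUT)" by (simp_all add: m4_def m3_def)
  moreover have "m4 (v + 2) = m (L + 32 * (v + 1) + aOUT)" if "v < 30" for v
    using 2(2) that by (simp add: m4_def m3_def m2_def)
  moreover have "m4 q = m q" if "32 \<le> q" for q using m1(2)[OF that] that by (simp add: m4_def m3_def m2_def)
  ultimately show ?thesis by blast
qed

section \<open>Correctness and running time of the machine program\<close>

text \<open>The additive 230 covers the 130 instructions of the preamble and the at most 95 steps of
  the postamble.\<close>

lemma program_correct:
  assumes G: "wf_admg G" "encodes G p ds bs" and xy: "x < p" "y < p" "x \<noteq> y"
  shows "\<exists>pc m. run program (230 + len_com solve * (4000 * (p + 1) * (p + (length ds + length bs) + 1)))
      (0, init_mem p x y ds bs) (pc, m) \<and> halted program (pc, m) \<and> output_correct G p x y m"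
proof -
  let ?m = "length ds + length bs" and ?f = "init_mem p x y ds bs" and ?P = program
  define L where "L = 32 * p + 31 * ?m"
  have L': "L = 32 * p + 31 * (length ds + length bs)" by (simp add: L_def)
  define pc1 where "pc1 = length preamble"
  define pc2 where "pc2 = pc1 + len_com solve"
  have p2: "2 \<le> p" using xy by linarith
  have L: "64 \<le> L" "32 + p \<le> L" "5 + 2 * ?m \<le> L" using p2 by (simp_all add: L_def)
  have nodes: "nodes G = {..<p}" using G(2) by (simp add: encodes_def)
  have xyn: "x \<in> nodes G" "y \<in> nodes G" using xy nodes by auto
  have code: "code_at ?P 0 preamble" "code_at ?P pc1 (comp solve pc1)" "code_at ?P pc2 (postamble pc2)"
    using code_at_mid[of "[]" "program" "[]"] unfolding program_def pc1_def pc2_def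
    by (simp_all only: append_Nil append_Nil2 list.size code_at_append length_comp add_0)
  obtain m1 where m1: "run ?P (length preamble) (0, ?f) (pc1, m1)" "m1 0 = int L" "m1 rP = int p"
    "m1 rND = int (length ds)" "m1 rNB = int (length bs)" "\<forall>i<29. m1 (L + 32 * i) = ?f (i + 3)"
    "\<forall>q. 32 \<le> q \<longrightarrow> (\<forall>i<29. q \<noteq> L + 32 * i) \<longrightarrow> m1 q = ?f q"
    using run_preamble[of ?P ?f p "length ds" "length bs" L, OF code(1) init_mem_values(1-3) p2 L']
    unfolding pc1_def by (elim exE conjE)
  \<comment> \<open>The initial arrays are read off the memory as the preamble leaves it, so that
    \<open>rep\<close> holds by construction.\<close>
  define a1 where "a1 k i = (if k = raw then m1 i else m1 (L + 32 * i + k))" for k i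
  have rep1: "rep L m1 a1 m1" using m1(2) L by (simp add: rep_def a1_def)
  have lo: "\<forall>i<29. a1 aIN i = ?f (i + 3)" using m1(6) by (simp add: a1_def)
  have hi: "\<forall>i. 32 \<le> i \<and> i < L \<longrightarrow> a1 raw i = ?f i" using m1(7) by (simp add: a1_def)
  have zero: "\<forall>v. a1 aCAUS v = 0"
  proof
    fix v
    \<comment> \<open>Saved cells have offset 0 modulo 32, and \<open>aCAUS\<close> has another
      residue; beyond the input such a cell still has its initial 0.\<close>
    have "L + 32 * v + aCAUS \<noteq> L + 32 * i" for i
    proof
      assume "L + 32 * v + aCAUS = L + 32 * i"
      then have "(32 * v + aCAUS) mod 32 = (32 * i) mod 32" by simp
      then show False by simp
    qed
    then have "m1 (L + 32 * v + aCAUS) = ?f (L + 32 * v + aCAUS)" using m1(7) L by simp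
    also have "\<dots> = 0" by (rule init_mem_values(10)) (use L in simp)
    finally show "a1 aCAUS v = 0" by (simp add: a1_def)
  qed
  define good where "good = (\<lambda>(r :: regs) (a :: arrs). (r rF \<noteq> 0 \<longrightarrow> (\<exists>z<p. good_instr G x y z \<and> a aOUT 0 = int z \<and>
         (\<forall>v<p. a aOUT (Suc v) \<noteq> 0 \<longleftrightarrow> v \<in> instr_sep G x y z) \<and> (\<forall>v<p. a raw (v + 32) = a aOUT (v + 31)))) \<and>
      (r rF = 0 \<longrightarrow> (\<forall>z<p. \<not> good_instr G x y z)))"
  have "wp L solve (\<lambda>r a t. good r a \<and> t \<le> 0 + 4000 * (p + 1) * (p + ?m + 1)) m1 a1 0"
    by (rule wp_solve[OF G xy m1(3-5) L_def lo hi zero]) (simp add: good_def)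
  then obtain n r2 a2 where n: "big_step L solve m1 a1 n r2 a2" "good r2 a2" "n \<le> 4000 * (p + 1) * (p + ?m + 1)"
    by (auto simp: wp_def)
  obtain m2 where m2: "run ?P (len_com solve * n) (pc1, m1) (pc2, m2)" "rep L r2 a2 m2"
    using run_comp[OF n(1) code(2) wf_solve rep1 order_refl] unfolding pc2_def by blast
  have m2v: "m2 0 = int L" "m2 rF = r2 rF" "\<And>i. m2 (L + 32 * i + aOUT) = a2 aOUT i"
    "\<And>i. 32 \<le> i \<Longrightarrow> i < L \<Longrightarrow> m2 i = a2 raw i"
    using m2(2) by (auto simp: rep_def)
  obtain pc3 m3 where m3: "run ?P 95 (pc2, m2) (pc3, m3)" "halted ?P (pc3, m3)" "output_correct G p x y m3"
  proof (cases "r2 rF = 0")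
    case True
    obtain pc3 m3 where 3: "run ?P 2 (pc2, m2) (pc3, m3)" "halted ?P (pc3, m3)" "m3 0 = 0"
      using run_postamble_fail[OF code(3), of m2] m2v(2) True by auto
    have "\<not> (\<exists>z W. valid_cis G x y {z} W)"
    proof
      assume "\<exists>z W. valid_cis G x y {z} W"
      then obtain z where z: "good_instr G x y z" using good_instr_exists[OF G(1) xyn xy(3)] by blast
      then have "z < p" using nodes by (auto simp: good_instr_def allowed_def)
      with z n(2) True show False by (auto simp: good_def)
    qed
    then have "output_correct G p x y m3" using 3(3) by (simp add: output_correct_def)
    moreover have "run ?P 95 (pc2, m2) (pc3, m3)" by (rule run_mono[OF 3(1)]) simp
    ultimately show ?thesis using that 3(2) by blast
  next
    case False
    obtain pc3 m3 where 3: "run ?P 95 (pc2, m2) (pc3, m3)" "halted ?P (pc3, m3)" "m3 0 = 1"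
      "m3 1 = m2 (L + aOUT)" "\<forall>v<30. m3 (v + 2) = m2 (L + 32 * (v + 1) + aOUT)" "\<forall>q\<ge>32. m3 q = m2 q"
      using run_postamble_found[OF code(3), of m2 L] m2v(1,2) False L by auto
    obtain z where z: "z < p" "good_instr G x y z" "a2 aOUT 0 = int z"
      "\<forall>v<p. a2 aOUT (Suc v) \<noteq> 0 \<longleftrightarrow> v \<in> instr_sep G x y z" "\<forall>v<p. a2 raw (v + 32) = a2 aOUT (v + 31)"
      using n(2) False by (auto simp: good_def)
    have "m3 1 = int z" using 3(4) m2v(3)[of 0] z(3) by simp
    moreover have out: "m3 (2 + v) = a2 aOUT (Suc v)" if "v < p" for v
    proof (cases "v < 30")
      case True
      then have "m3 (v + 2) = a2 aOUT (v + 1)" using 3(5) m2v(3)[of "v + 1"] by simp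
      then show ?thesis by (simp add: add.commute)
    next
      case False
      \<comment> \<open>From output cell 32 on the entry was put in place by
        \<open>copy_out\<close>, shifted by the 30 entries that the postamble loads.\<close>
      define w where "w = v - 30"
      have w: "2 + v = w + 32" "Suc v = w + 31" "w < p" using False that by (simp_all add: w_def)
      have "m3 (w + 32) = a2 raw (w + 32)" using 3(6) m2v(4) w(3) L by simp
      then show ?thesis unfolding w(1,2) using z(5) w(3) by simp
    qed
    have "v < p" if "v \<in> instr_sep G x y z" for v
      using that nodes by (auto simp: canon_sep_def Let_def allowed_def)
    then have "v < p \<and> m3 (2 + v) \<noteq> 0 \<longleftrightarrow> v \<in> instr_sep G x y z" for v
      using out[of v] z(4) by (cases "v < p") (simp, blast)
    then have "{v. v < p \<and> m3 (2 + v) \<noteq> 0} = instr_sep G x y z" by blast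
    ultimately have "output_correct G p x y m3"
      using 3(3) good_instr_valid[OF G(1) xyn xy(3) z(2)] by (simp add: output_correct_def)
    then show ?thesis using that 3(1,2) by blast
  qed
  have "length preamble + len_com solve * n + 95 \<le> 230 + len_com solve * (4000 * (p + 1) * (p + ?m + 1))"
  proof -
    have "len_com solve * n \<le> len_com solve * (4000 * (p + 1) * (p + ?m + 1))" by (rule mult_le_mono2[OF n(3)])
    moreover have "length preamble = 130" by (simp add: preamble_def)
    ultimately show ?thesis by linarith
  qed
  with run_trans[OF run_trans[OF m1(1) m2(1)] m3(1)] m3(2,3) show ?thesis
    using run_mono by blast
qed

theorem mainTheorem8:
  shows "\<exists>(P :: instr list) (c :: nat).
     \<forall>(G :: nat admg) p x y ds bs.
       wf_admg G \<and> encodes G p ds bs \<and> x < p \<and> y < p \<and> x \<noteq> y \<longrightarrow>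
       (\<exists>t \<le> c * p * (p + (length ds + length bs)).
          halted P (steps P (0, init_mem p x y ds bs) t) \<and>
          output_correct G p x y (snd (steps P (0, init_mem p x y ds bs) t)))"
proof (rule exI[of _ program], rule exI[of _ "230 + 16000 * len_com solve"], intro allI impI)
  fix G :: "nat admg" and p x y ds bs
  assume A: "wf_admg G \<and> encodes G p ds bs \<and> x < p \<and> y < p \<and> x \<noteq> y"
  let ?m = "length ds + length bs" and ?B = "len_com solve"
  obtain pc m t where t: "t \<le> 230 + ?B * (4000 * (p + 1) * (p + ?m + 1))"
    "steps program (0, init_mem p x y ds bs) t = (pc, m)" "halted program (pc, m)" "output_correct G p x y m"
    using program_correct[of G p ds bs x y] A by (auto simp: run_def)
  \<comment> \<open>Since \<open>p\<close> is positive, \<open>p + 1 \<le> 2 * p\<close> and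
    \<open>p + ?m + 1 \<le> 2 * (p + ?m)\<close>; this doubles the constant twice.\<close>
  have "4000 * (p + 1) * (p + ?m + 1) \<le> (8000 * p) * (2 * (p + ?m))" by (rule mult_le_mono) (use A in auto)
  also have "\<dots> = 16000 * (p * (p + ?m))" by simp
  finally have "4000 * (p + 1) * (p + ?m + 1) \<le> 16000 * (p * (p + ?m))" .
  then have "?B * (4000 * (p + 1) * (p + ?m + 1)) \<le> ?B * (16000 * (p * (p + ?m)))" by (rule mult_le_mono2)
  moreover have "1 * 1 \<le> p * (p + ?m)" using A by (intro mult_le_mono) auto
  ultimately have "t \<le> 230 * (p * (p + ?m)) + ?B * (16000 * (p * (p + ?m)))" using t(1) by linarith
  also have "\<dots> = (230 + 16000 * ?B) * p * (p + ?m)" by (simp add: algebra_simps)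
  finally show "\<exists>t \<le> (230 + 16000 * ?B) * p * (p + ?m).
      halted program (steps program (0, init_mem p x y ds bs) t) \<and>
      output_correct G p x y (snd (steps program (0, init_mem p x y ds bs) t))"
    using t(2-4) by (intro exI[of _ t]) simp
qed

end
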